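(* For $\gamma>0$ let $\mathbb{T}^2_\gamma:=\mathbb{R}^2/(2\pi\mathbb{Z}\times 2\pi\gamma\mathbb{Z})$, and say that $\gamma$ is well approximable if for any $\varepsilon>0$ there exist $p,q\in\mathbb{N}$ such that $$\Big|q^2-\frac{p^2}{\gamma^2}\Big|<\varepsilon .$$ (i) If $\gamma>0$ is well approximable, then the $L^4$ Strichartz estimate does not hold on $\mathbb{T}^2_\gamma$ for any $T>0$; that is, for every $T>0$ there is no constant $C<\infty$ such that $$\|e^{it\Delta}\phi\|_{L^4_{t,x}([0,T]\times\mathbb{T}^2_\gamma)}\le C\,\|\phi\|_{L^2(\mathbb{T}^2_\gamma)}\qquad\text{for all }\phi\in L^2(\mathbb{T}^2_\gamma).$$ (ii) Let $\gamma>0$ be well approximable, $\mu\in\{1,-1\}$, and let $T,r>0$ be arbitrarily small positive constants. Consider the initial value problem $$i\partial_t u+\Delta u=\mu|u|^{2}u,\qquad u(0,x)=u_0(x),\qquad x\in\mathbb{T}^2_\gamma .$$ Assume that the data-to-solution map $S:u_0\mapsto u(\cdot)$ associated with this problem on smooth data extends continuously to a map from the closed ball $\{u_0\in L^2(\mathbb{T}^2_\gamma):\|u_0\|_{L^2(\mathbb{T}^2_\gamma)}\le r\}$ into $C([0,T];L^2(\mathbb{T}^2_\gamma))$. Then this (extended) map is not $C^3$ at the origin. (iii) The set of all $\gamma>0$ that are not well approximable has Lebesgue measure zero.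
   Context: $\mathbb{N}=\{1,2,\dots\}$; functions are complex-valued. $e^{it\Delta}$ denotes the free Schrödinger propagator on $\mathbb{T}^2_\gamma$, i.e. the Fourier multiplier acting by $e^{it\Delta}e^{i\xi\cdot x}=e^{-i|\xi|^2t}e^{i\xi\cdot x}$ for $\xi\in\mathbb{Z}\times\frac1\gamma\mathbb{Z}$. The data-to-solution map on smooth data sends $u_0\in C^\infty(\mathbb{T}^2_\gamma)$ with $\|u_0\|_{L^2}\le r$ to the corresponding smooth solution $u$ of the initial value problem on $[0,T]\times\mathbb{T}^2_\gamma$. $L^2(\mathbb{T}^2_\gamma)$ and $C([0,T];L^2(\mathbb{T}^2_\gamma))$ (with the norm $\sup_{t\in[0,T]}\|u(t)\|_{L^2}$) are regarded as real Banach spaces, and "$C^3$ at the origin" refers to three-times continuous Fréchet differentiability of the map near the origin $u_0=0$. *)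

theory Defs
  imports "HOL-Analysis.Analysis" "HOL-Library.Function_Algebras"
begin

instantiation "fun" :: (type, real_vector) real_vector
begin

definition scaleR_fun :: "real \<Rightarrow> ('a \<Rightarrow> 'b) \<Rightarrow> 'a \<Rightarrow> 'b" where
  "scaleR_fun c f = (\<lambda>x. c *\<^sub>R f x)"

instance
  by standard (auto simp: scaleR_fun_def plus_fun_def algebra_simps)

end

text \<open>
  The spaces below depend on real parameters (the aspect ratio \<open>\<gamma>\<close>, the time \<open>T\<close>), so they
  cannot be types, and \<^const>\<open>has_derivative\<close> is not available for them. A Banach space such as
  \<open>L\<^sup>2\<close> is represented by the vector space \<open>vecs E\<close> of its representatives together with the
  seminorm \<open>snorm E\<close>; its elements are the representatives modulo vectors of seminorm zero.
  Accordingly linearity is only required modulo vectors of seminorm zero.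
\<close>

record 'a seminormed =
  vecs :: "'a set"
  snorm :: "'a \<Rightarrow> real"

definition snorm_cball :: "('a, 'm) seminormed_scheme \<Rightarrow> real \<Rightarrow> 'a set" where
  "snorm_cball E r = {x \<in> vecs E. snorm E x \<le> r}"

definition snorm_continuous_on ::
  "'a::real_vector seminormed \<Rightarrow> 'b::real_vector seminormed \<Rightarrow> 'a set \<Rightarrow> ('a \<Rightarrow> 'b) \<Rightarrow> bool" where
  "snorm_continuous_on E F B f \<longleftrightarrow>
     (\<forall>x\<in>B. \<forall>e>0. \<exists>d>0. \<forall>y\<in>B. snorm E (y - x) < d \<longrightarrow> snorm F (f y - f x) < e)"

definition bounded_lin ::
  "'a::real_vector seminormed \<Rightarrow> 'b::real_vector seminormed \<Rightarrow> ('a \<Rightarrow> 'b) \<Rightarrow> bool" where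
  "bounded_lin E F A \<longleftrightarrow>
     (\<forall>x\<in>vecs E. A x \<in> vecs F) \<and>
     (\<forall>x\<in>vecs E. \<forall>y\<in>vecs E. snorm F (A (x + y) - (A x + A y)) = 0) \<and>
     (\<forall>c. \<forall>x\<in>vecs E. snorm F (A (c *\<^sub>R x) - c *\<^sub>R A x) = 0) \<and>
     (\<exists>K. \<forall>x\<in>vecs E. snorm F (A x) \<le> K * snorm E x)"

definition blin_space ::
  "'a::real_vector seminormed \<Rightarrow> 'b::real_vector seminormed \<Rightarrow> ('a \<Rightarrow> 'b) seminormed" where
  "blin_space E F =
     \<lparr>vecs = {A. bounded_lin E F A}, snorm = (\<lambda>A. SUP x\<in>snorm_cball E 1. snorm F (A x))\<rparr>"

definition has_frechet ::
  "'a::real_vector seminormed \<Rightarrow> 'b::real_vector seminormed \<Rightarrow> ('a \<Rightarrow> 'b) \<Rightarrow> ('a \<Rightarrow> 'b) \<Rightarrow> 'a \<Rightarrow> bool" where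
  "has_frechet E F f A x \<longleftrightarrow>
     bounded_lin E F A \<and>
     (\<forall>e>0. \<exists>d>0. \<forall>h\<in>vecs E. snorm E h < d \<longrightarrow>
        snorm F (f (x + h) - f x - A h) \<le> e * snorm E h)"

definition C3_near ::
  "'a::real_vector seminormed \<Rightarrow> 'b::real_vector seminormed \<Rightarrow> ('a \<Rightarrow> 'b) \<Rightarrow> 'a \<Rightarrow> bool" where
  "C3_near E F f x0 \<longleftrightarrow>
     (\<exists>\<rho>>0. \<exists>f1 f2 f3. let B = {x \<in> vecs E. snorm E (x - x0) < \<rho>} in
        (\<forall>x\<in>B. f x \<in> vecs F \<and>
           has_frechet E F f (f1 x) x \<and>
           has_frechet E (blin_space E F) f1 (f2 x) x \<and>
           has_frechet E (blin_space E (blin_space E F)) f2 (f3 x) x) \<and>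
        snorm_continuous_on E (blin_space E (blin_space E (blin_space E F))) B f3)"

lemma has_frechet_UNIV_iff:
  fixes f :: "'a::real_normed_vector \<Rightarrow> 'b::real_normed_vector"
  shows "has_frechet \<lparr>vecs = UNIV, snorm = norm\<rparr> \<lparr>vecs = UNIV, snorm = norm\<rparr> f A x
           \<longleftrightarrow> (f has_derivative A) (at x)"
proof -
  have "bounded_lin \<lparr>vecs = UNIV, snorm = norm\<rparr> \<lparr>vecs = UNIV, snorm = norm\<rparr> A \<longleftrightarrow> bounded_linear A"
    unfolding bounded_lin_def
    by (auto simp: bounded_linear_def bounded_linear_axioms_def linear_iff mult.commute)
  moreover have "(\<forall>e>0. \<exists>d>0. \<forall>h. norm h < d \<longrightarrow> norm (f (x + h) - f x - A h) \<le> e * norm h)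
      \<longleftrightarrow> (\<forall>e>0. \<exists>d>0. \<forall>y. norm (y - x) < d \<longrightarrow> norm (f y - f x - A (y - x)) \<le> e * norm (y - x))"
    by (metis (no_types, lifting) add_diff_cancel_left' diff_add_cancel add.commute)
  ultimately show ?thesis
    unfolding has_frechet_def has_derivative_at_alt by auto
qed

definition curve_space :: "real \<Rightarrow> 'a::real_vector seminormed \<Rightarrow> (real \<Rightarrow> 'a) seminormed" where
  "curve_space T F =
     \<lparr>vecs = {u. \<forall>t\<in>{0..T}. u t \<in> vecs F \<and>
                   ((\<lambda>s. snorm F (u s - u t)) \<longlongrightarrow> 0) (at t within {0..T})},
      snorm = (\<lambda>u. SUP t\<in>{0..T}. snorm F (u t))\<rparr>"

text \<open>
  Functions on the torus are functions on the plane with periods \<open>2\<pi>\<close> and \<open>2\<pi>\<gamma>\<close>; integrals over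
  the torus are integrals over the period cell.
\<close>

definition well_approximable :: "real \<Rightarrow> bool" where
  "well_approximable \<gamma> \<longleftrightarrow>
     (\<forall>\<epsilon>>0. \<exists>p q :: nat. p \<ge> 1 \<and> q \<ge> 1 \<and> \<bar>(real q)\<^sup>2 - (real p)\<^sup>2 / \<gamma>\<^sup>2\<bar> < \<epsilon>)"

definition torus_periodic :: "real \<Rightarrow> (real \<times> real \<Rightarrow> complex) \<Rightarrow> bool" where
  "torus_periodic \<gamma> f \<longleftrightarrow>
     (\<forall>a b. f (a + 2 * pi, b) = f (a, b) \<and> f (a, b + 2 * pi * \<gamma>) = f (a, b))"

definition torus_measure :: "real \<Rightarrow> (real \<times> real) measure" where
  "torus_measure \<gamma> = restrict_space lborel ({0..<2 * pi} \<times> {0..<2 * pi * \<gamma>})"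

definition L2 :: "real \<Rightarrow> (real \<times> real \<Rightarrow> complex) seminormed" where
  "L2 \<gamma> =
     \<lparr>vecs = {f. torus_periodic \<gamma> f \<and> f \<in> borel_measurable borel \<and>
                 integrable (torus_measure \<gamma>) (\<lambda>x. (norm (f x))\<^sup>2)},
      snorm = (\<lambda>f. sqrt (LINT x|torus_measure \<gamma>. (norm (f x))\<^sup>2))\<rparr>"

definition freq :: "real \<Rightarrow> int \<times> int \<Rightarrow> real \<times> real" where
  "freq \<gamma> k = (of_int (fst k), of_int (snd k) / \<gamma>)"

definition fourier_coeff :: "real \<Rightarrow> (real \<times> real \<Rightarrow> complex) \<Rightarrow> int \<times> int \<Rightarrow> complex" where
  "fourier_coeff \<gamma> f k =
     (LINT x|torus_measure \<gamma>. f x * exp (- \<i> * of_real (freq \<gamma> k \<bullet> x))) / of_real (4 * pi\<^sup>2 * \<gamma>)"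

text \<open>
  \<open>schroedinger \<gamma> \<phi> t\<close> is \<open>e\<^sup>i\<^sup>t\<^sup>\<Delta> \<phi>\<close>. The Fourier coefficients determine it for every \<open>t\<close> up to null
  sets in \<open>x\<close>; joint measurability in \<open>(t, x)\<close>, needed for space-time norms, can be arranged because
  a subsequence of the partial Fourier sums, chosen independently of \<open>t\<close>, converges almost
  everywhere in \<open>x\<close> for every \<open>t\<close>.
\<close>

definition schroedinger :: "real \<Rightarrow> (real \<times> real \<Rightarrow> complex) \<Rightarrow> real \<Rightarrow> real \<times> real \<Rightarrow> complex" where
  "schroedinger \<gamma> \<phi> = (SOME u.
     (\<lambda>(t, x). u t x) \<in> borel_measurable borel \<and>
     (\<forall>t. u t \<in> vecs (L2 \<gamma>) \<and>
        (\<forall>k. fourier_coeff \<gamma> (u t) k =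
               exp (- \<i> * of_real ((norm (freq \<gamma> k))\<^sup>2 * t)) * fourier_coeff \<gamma> \<phi> k)))"

definition L4_norm :: "real \<Rightarrow> real \<Rightarrow> (real \<Rightarrow> real \<times> real \<Rightarrow> complex) \<Rightarrow> ennreal" where
  "L4_norm T \<gamma> u =
     (let M = restrict_space lborel {0..T} \<Otimes>\<^sub>M torus_measure \<gamma>;
          g = (\<lambda>(t, x). norm (u t x) ^ 4)
      in if integrable M g then ennreal (root 4 (integral\<^sup>L M g)) else \<infinity>)"

definition L4_strichartz :: "real \<Rightarrow> real \<Rightarrow> bool" where
  "L4_strichartz \<gamma> T \<longleftrightarrow>
     (\<exists>C::real. \<forall>\<phi>\<in>vecs (L2 \<gamma>). L4_norm T \<gamma> (schroedinger \<gamma> \<phi>) \<le> ennreal (C * snorm (L2 \<gamma>) \<phi>))"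

text \<open>
  \<open>C\<^sup>\<infinity>\<close> on \<open>S\<close>: all iterated directional derivatives exist as Frechet derivatives within \<open>S\<close>. The
  sets used are the plane and closed slabs \<open>[0,T] \<times> \<real>\<^sup>2\<close> with \<open>T > 0\<close>, where these derivatives are
  unique (and one-sided in time at the end points).
\<close>

coinductive smooth_on ::
  "'a::euclidean_space set \<Rightarrow> ('a \<Rightarrow> 'b::real_normed_vector) \<Rightarrow> bool" for S where
  "\<lbrakk>\<And>x. x \<in> S \<Longrightarrow> (f has_derivative D x) (at x within S); \<And>h. smooth_on S (\<lambda>x. D x h)\<rbrakk>
     \<Longrightarrow> smooth_on S f"

definition smooth_torus :: "real \<Rightarrow> (real \<times> real \<Rightarrow> complex) \<Rightarrow> bool" where
  "smooth_torus \<gamma> f \<longleftrightarrow> torus_periodic \<gamma> f \<and> smooth_on UNIV f"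

definition laplacian :: "('a::euclidean_space \<Rightarrow> 'b::real_normed_vector) \<Rightarrow> 'a \<Rightarrow> 'b" where
  "laplacian f x =
     (\<Sum>e\<in>Basis. vector_derivative (\<lambda>s. vector_derivative (\<lambda>r. f (x + r *\<^sub>R e)) (at s)) (at 0))"

definition nls_smooth_solution ::
  "real \<Rightarrow> real \<Rightarrow> real \<Rightarrow> (real \<times> real \<Rightarrow> complex) \<Rightarrow> (real \<Rightarrow> real \<times> real \<Rightarrow> complex) \<Rightarrow> bool" where
  "nls_smooth_solution \<gamma> \<mu> T u0 u \<longleftrightarrow>
     smooth_on ({0..T} \<times> UNIV) (\<lambda>(t, x). u t x) \<and>
     (\<forall>t\<in>{0..T}. torus_periodic \<gamma> (u t)) \<and>
     u 0 = u0 \<and>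
     (\<forall>t\<in>{0..T}. \<forall>x.
        \<i> * vector_derivative (\<lambda>s. u s x) (at t within {0..T}) + laplacian (u t) x
          = of_real (\<mu> * (norm (u t x))\<^sup>2) * u t x)"

text \<open>
  \<open>S\<close> extends the data-to-solution map on smooth data in the ball of radius \<open>r\<close>. That this map is
  defined, i.e. that the smooth solution exists up to time \<open>T\<close>, is part of the condition; smooth
  solutions are unique, so it does not matter that one is chosen existentially.
\<close>

definition extends_nls_flow ::
  "real \<Rightarrow> real \<Rightarrow> real \<Rightarrow> real \<Rightarrow> ((real \<times> real \<Rightarrow> complex) \<Rightarrow> real \<Rightarrow> real \<times> real \<Rightarrow> complex) \<Rightarrow> bool" where
  "extends_nls_flow \<gamma> \<mu> T r S \<longleftrightarrow>
     (\<forall>u0. smooth_torus \<gamma> u0 \<and> snorm (L2 \<gamma>) u0 \<le> r \<longrightarrow>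
        (\<exists>u. nls_smooth_solution \<gamma> \<mu> T u0 u \<and>
             (\<forall>t\<in>{0..T}. AE x in torus_measure \<gamma>. S u0 t x = u t x)))"

end

theory Submission
  imports Defs "HOL-Number_Theory.Totient"
begin

text \<open>
  Parts (i) and (ii) share one mechanism, a comparison with the square torus, where the \<open>L\<^sup>4\<close> estimate
  is known to fail by a logarithm.

  Let \<open>v\<close> be the linear evolution of a sum of \<open>N\<^sup>2\<close> characters whose frequencies form an
  \<open>N \<times> N\<close> box in a square lattice of mesh \<open>q\<close>. Expanding \<open>|v|\<^sup>4\<close> and integrating over the torus and
  over a time period \<open>2\<pi>/q\<^sup>2\<close> leaves exactly the quadruples of frequencies that form a (possibly
  degenerate) rectangle. Their number exceeds every multiple of \<open>N\<^sup>4\<close>, in fact by a logarithm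
  (\<open>rectangles_superquartic\<close>), whereas \<open>\<parallel>v\<parallel>\<^sub>2\<^sup>4\<close> is of the order of \<open>N\<^sup>4\<close>. If \<open>\<gamma>\<close> is well approximable,
  the frequency lattice \<open>\<int> \<times> \<gamma>\<inverse>\<int>\<close> contains sublattices \<open>q\<int> \<times> (p/\<gamma>)\<int>\<close> for which \<open>q\<^sup>2 - p\<^sup>2/\<gamma>\<^sup>2\<close> is
  as small as desired. For fixed \<open>N\<close> and \<open>T\<close> the phases on such a sublattice are then as close as
  desired to those of the square lattice, uniformly on \<open>[0,T]\<close>; replacing \<open>(p,q)\<close> by a multiple
  makes \<open>q\<close> large, so that \<open>[0,T]\<close> contains a full period. Hence the quotient of
  \<open>\<integral>\<^sub>0\<^sup>T \<parallel>v(t)\<parallel>\<^sub>4\<^sup>4 dt\<close> by \<open>\<parallel>v\<parallel>\<^sub>2\<^sup>4\<close> is unbounded (\<open>free_wave_strichartz_ratio_unbounded\<close>).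

  Part (i). The evolution of a trigonometric polynomial \<open>\<phi>\<close> is only specified through its Fourier
  coefficients. Testing against \<open>|v|\<^sup>2 v\<close>, again a trigonometric polynomial, shows that any square
  integrable function with the Fourier coefficients of \<open>v(t)\<close> has at least the \<open>L\<^sup>4\<close> norm of \<open>v(t)\<close>
  (\<open>L4_norm_trig_poly_le\<close>), so the unbounded quotient contradicts the estimate.

  Part (ii). Let \<open>u\<close> be the solution with data \<open>\<delta>\<phi>\<close>. Then
  \<open>\<langle>u(T), v(T)\<rangle> = \<delta>\<parallel>\<phi>\<parallel>\<^sup>2 - i\<mu>\<delta>\<^sup>3 \<integral>\<^sub>0\<^sup>T \<parallel>v\<parallel>\<^sub>4\<^sup>4 dt + O(\<delta>\<^sup>4)\<close> (\<open>nls_cubic_expansion\<close>), where the constant in the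
  error may depend on \<open>\<phi>\<close>. A map that is \<open>C\<^sup>3\<close> near the origin has cubic Taylor coefficients bounded by
  \<open>B\<parallel>\<phi>\<parallel>\<^sup>3\<close> with \<open>B\<close> independent of \<open>\<phi>\<close> (\<open>C3_near_cubic_coefficient\<close>), so
  \<open>\<integral>\<^sub>0\<^sup>T \<parallel>v\<parallel>\<^sub>4\<^sup>4 dt \<le> B\<parallel>\<phi>\<parallel>\<^sup>4\<close> for all \<open>\<phi>\<close>, which is again impossible. The expansion rests on the a priori
  bound \<open>\<parallel>u(t)\<parallel>\<^sub>4 = O(\<delta>)\<close>, a consequence of the conservation of mass and energy and of Ladyzhenskaya's
  inequality, which for small mass controls the energy from below for both signs of \<open>\<mu>\<close>. Given this bound,
  \<open>\<langle>u(t), v(t)\<rangle>\<close> differs from \<open>\<delta>\<parallel>\<phi>\<parallel>\<^sup>2\<close> by \<open>O(\<delta>\<^sup>3)\<close>, and since mass is conserved for both \<open>u\<close> and \<open>v\<close> this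
  forces \<open>\<parallel>u - \<delta>v\<parallel>\<^sub>2\<^sup>2 = O(\<delta>\<^sup>4)\<close>, which suffices to replace \<open>u\<close> by \<open>\<delta>v\<close> in the cubic term.

  Part (iii). If \<open>\<gamma>\<close> is not well approximable, then \<open>1/\<gamma>\<close> is badly approximable. Around a positive irrational
  number the intervals of radius \<open>1/p\<^sup>2\<close> about its Dirichlet approximants \<open>q/p\<close> form a Vitali cover, and
  a fixed proportion of each of them consists of numbers that are too close to \<open>q/p\<close> to be
  \<open>c\<close>-badly approximable. Hence the badly approximable numbers form a null set.
\<close>

section \<open>Badly approximable numbers\<close>

text \<open>
  The denominator is called \<open>p\<close> and the numerator \<open>q\<close>, as in
  \<open>well_approximable\<close>, where \<open>q\<^sup>2 - p\<^sup>2/\<gamma>\<^sup>2\<close> measures how well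
  \<open>q/p\<close> approximates \<open>\<alpha> = 1/\<gamma>\<close>.
\<close>

definition badly_approximable :: "real \<Rightarrow> real set" where
  "badly_approximable c =
     {\<alpha>. \<forall>p q :: nat. p \<ge> 1 \<longrightarrow> q \<ge> 1 \<longrightarrow> \<bar>\<alpha> - real q / real p\<bar> \<ge> c / (real p)\<^sup>2}"

lemma closed_badly_approximable: "closed (badly_approximable c)"
proof -
  have "badly_approximable c = (\<Inter>p\<in>{1..}. \<Inter>q\<in>{1..}. - ball (real q / real p) (c / (real p)\<^sup>2))"
    unfolding badly_approximable_def ball_def dist_real_def by (force simp: abs_minus_commute not_less)
  then show ?thesis by (auto intro!: closed_INT)
qed

text \<open>
  Dirichlet's theorem in the form of a Vitali cover: the approximants can be taken with denominators beyond any
  bound, and a positive number has positive approximants.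
\<close>

lemma irrational_approximation:
  fixes x d :: real
  assumes "x \<notin> \<rat>" "x > 0" "d > 0"
  obtains p q :: nat where "p \<ge> 1" "q \<ge> 1" "x \<in> cball (real q / real p) (1 / (real p)\<^sup>2)"
    "1 / (real p)\<^sup>2 < d"
proof -
  have "infinite (approx_set x)" using assms rational_iff_finite_approx_set by blast
  moreover obtain K0 :: int where K0: "of_int K0 > max 1 (max (1/d) (1/x))" using ex_less_of_int by blast
  ultimately obtain h k where hk: "(h,k) \<in> approx_set x" and "k > K0"
    using infinite_approx_set by blast
  then have k: "real_of_int k > 1" "real_of_int k > 1/d" "real_of_int k > 1/x"
    using K0 of_int_less_iff[of K0 k, where 'a=real] by linarith+
  have k0: "k > 0" and ap: "\<bar>x - of_int h / of_int k\<bar> < 1 / (of_int k)\<^sup>2"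
    using hk by (auto simp: approx_set_def)
  have sq: "(real_of_int k)\<^sup>2 > real_of_int k" using k by (simp add: power2_eq_square)
  have "1 / (of_int k)\<^sup>2 < d"
  proof -
    have "1 / (real_of_int k)\<^sup>2 < 1 / real_of_int k" using sq k by (intro divide_strict_left_mono) auto
    also have "\<dots> < d" using k assms by (simp add: field_simps)
    finally show ?thesis .
  qed
  moreover have "h \<ge> 1"
  proof -
    have "1 / (of_int k)\<^sup>2 = (1 / of_int k) / real_of_int k" by (simp add: power2_eq_square)
    also have "\<dots> \<le> 1 / of_int k" using k by (simp add: field_simps)
    also have "\<dots> < x" using k assms by (simp add: field_simps)
    finally have "of_int h / real_of_int k > 0" using ap by linarith
    then show ?thesis using k0 by (simp add: zero_less_divide_iff)
  qed
  ultimately show thesis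
    using that[of "nat k" "nat h"] k0 ap by (auto simp: dist_real_def abs_minus_commute)
qed

text \<open>
  The concentric ball whose radius is smaller by the factor \<open>c\<close> is excluded by the definition of bad
  approximability.
\<close>

lemma badly_approximable_ball:
  assumes "0 < c" "c \<le> 1" "p \<ge> 1" "q \<ge> (1::nat)"
  shows "emeasure lebesgue (badly_approximable c \<inter> cball (real q / real p) (1 / (real p)\<^sup>2))
           \<le> ennreal (1 - c) * emeasure lebesgue (cball (real q / real p) (1 / (real p)\<^sup>2))"
proof -
  define x r where "x = real q / real p" and "r = 1 / (real p)\<^sup>2"
  have r: "r > 0" using assms by (simp add: r_def)
  have "badly_approximable c \<inter> cball x r \<subseteq> cball x r - ball x (c * r)"
    using assms unfolding badly_approximable_def x_def r_def
    by (auto simp: dist_real_def abs_minus_commute) (meson not_less)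
  then have "emeasure lebesgue (badly_approximable c \<inter> cball x r) \<le> emeasure lebesgue (cball x r - ball x (c * r))"
    by (intro emeasure_mono) auto
  also have "\<dots> = emeasure lebesgue (cball x r) - emeasure lebesgue (ball x (c * r))"
  proof (intro emeasure_Diff)
    have "c * r \<le> r" using r assms by simp
    then show "ball x (c * r) \<subseteq> cball x r" by (auto simp: dist_real_def)
  qed (use r assms in \<open>auto simp: ball_eq_greaterThanLessThan\<close>)
  also have "\<dots> = ennreal (2 * r - 2 * (c * r))"
    using r assms by (subst ennreal_minus[symmetric]) (auto simp: ball_eq_greaterThanLessThan cball_eq_atLeastAtMost)
  also have "\<dots> = ennreal (1 - c) * ennreal (2 * r)"
    using r assms by (subst ennreal_mult[symmetric]) (auto simp: algebra_simps)
  also have "ennreal (2 * r) = emeasure lebesgue (cball x r)"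
    using r by (simp add: cball_eq_atLeastAtMost)
  finally show ?thesis unfolding x_def r_def .
qed

text \<open>
  If the set had measure \<open>m > 0\<close>, an open set \<open>U\<close> around it of measure at most \<open>(1
  + c) m\<close> could be filled, up to a null set of the points in question, with disjoint approximation balls,
  and \<open>badly_approximable_ball\<close> would give \<open>m \<le> (1 - c)(1 + c) m < m\<close>.
\<close>

lemma negligible_badly_approximable:
  assumes c: "0 < c" "c \<le> 1"
  shows "negligible (badly_approximable c \<inter> {0<..<b})"
proof -
  define A where "A = badly_approximable c \<inter> {0<..<b} - \<rat>"
  have Aset: "A \<in> sets lebesgue"
    unfolding A_def using closed_badly_approximable[of c] countable_rat
    by (intro sets.Diff sets.Int) (auto intro: sets.countable)
  have fin: "emeasure lebesgue A < \<infinity>"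
  proof -
    have "emeasure lebesgue A \<le> emeasure lebesgue {0..max 0 b}"
      by (intro emeasure_mono) (auto simp: A_def)
    also have "\<dots> < \<infinity>" by simp
    finally show ?thesis .
  qed
  define m where "m = measure lebesgue A"
  have m: "emeasure lebesgue A = ennreal m"
    unfolding m_def using fin by (intro emeasure_eq_ennreal_measure) auto
  have "m = 0"
  proof (rule ccontr)
    assume "m \<noteq> 0"
    then have mpos: "m > 0" using measure_nonneg[of lebesgue A] unfolding m_def by linarith
    then have "c * m > 0" using c by simp
    then obtain U where U: "open U" "A \<subseteq> U" "U - A \<in> lmeasurable" "emeasure lebesgue (U - A) < ennreal (c * m)"
      using sets_lebesgue_outer_open[OF Aset] by metis
    have eU: "emeasure lebesgue U \<le> ennreal (m + c * m)"
    proof -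
      have "emeasure lebesgue U \<le> emeasure lebesgue A + emeasure lebesgue (U - A)"
        using U Aset by (metis Un_Diff_cancel Un_absorb1 emeasure_subadditive fmeasurableD)
      also have "\<dots> \<le> ennreal m + ennreal (c * m)"
        using m U(4) by (intro add_mono) auto
      also have "\<dots> = ennreal (m + c * m)" using mpos c by simp
      finally show ?thesis .
    qed
    define a r where "a = (\<lambda>(p::nat, q::nat). real q / real p)" and "r = (\<lambda>(p::nat, q::nat). 1 / (real p)\<^sup>2)"
    define K where "K = {(p, q). p \<ge> 1 \<and> q \<ge> 1 \<and> cball (a (p, q)) (r (p, q)) \<subseteq> U}"
    obtain C where C: "countable C" "C \<subseteq> K"
      "pairwise (\<lambda>i j. disjnt (cball (a i) (r i)) (cball (a j) (r j))) C"
      "negligible (A - (\<Union>i \<in> C. cball (a i) (r i)))"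
    proof (rule Vitali_covering_theorem_cballs[of K r A a])
      show "\<And>i. i \<in> K \<Longrightarrow> 0 < r i" by (auto simp: K_def r_def)
      fix x d :: real assume x: "x \<in> A" and d: "d > 0"
      obtain e where e: "e > 0" "ball x e \<subseteq> U" using U x by (meson openE subsetD)
      have "x \<notin> \<rat>" "x > 0" using x by (auto simp: A_def)
      then obtain p q where pq: "p \<ge> 1" "q \<ge> 1" "x \<in> cball (real q / real p) (1 / (real p)\<^sup>2)"
        "1 / (real p)\<^sup>2 < min d (e/2)"
        using irrational_approximation[of x "min d (e/2)"] d e by (metis half_gt_zero min_less_iff_conj)
      have "cball (real q / real p) (1 / (real p)\<^sup>2) \<subseteq> ball x e"
        using pq(3,4) by (auto simp: dist_real_def)
      then show "\<exists>i. i \<in> K \<and> x \<in> cball (a i) (r i) \<and> r i < d"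
        using pq e by (intro exI[of _ "(p, q)"]) (auto simp: K_def a_def r_def)
    qed
    have disj: "disjoint_family_on (\<lambda>i. cball (a i) (r i)) C"
      using C(3) by (auto simp: pairwise_def disjoint_family_on_def disjnt_def)
    then have disj': "disjoint_family_on (\<lambda>i. A \<inter> cball (a i) (r i)) C"
      unfolding disjoint_family_on_def by blast
    have Cset: "(\<Union>i\<in>C. cball (a i) (r i)) \<in> sets lebesgue"
      using C(1) by (intro sets.countable_UN'') auto
    have "(\<Union>i\<in>C. A \<inter> cball (a i) (r i)) = A \<inter> (\<Union>i\<in>C. cball (a i) (r i))" by blast
    then have ACset: "(\<Union>i\<in>C. A \<inter> cball (a i) (r i)) \<in> sets lebesgue" using Aset Cset by (metis sets.Int)
    have "emeasure lebesgue A \<le> emeasure lebesgue ((A - (\<Union>i \<in> C. cball (a i) (r i))) \<union> (\<Union>i\<in>C. A \<inter> cball (a i) (r i)))"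
      by (intro emeasure_mono sets.Un sets.Diff Aset Cset ACset) blast
    also have "\<dots> \<le> emeasure lebesgue (A - (\<Union>i \<in> C. cball (a i) (r i))) + emeasure lebesgue (\<Union>i\<in>C. A \<inter> cball (a i) (r i))"
      by (intro emeasure_subadditive sets.Diff Aset Cset ACset)
    also have "emeasure lebesgue (A - (\<Union>i \<in> C. cball (a i) (r i))) = 0"
      using C(4) by (simp add: negligible_iff_null_sets null_sets_def)
    also have "emeasure lebesgue (\<Union>i\<in>C. A \<inter> cball (a i) (r i)) = (\<integral>\<^sup>+i. emeasure lebesgue (A \<inter> cball (a i) (r i)) \<partial>count_space C)"
      using Aset C(1) disj' by (intro emeasure_UN_countable) auto
    also have "\<dots> \<le> (\<integral>\<^sup>+i. ennreal (1 - c) * emeasure lebesgue (cball (a i) (r i)) \<partial>count_space C)"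
    proof (intro nn_integral_mono)
      fix i assume "i \<in> space (count_space C)"
      then have "i \<in> K" using C by auto
      then obtain p q where i: "i = (p, q)" "p \<ge> 1" "q \<ge> 1" by (auto simp: K_def)
      have "emeasure lebesgue (A \<inter> cball (a i) (r i)) \<le> emeasure lebesgue (badly_approximable c \<inter> cball (a i) (r i))"
        using closed_badly_approximable[of c] by (intro emeasure_mono) (auto simp: A_def)
      also have "\<dots> \<le> ennreal (1 - c) * emeasure lebesgue (cball (a i) (r i))"
        using badly_approximable_ball[OF c i(2,3)] i by (simp add: a_def r_def)
      finally show "emeasure lebesgue (A \<inter> cball (a i) (r i)) \<le> ennreal (1 - c) * emeasure lebesgue (cball (a i) (r i))" .
    qed
    also have "\<dots> = ennreal (1 - c) * (\<integral>\<^sup>+i. emeasure lebesgue (cball (a i) (r i)) \<partial>count_space C)"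
      by (intro nn_integral_cmult) auto
    also have "(\<integral>\<^sup>+i. emeasure lebesgue (cball (a i) (r i)) \<partial>count_space C) = emeasure lebesgue (\<Union>i\<in>C. cball (a i) (r i))"
      using C(1) disj by (intro emeasure_UN_countable[symmetric]) auto
    also have "\<dots> \<le> emeasure lebesgue U"
      using C(2) U(1) by (intro emeasure_mono) (auto simp: K_def)
    also have "\<dots> \<le> ennreal (m + c * m)" by (rule eU)
    finally have "ennreal m \<le> ennreal (1 - c) * ennreal (m + c * m)"
      unfolding m by (simp add: mult_left_mono)
    also have "\<dots> = ennreal ((1 - c) * (m + c * m))" using c mpos by (simp add: ennreal_mult)
    finally have "m \<le> (1 - c) * (m + c * m)" using c mpos by simp
    also have "\<dots> = m - c\<^sup>2 * m" by (simp add: algebra_simps power2_eq_square)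
    finally have "c\<^sup>2 * m \<le> 0" by simp
    moreover have "c\<^sup>2 * m > 0" using c mpos by simp
    ultimately show False by linarith
  qed
  then have "negligible A" using m Aset by (simp add: negligible_iff_null_sets null_sets_def)
  then have "negligible (A \<union> \<rat>)"
    using countable_imp_null_set_lborel[OF countable_rat]
    by (intro negligible_Un) (auto simp: negligible_iff_null_sets intro: null_sets_completionI)
  then show ?thesis by (rule negligible_subset) (auto simp: A_def)
qed

text \<open>
  With \<open>\<alpha> = 1/\<gamma>\<close> the form factorises as \<open>q\<^sup>2 - p\<^sup>2\<alpha>\<^sup>2 =
  (q - p\<alpha>)(q + p\<alpha>)\<close>, and the second factor is at most \<open>(2\<alpha> + 1) p\<close> when
  the first one is at most \<open>1\<close> in absolute value.
\<close>

lemma not_well_approximable_imp: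
  assumes "\<gamma> > 0" "\<not> well_approximable \<gamma>"
  shows "\<exists>n::nat. inverse \<gamma> \<in> badly_approximable (1 / real (Suc n)) \<inter> {0<..<real n}"
proof -
  obtain \<epsilon> where e: "\<epsilon> > 0" "\<And>p q :: nat. p \<ge> 1 \<Longrightarrow> q \<ge> 1 \<Longrightarrow> \<bar>(real q)\<^sup>2 - (real p)\<^sup>2 / \<gamma>\<^sup>2\<bar> \<ge> \<epsilon>"
    using assms(2) unfolding well_approximable_def by (meson not_less)
  define \<alpha> where "\<alpha> = inverse \<gamma>"
  have a: "\<alpha> > 0" using assms by (simp add: \<alpha>_def)
  obtain n :: nat where n: "real n > max ((2 * \<alpha> + 1) / \<epsilon>) \<alpha>" using reals_Archimedean2 by blast
  have "1 / real (Suc n) \<le> \<bar>\<alpha> - real q / real p\<bar> * (real p)\<^sup>2" if pq: "p \<ge> 1" "q \<ge> 1" for p q :: nat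
  proof (rule ccontr)
    assume "\<not> ?thesis"
    moreover have "\<bar>\<alpha> - real q / real p\<bar> * (real p)\<^sup>2 = \<bar>real q - real p * \<alpha>\<bar> * real p"
    proof -
      have "\<alpha> - real q / real p = - ((real q - real p * \<alpha>) / real p)" using pq by (simp add: field_simps)
      then show ?thesis using pq by (simp add: abs_mult power2_eq_square)
    qed
    ultimately have lt: "\<bar>real q - real p * \<alpha>\<bar> * real p < 1 / real (Suc n)" by simp
    have p1: "real p \<ge> 1" using pq by simp
    have "\<bar>real q - real p * \<alpha>\<bar> \<le> \<bar>real q - real p * \<alpha>\<bar> * real p"
      using mult_left_mono[OF p1, of "\<bar>real q - real p * \<alpha>\<bar>"] by simp
    then have "\<bar>real q - real p * \<alpha>\<bar> \<le> 1"
      using lt by (smt (verit) divide_le_eq_1 of_nat_Suc of_nat_0_le_iff)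
    then have "real q + real p * \<alpha> \<le> 1 + 2 * (real p * \<alpha>)" by linarith
    also have "\<dots> \<le> real p * (2 * \<alpha> + 1)" using p1 by (simp add: algebra_simps)
    finally have s: "real q + real p * \<alpha> \<le> real p * (2 * \<alpha> + 1)" .
    have "\<epsilon> \<le> \<bar>(real q)\<^sup>2 - (real p)\<^sup>2 / \<gamma>\<^sup>2\<bar>" using e pq by blast
    also have "(real q)\<^sup>2 - (real p)\<^sup>2 / \<gamma>\<^sup>2 = (real q - real p * \<alpha>) * (real q + real p * \<alpha>)"
      using assms(1) by (simp add: \<alpha>_def power2_eq_square field_simps)
    also have "\<bar>\<dots>\<bar> = \<bar>real q - real p * \<alpha>\<bar> * (real q + real p * \<alpha>)"
      using a by (simp add: abs_mult)
    also have "\<dots> \<le> \<bar>real q - real p * \<alpha>\<bar> * (real p * (2 * \<alpha> + 1))"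
      using s by (intro mult_left_mono) auto
    also have "\<dots> = (\<bar>real q - real p * \<alpha>\<bar> * real p) * (2 * \<alpha> + 1)" by simp
    also have "\<dots> < 1 / real (Suc n) * (2 * \<alpha> + 1)" using lt a by (intro mult_strict_right_mono) auto
    also have "\<dots> = (2 * \<alpha> + 1) / real (Suc n)" by simp
    finally have "\<epsilon> * real (Suc n) < 2 * \<alpha> + 1" by (simp add: field_simps)
    moreover have "(2 * \<alpha> + 1) < \<epsilon> * real n" using n e by (simp add: field_simps)
    ultimately show False using e by (simp add: algebra_simps)
  qed
  then have "\<alpha> \<in> badly_approximable (1 / real (Suc n))"
    unfolding badly_approximable_def by (auto simp: divide_le_eq mult_ac)
  then show ?thesis using n a unfolding \<alpha>_def by auto
qed

lemma null_sets_not_well_approximable: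
  "{\<gamma>::real. \<gamma> > 0 \<and> \<not> well_approximable \<gamma>} \<in> null_sets lebesgue"
proof -
  define B where "B = (\<Union>n. badly_approximable (1 / real (Suc n)) \<inter> {0<..<real n})"
  have "negligible B" unfolding B_def
    by (intro negligible_Union_nat negligible_badly_approximable) auto
  moreover have "inverse differentiable_on B"
    unfolding differentiable_on_def B_def by (auto intro!: differentiable_inverse)
  ultimately have "negligible (inverse ` B)"
    by (intro negligible_differentiable_image_negligible) auto
  moreover have "{\<gamma>::real. \<gamma> > 0 \<and> \<not> well_approximable \<gamma>} \<subseteq> inverse ` B"
  proof safe
    fix \<gamma> :: real assume "\<gamma> > 0" "\<not> well_approximable \<gamma>"
    then have "inverse \<gamma> \<in> B" using not_well_approximable_imp unfolding B_def by blast
    then show "\<gamma> \<in> inverse ` B" by (metis image_eqI inverse_inverse_eq)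
  qed
  ultimately show ?thesis using negligible_subset negligible_iff_null_sets by blast
qed

section \<open>Counting rectangles\<close>

text \<open>
  The two equations say that the segments from \<open>k1\<close> to \<open>k2\<close> and from \<open>k3\<close>
  to \<open>k4\<close> have the same midpoint and the same length, so \<open>k1 k3 k2 k4\<close> is a possibly
  degenerate rectangle. They are also the resonance conditions of the cubic interaction on the square lattice.
\<close>

definition rectangles :: "nat \<Rightarrow> ((nat \<times> nat) \<times> (nat \<times> nat) \<times> (nat \<times> nat) \<times> (nat \<times> nat)) set" where
  "rectangles N = {(k1, k2, k3, k4).
     {k1, k2, k3, k4} \<subseteq> {0..<N} \<times> {0..<N} \<and>
     fst k1 + fst k2 = fst k3 + fst k4 \<and> snd k1 + snd k2 = snd k3 + snd k4 \<and>
     (fst k1)\<^sup>2 + (snd k1)\<^sup>2 + (fst k2)\<^sup>2 + (snd k2)\<^sup>2 = (fst k3)\<^sup>2 + (snd k3)\<^sup>2 + (fst k4)\<^sup>2 + (snd k4)\<^sup>2}"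

lemma finite_rectangles: "finite (rectangles N)"
proof (rule finite_subset)
  let ?B = "{0..<N} \<times> {0..<N}"
  show "rectangles N \<subseteq> ?B \<times> ?B \<times> ?B \<times> ?B" by (auto simp: rectangles_def)
qed auto

text \<open>
  A rectangle is determined by a corner and two orthogonal sides, which can be written as \<open>m(a,b)\<close>
  and \<open>n(-b,a)\<close> with \<open>a, b\<close> coprime. The primitive vector and the multiplicities are
  recovered from the sides as greatest common divisors, which makes the parametrisation injective. The vertex that
  \<open>n(-b,a)\<close> leads to serves as base point, so that all coordinates are sums of natural numbers.
\<close>

lemma card_rectangles_ge:
  "real (card (rectangles (3 * L))) \<ge> real L ^ 4 / 4 * (\<Sum>a=1..L. real (totient a) / (real a)\<^sup>2)"
proof -
  define D where "D = Sigma {1..L} (\<lambda>a. totatives a \<times> {1..L div a} \<times> {1..L div a} \<times> {0..<L} \<times> {0..<L})"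
  define f where "f = (\<lambda>(a :: nat, b :: nat, m :: nat, n :: nat, y :: nat, z :: nat).
     ((y + n * b, z), (y + m * a, z + m * b + n * a), (y + n * b + m * a, z + m * b), (y, z + n * a)))"
  have inj: "inj_on f D"
  proof (rule inj_onI)
    fix s t assume "s \<in> D" "t \<in> D" and eq: "f s = f t"
    then obtain a b m n y z a' b' m' n' y' z' where
      s: "s = (a, b, m, n, y, z)" "a \<ge> 1" "b \<in> totatives a" "m \<ge> 1" "n \<ge> 1" and
      t: "t = (a', b', m', n', y', z')" "a' \<ge> 1" "b' \<in> totatives a'" "m' \<ge> 1" "n' \<ge> 1"
      unfolding D_def by auto
    have yz: "y = y'" "z = z'" and ma: "m * a = m' * a'" and mb: "m * b = m' * b'" and na: "n * a = n' * a'"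
      using eq unfolding s t f_def by auto
    have "gcd (m * a) (m * b) = m" "gcd (m' * a') (m' * b') = m'"
      using s t by (simp_all add: gcd_mult_distrib_nat[symmetric] totatives_def coprime_commute coprime_imp_gcd_eq_1)
    then have m: "m = m'" using ma mb by simp
    then have "a = a'" "b = b'" using ma mb s t by auto
    moreover from this have "n = n'" using na s by simp
    ultimately show "s = t" using s t yz m by simp
  qed
  have sub: "f ` D \<subseteq> rectangles (3 * L)"
  proof
    fix k assume "k \<in> f ` D"
    then obtain a b m n y z where k: "k = f (a, b, m, n, y, z)" and a: "a \<in> {1..L}" and b: "b \<in> totatives a"
      and m: "m \<le> L div a" and n: "n \<le> L div a" and y: "y < L" and z: "z < L"
      unfolding D_def by auto
    have ba: "b \<le> a" using b by (rule totatives_le)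
    have a0: "a > 0" using a by simp
    have ma: "m * a \<le> L" "n * a \<le> L" using m n a0 by (simp_all add: less_eq_div_iff_mult_less_eq)
    moreover have "m * b \<le> m * a" "n * b \<le> n * a" using ba by simp_all
    ultimately have mb: "m * b \<le> L" "n * b \<le> L" by linarith+
    have "y + n * b < 3 * L" "z < 3 * L" "y + m * a < 3 * L" "z + m * b + n * a < 3 * L"
      "y + n * b + m * a < 3 * L" "z + m * b < 3 * L" "y < 3 * L" "z + n * a < 3 * L"
      using ma mb y z by linarith+
    moreover have "(y + n * b)\<^sup>2 + z\<^sup>2 + (y + m * a)\<^sup>2 + (z + m * b + n * a)\<^sup>2
        = (y + n * b + m * a)\<^sup>2 + (z + m * b)\<^sup>2 + y\<^sup>2 + (z + n * a)\<^sup>2"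
      by (simp add: power2_eq_square algebra_simps)
    ultimately show "k \<in> rectangles (3 * L)" unfolding k f_def rectangles_def by simp
  qed
  have "card D = (\<Sum>a=1..L. totient a * ((L div a) * ((L div a) * (L * L))))"
    unfolding D_def by (simp add: card_cartesian_product totient_def)
  then have cD: "real (card D) = (\<Sum>a=1..L. real (totient a) * (real (L div a) * (real (L div a) * (real L * real L))))"
    by simp
  have "real L ^ 4 / 4 * (\<Sum>a=1..L. real (totient a) / (real a)\<^sup>2) = (\<Sum>a=1..L. real (totient a) * ((real L / (2 * real a)) * ((real L / (2 * real a)) * (real L * real L))))"
    by (simp add: sum_distrib_left power2_eq_square power4_eq_xxxx field_simps)
  also have "\<dots> \<le> (\<Sum>a=1..L. real (totient a) * (real (L div a) * (real (L div a) * (real L * real L))))"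
  proof (rule sum_mono)
    fix a assume a: "a \<in> {1..L}"
    \<comment> \<open>\<open>L div a \<ge> L/(2a)\<close> because \<open>a \<le> L\<close>\<close>
    have "L < (L div a + 1) * a" using a dividend_less_times_div[of a L] by (simp add: algebra_simps)
    moreover have "L div a \<ge> 1" using a by (simp add: Suc_le_eq div_greater_zero_iff)
    then have "a \<le> a * (L div a)" using mult_le_mono2[of 1 "L div a" a] by linarith
    ultimately have "L \<le> 2 * (a * (L div a))" by (simp only: add_mult_distrib mult_1 mult.commute[of "L div a"])
    then have "L \<le> 2 * a * (L div a)" by (simp only: mult.assoc)
    then have "real L \<le> 2 * real a * real (L div a)" by (metis of_nat_le_iff of_nat_mult of_nat_numeral)
    then have "real L / (2 * real a) \<le> real (L div a)" using a by (simp add: field_simps)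
    then show "real (totient a) * ((real L / (2 * real a)) * ((real L / (2 * real a)) * (real L * real L)))
       \<le> real (totient a) * (real (L div a) * (real (L div a) * (real L * real L)))"
      using a by (intro mult_left_mono mult_mono) auto
  qed
  also have "\<dots> = real (card D)" by (rule cD[symmetric])
  also have "\<dots> = real (card (f ` D))" using card_image[OF inj] by simp
  also have "\<dots> \<le> real (card (rectangles (3 * L)))" using card_mono[OF finite_rectangles sub] by simp
  finally show ?thesis .
qed

lemma sum_inverse_squares_le: "(\<Sum>e=1..L. 1 / (real e)\<^sup>2) \<le> 2"
proof -
  have "(\<Sum>e=1..L. 1 / (real e)\<^sup>2) \<le> 2 - 1 / real L" if "L \<ge> 1" for L
    using that
  proof (induction L rule: dec_induct)
    case (step n)
    have "1 / (real (Suc n))\<^sup>2 \<le> 1 / real n - 1 / real (Suc n)"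
      using step by (simp add: divide_simps power2_eq_square)
    then show ?case using step by simp
  qed auto
  then have "L \<ge> 1 \<Longrightarrow> (\<Sum>e=1..L. 1 / (real e)\<^sup>2) \<le> 2"
    by (rule order_trans) auto
  then show ?thesis by (cases "L \<ge> 1") simp_all
qed

text \<open>
  The identity \<open>\<Sum>\<^bsub>d | n\<^esub> totient d = n\<close> turns \<open>1/n\<close> into
  \<open>\<Sum>\<^bsub>d | n\<^esub> totient d / n\<^sup>2\<close>. Writing \<open>n = d e\<close> and letting
  \<open>d\<close> and \<open>e\<close> run independently up to \<open>L\<close> bounds the sum over
  \<open>n\<close> by a product, one factor of which is a partial sum of \<open>\<Sum> 1/e\<^sup>2 \<le>
  2\<close>.
\<close>

lemma harm_le_sum_totient: "harm L \<le> 2 * (\<Sum>a=1..L. real (totient a) / (real a)\<^sup>2)"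
proof -
  let ?t = "\<lambda>d. real (totient d) / (real d)\<^sup>2"
  define P where "P = Sigma {1..L} (\<lambda>n. {d. d dvd n})"
  define g where "g = (\<lambda>(n::nat, d::nat). (n div d, d))"
  have "harm L = (\<Sum>n=1..L. \<Sum>d | d dvd n. real (totient d) / (real n)\<^sup>2)"
  proof (unfold harm_def, rule sum.cong)
    fix n assume n: "n \<in> {1..L}"
    have "(\<Sum>d | d dvd n. real (totient d) / (real n)\<^sup>2) = real (\<Sum>d | d dvd n. totient d) / (real n)\<^sup>2"
      by (simp add: sum_divide_distrib)
    also have "\<dots> = real n / (real n)\<^sup>2" by (simp only: totient_divisor_sum)
    finally show "inverse (real n) = (\<Sum>d | d dvd n. real (totient d) / (real n)\<^sup>2)"
      using n by (simp add: power2_eq_square field_simps)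
  qed simp
  also have "\<dots> = (\<Sum>(n, d)\<in>P. real (totient d) / (real n)\<^sup>2)"
    unfolding P_def by (intro sum.Sigma) auto
  also have "\<dots> = (\<Sum>(n, d)\<in>P. 1 / (real (n div d))\<^sup>2 * ?t d)"
  proof (intro sum.cong refl, clarify)
    fix n d assume "(n, d) \<in> P"
    then have "d dvd n" "n \<ge> 1" by (auto simp: P_def)
    then obtain k where "n = d * k" "d > 0" by (auto simp: dvd_def)
    then show "real (totient d) / (real n)\<^sup>2 = 1 / (real (n div d))\<^sup>2 * ?t d" by (simp add: power_mult_distrib)
  qed
  also have "\<dots> = (\<Sum>(e, d)\<in>g ` P. 1 / (real e)\<^sup>2 * ?t d)"
  proof (subst sum.reindex)
    show "inj_on g P"
      by (rule inj_onI) (auto simp: g_def P_def dvd_def)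
  qed (auto simp: g_def case_prod_beta)
  also have "\<dots> \<le> (\<Sum>(e, d)\<in>{1..L} \<times> {1..L}. 1 / (real e)\<^sup>2 * ?t d)"
  proof (rule sum_mono2)
    show "g ` P \<subseteq> {1..L} \<times> {1..L}"
    proof
      fix x assume "x \<in> g ` P"
      then obtain n d where x: "x = (n div d, d)" and n: "n \<in> {1..L}" and d: "d dvd n" by (auto simp: g_def P_def)
      obtain k where k: "n = d * k" using d by (auto simp: dvd_def)
      have kd: "k \<ge> 1" "d \<ge> 1" using n k by (auto simp: Suc_le_eq)
      have "k \<le> n" "d \<le> n" using n k by (auto intro: dvd_imp_le)
      moreover have "n div d = k" using k kd by simp
      ultimately show "x \<in> {1..L} \<times> {1..L}" using x kd n by simp
    qed
  qed auto
  also have "\<dots> = (\<Sum>e=1..L. 1 / (real e)\<^sup>2) * (\<Sum>d=1..L. ?t d)"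
    by (simp add: sum_product sum.cartesian_product)
  also have "\<dots> \<le> 2 * (\<Sum>d=1..L. ?t d)"
    by (intro mult_right_mono sum_inverse_squares_le sum_nonneg) auto
  finally show ?thesis .
qed

lemma rectangles_superquartic: "\<exists>N\<ge>1. real (card (rectangles N)) > B * real N ^ 4"
proof -
  \<comment> \<open>\<open>648 = 8 \<sqdot> 3\<^sup>4\<close>: the box has side \<open>3L\<close>, and the two preceding bounds lose the factors \<open>4\<close> and \<open>2\<close>\<close>
  have "eventually (\<lambda>L. harm L > 648 * B) sequentially"
    using harm_at_top by (simp add: filterlim_at_top_dense)
  then obtain L0 where L0: "\<And>L. L \<ge> L0 \<Longrightarrow> harm L > 648 * B" by (auto simp: eventually_sequentially)
  define L where "L = max L0 1"
  have L: "L \<ge> 1" "harm L > 648 * B" using L0 by (auto simp: L_def)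
  have "B * real (3 * L) ^ 4 = real L ^ 4 * (81 * B)" by (simp add: power_mult_distrib)
  also have "\<dots> < real L ^ 4 * (harm L / 8)" using L by (intro mult_strict_left_mono) auto
  also have "\<dots> \<le> real L ^ 4 / 4 * (\<Sum>a=1..L. real (totient a) / (real a)\<^sup>2)"
    using mult_left_mono[OF harm_le_sum_totient[of L], of "real L ^ 4 / 8"] by simp
  also have "\<dots> \<le> real (card (rectangles (3 * L)))" by (rule card_rectangles_ge)
  finally show ?thesis using L by (intro exI[of _ "3 * L"]) auto
qed

section \<open>Integration and characters on the torus\<close>

text \<open>
  Nearly all integrands below are continuous. For these the gauge integral over the closed period cell agrees with
  the Lebesgue integral over the torus, and it comes with iterated integrals and differentiation under the
  integral sign.
\<close>

definition tint :: "real \<Rightarrow> (real \<times> real \<Rightarrow> 'a::euclidean_space) \<Rightarrow> 'a" where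
  "tint \<gamma> f = integral (cbox (0, 0) (2 * pi, 2 * pi * \<gamma>)) f"

lemma
  fixes f :: "real \<times> real \<Rightarrow> 'a::euclidean_space"
  assumes f: "continuous_on UNIV f"
  shows integrable_torus: "integrable (torus_measure \<gamma>) f"
    and torus_integral_eq: "integral\<^sup>L (torus_measure \<gamma>) f = tint \<gamma> f"
proof -
  define A where "A = {0..<2 * pi} \<times> {0..<2 * pi * \<gamma>}"
  define B where "B = cbox (0, 0) (2 * pi, 2 * pi * \<gamma>)"
  have A: "A \<in> sets lborel"
    unfolding A_def by (simp add: borel_prod[symmetric])
  have "integrable lborel (\<lambda>x. indicator B x *\<^sub>R f x)"
    unfolding B_def using f by (intro borel_integrable_compact compact_cbox) (auto intro: continuous_on_subset)
  then have intB: "set_integrable lborel B f" by (simp add: set_integrable_def)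
  have AB: "A \<subseteq> B" unfolding A_def B_def by (auto simp: mem_box Basis_prod_def)
  have intA: "set_integrable lborel A f"
    by (rule set_integrable_subset[OF intB A AB])
  then show "integrable (torus_measure \<gamma>) f"
    unfolding torus_measure_def A_def[symmetric] set_integrable_def using A by (subst integrable_restrict_space) auto
  have "integral\<^sup>L (torus_measure \<gamma>) f = set_lebesgue_integral lborel A f"
    unfolding torus_measure_def A_def[symmetric] set_lebesgue_integral_def using A by (subst integral_restrict_space) auto
  also have "\<dots> = integral A f" using set_borel_integral_eq_integral(2)[OF intA] .
  also have "\<dots> = integral B f"
  proof (rule integral_spike_set)
    have "box (0, 0) (2 * pi, 2 * pi * \<gamma>) \<subseteq> A"
      unfolding A_def by (auto simp: mem_box Basis_prod_def)
    then have "B - A \<subseteq> cbox (0, 0) (2 * pi, 2 * pi * \<gamma>) - box (0, 0) (2 * pi, 2 * pi * \<gamma>)"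
      unfolding B_def by blast
    then have "negligible (B - A)" using negligible_frontier_interval negligible_subset by blast
    then show "negligible {x \<in> B - A. f x \<noteq> 0}" by (rule negligible_subset) auto
    show "negligible {x \<in> A - B. f x \<noteq> 0}" using AB by (auto intro: negligible_subset[of "{}"])
  qed
  finally show "integral\<^sup>L (torus_measure \<gamma>) f = tint \<gamma> f" by (simp add: tint_def B_def)
qed

lemma tint_integrable:
  fixes f :: "real \<times> real \<Rightarrow> 'a::euclidean_space"
  shows "continuous_on UNIV f \<Longrightarrow> f integrable_on cbox (0, 0) (2 * pi, 2 * pi * \<gamma>)"
  by (rule integrable_continuous) (auto intro: continuous_on_subset)

lemma tint_add:
  "continuous_on UNIV f \<Longrightarrow> continuous_on UNIV g \<Longrightarrow> tint \<gamma> (\<lambda>x. f x + g x) = tint \<gamma> f + tint \<gamma> g"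
  unfolding tint_def by (intro integral_add tint_integrable)

lemma tint_diff:
  "continuous_on UNIV f \<Longrightarrow> continuous_on UNIV g \<Longrightarrow> tint \<gamma> (\<lambda>x. f x - g x) = tint \<gamma> f - tint \<gamma> g"
  unfolding tint_def by (intro integral_diff tint_integrable)

lemma tint_linear:
  "bounded_linear h \<Longrightarrow> continuous_on UNIV f \<Longrightarrow> tint \<gamma> (\<lambda>x. h (f x)) = h (tint \<gamma> f)"
  unfolding tint_def by (intro integral_linear[unfolded o_def] tint_integrable)

lemma tint_cmult:
  fixes f :: "real \<times> real \<Rightarrow> complex"
  shows "continuous_on UNIV f \<Longrightarrow> tint \<gamma> (\<lambda>x. c * f x) = c * tint \<gamma> f"
  by (rule tint_linear[OF bounded_linear_mult_right])

lemma tint_cmult_real: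
  fixes f :: "real \<times> real \<Rightarrow> real"
  shows "continuous_on UNIV f \<Longrightarrow> tint \<gamma> (\<lambda>x. c * f x) = c * tint \<gamma> f"
  by (rule tint_linear[OF bounded_linear_mult_right])

lemma tint_of_real: "continuous_on UNIV f \<Longrightarrow> tint \<gamma> (\<lambda>x. complex_of_real (f x)) = of_real (tint \<gamma> f)"
  by (rule tint_linear[OF bounded_linear_of_real])

lemma tint_sum:
  fixes f :: "'i \<Rightarrow> real \<times> real \<Rightarrow> 'a::euclidean_space"
  assumes "\<And>i. i \<in> I \<Longrightarrow> continuous_on UNIV (f i)"
  shows "tint \<gamma> (\<lambda>x. \<Sum>i\<in>I. f i x) = (\<Sum>i\<in>I. tint \<gamma> (f i))"
  using assms by (induction I rule: infinite_finite_induct)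
    (auto simp: tint_add continuous_on_sum, simp_all add: tint_def)

lemma tint_mono:
  fixes f g :: "real \<times> real \<Rightarrow> real"
  assumes "continuous_on UNIV f" "continuous_on UNIV g" "\<And>x. f x \<le> g x"
  shows "tint \<gamma> f \<le> tint \<gamma> g"
  unfolding tint_def using assms by (intro integral_le tint_integrable) auto

lemma tint_nonneg:
  fixes f :: "real \<times> real \<Rightarrow> real"
  assumes "continuous_on UNIV f" "\<And>x. f x \<ge> 0"
  shows "tint \<gamma> f \<ge> 0"
  unfolding tint_def using assms by (intro integral_nonneg tint_integrable) auto

lemma norm_tint_le:
  fixes f :: "real \<times> real \<Rightarrow> 'a::euclidean_space" and g :: "real \<times> real \<Rightarrow> real"
  assumes "continuous_on UNIV f" "continuous_on UNIV g" "\<And>x. norm (f x) \<le> g x"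
  shows "norm (tint \<gamma> f) \<le> tint \<gamma> g"
  unfolding tint_def using assms by (intro integral_norm_bound_integral tint_integrable) auto

lemma tint_deriv_fst_eq_0:
  fixes F Fx :: "real \<times> real \<Rightarrow> 'a::euclidean_space"
  assumes F: "\<And>x y. ((\<lambda>s. F (s, y)) has_vector_derivative Fx (x, y)) (at x)"
    and c: "continuous_on UNIV Fx" and per: "\<And>y. F (2 * pi, y) = F (0, y)"
  shows "tint \<gamma> Fx = 0"
proof -
  have cc: "continuous_on (cbox (0, 0) (2 * pi, 2 * pi * \<gamma>)) (\<lambda>(x, y). Fx (x, y))"
    using c by (auto intro: continuous_on_subset)
  have "tint \<gamma> Fx = integral (cbox 0 (2 * pi)) (\<lambda>x. integral (cbox 0 (2 * pi * \<gamma>)) (\<lambda>y. Fx (x, y)))"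
    unfolding tint_def using cc by (intro integral_prod_continuous) simp
  also have "\<dots> = integral (cbox 0 (2 * pi * \<gamma>)) (\<lambda>y. integral (cbox 0 (2 * pi)) (\<lambda>x. Fx (x, y)))"
    by (rule integral_swap_continuous[OF cc])
  also have "(\<lambda>y. integral (cbox 0 (2 * pi)) (\<lambda>x. Fx (x, y))) = (\<lambda>y. 0)"
  proof
    fix y
    have "((\<lambda>x. Fx (x, y)) has_integral F (2 * pi, y) - F (0, y)) {0..2 * pi}"
      using F by (intro fundamental_theorem_of_calculus) (auto intro: has_vector_derivative_at_within)
    then show "integral (cbox 0 (2 * pi)) (\<lambda>x. Fx (x, y)) = 0"
      using per by (simp add: integral_unique)
  qed
  finally show ?thesis by simp
qed

lemma tint_deriv_snd_eq_0:
  fixes F Fy :: "real \<times> real \<Rightarrow> 'a::euclidean_space"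
  assumes \<gamma>: "\<gamma> > 0" and F: "\<And>x y. ((\<lambda>s. F (x, s)) has_vector_derivative Fy (x, y)) (at y)"
    and c: "continuous_on UNIV Fy" and per: "\<And>x. F (x, 2 * pi * \<gamma>) = F (x, 0)"
  shows "tint \<gamma> Fy = 0"
proof -
  have "tint \<gamma> Fy = integral (cbox 0 (2 * pi)) (\<lambda>x. integral (cbox 0 (2 * pi * \<gamma>)) (\<lambda>y. Fy (x, y)))"
    unfolding tint_def using c by (intro integral_prod_continuous) (auto intro: continuous_on_subset)
  also have "(\<lambda>x. integral (cbox 0 (2 * pi * \<gamma>)) (\<lambda>y. Fy (x, y))) = (\<lambda>x. 0)"
  proof
    fix x
    have "((\<lambda>y. Fy (x, y)) has_integral F (x, 2 * pi * \<gamma>) - F (x, 0)) {0..2 * pi * \<gamma>}"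
      using F \<gamma> by (intro fundamental_theorem_of_calculus) (auto intro: has_vector_derivative_at_within)
    then show "integral (cbox 0 (2 * pi * \<gamma>)) (\<lambda>y. Fy (x, y)) = 0"
      using per by (simp add: integral_unique)
  qed
  finally show ?thesis by simp
qed

definition character :: "real \<Rightarrow> int \<times> int \<Rightarrow> real \<times> real \<Rightarrow> complex" where
  "character \<gamma> k x = exp (\<i> * of_real (freq \<gamma> k \<bullet> x))"

lemma freq_add: "freq \<gamma> (k + l) = freq \<gamma> k + freq \<gamma> l" and freq_uminus: "freq \<gamma> (- k) = - freq \<gamma> k"
  by (auto simp: freq_def add_divide_distrib)

lemma character_add: "character \<gamma> (k + l) x = character \<gamma> k x * character \<gamma> l x"
  by (simp add: character_def freq_add inner_add_left distrib_left exp_add)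

lemma character_uminus: "character \<gamma> (- k) x = cnj (character \<gamma> k x)"
  by (simp add: character_def freq_uminus exp_cnj)

lemma character_diff: "character \<gamma> (k - l) x = character \<gamma> k x * cnj (character \<gamma> l x)"
  using character_add[of \<gamma> k "- l" x] by (simp add: character_uminus)

lemma norm_character [simp]: "norm (character \<gamma> k x) = 1"
  by (simp add: character_def norm_exp_i_times)

lemma character_zero [simp]: "character \<gamma> 0 x = 1"
  by (simp add: character_def freq_def inner_prod_def)

lemma character_has_derivative:
  "(character \<gamma> k has_derivative (\<lambda>h. \<i> * of_real (freq \<gamma> k \<bullet> h) * character \<gamma> k x)) (at x within A)"
proof -
  have "((\<lambda>x. \<i> * of_real (freq \<gamma> k \<bullet> x)) has_derivative (\<lambda>h. \<i> * of_real (freq \<gamma> k \<bullet> h))) (at x within A)"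
    by (auto intro!: derivative_eq_intros)
  from has_derivative_compose[OF this DERIV_exp[unfolded has_field_derivative_def]]
  show ?thesis by (simp add: character_def[abs_def] mult.commute)
qed

lemma continuous_on_character [continuous_intros]: "continuous_on A (character \<gamma> k)"
  unfolding character_def by (intro continuous_intros)

lemma torus_periodic_character:
  assumes "\<gamma> > 0"
  shows "torus_periodic \<gamma> (character \<gamma> k)"
proof -
  have e: "exp (\<i> * of_real (2 * pi * of_int n)) = 1" for n
    using exp_2pi_1_int[of n] by (simp add: mult_ac)
  have "freq \<gamma> k \<bullet> (a + 2 * pi, b) = freq \<gamma> k \<bullet> (a, b) + 2 * pi * of_int (fst k)" for a b
    by (simp add: freq_def algebra_simps)
  moreover have "freq \<gamma> k \<bullet> (a, b + 2 * pi * \<gamma>) = freq \<gamma> k \<bullet> (a, b) + 2 * pi * of_int (snd k)" for a b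
    using assms by (simp add: freq_def field_simps)
  ultimately show ?thesis
    unfolding torus_periodic_def character_def by (simp only: of_real_add distrib_left exp_add e) simp
qed

lemma tint_const: "\<gamma> > 0 \<Longrightarrow> tint \<gamma> (\<lambda>x. c) = (4 * pi\<^sup>2 * \<gamma>) *\<^sub>R c"
  by (simp add: tint_def content_Pair power2_eq_square)

text \<open>
  A character of nonzero frequency is, up to a nonzero factor, a partial derivative of itself, and derivatives of
  periodic functions have integral zero.
\<close>

lemma tint_character:
  assumes \<gamma>: "\<gamma> > 0"
  shows "tint \<gamma> (character \<gamma> k) = (if k = 0 then of_real (4 * pi\<^sup>2 * \<gamma>) else 0)"
proof (cases "k = 0")
  case True
  then have "character \<gamma> k = (\<lambda>x. 1)" by (auto simp: fun_eq_iff)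
  then show ?thesis using True tint_const[OF \<gamma>, of "1::complex"] by (simp add: scaleR_conv_of_real)
next
  case False
  have per: "torus_periodic \<gamma> (character \<gamma> k)" by (rule torus_periodic_character[OF \<gamma>])
  have "tint \<gamma> (\<lambda>x. \<i> * of_int (fst k) * character \<gamma> k x) = 0"
  proof (rule tint_deriv_fst_eq_0)
    show "((\<lambda>s. character \<gamma> k (s, y)) has_vector_derivative \<i> * of_int (fst k) * character \<gamma> k (x, y)) (at x)" for x y
    proof -
      have "((\<lambda>s. character \<gamma> k (s, y)) has_derivative (\<lambda>h. \<i> * of_real (freq \<gamma> k \<bullet> (h, 0)) * character \<gamma> k (x, y))) (at x)"
        by (rule has_derivative_compose[OF _ character_has_derivative, where f = "\<lambda>s. (s, y)"])
           (auto intro!: derivative_eq_intros)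
      then show ?thesis
        unfolding has_vector_derivative_def
        by (rule has_derivative_eq_rhs) (auto simp: fun_eq_iff freq_def scaleR_conv_of_real)
    qed
    show "character \<gamma> k (2 * pi, y) = character \<gamma> k (0, y)" for y
      using per[unfolded torus_periodic_def, rule_format, of 0 y] by simp
  qed (intro continuous_intros)
  then have 1: "\<i> * of_int (fst k) * tint \<gamma> (character \<gamma> k) = 0"
    by (simp only: tint_cmult[OF continuous_on_character])
  have "tint \<gamma> (\<lambda>x. \<i> * of_real (of_int (snd k) / \<gamma>) * character \<gamma> k x) = 0"
  proof (rule tint_deriv_snd_eq_0[OF \<gamma>])
    show "((\<lambda>s. character \<gamma> k (x, s)) has_vector_derivative \<i> * of_real (of_int (snd k) / \<gamma>) * character \<gamma> k (x, y)) (at y)" for x y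
    proof -
      have "((\<lambda>s. character \<gamma> k (x, s)) has_derivative (\<lambda>h. \<i> * of_real (freq \<gamma> k \<bullet> (0, h)) * character \<gamma> k (x, y))) (at y)"
        by (rule has_derivative_compose[OF _ character_has_derivative, where f = "\<lambda>s. (x, s)"])
           (auto intro!: derivative_eq_intros)
      then show ?thesis
        unfolding has_vector_derivative_def
        by (rule has_derivative_eq_rhs) (auto simp: fun_eq_iff freq_def scaleR_conv_of_real)
    qed
    show "character \<gamma> k (x, 2 * pi * \<gamma>) = character \<gamma> k (x, 0)" for x
      using per[unfolded torus_periodic_def, rule_format, of x 0] by simp
  qed (intro continuous_intros)
  then have 2: "\<i> * of_real (of_int (snd k) / \<gamma>) * tint \<gamma> (character \<gamma> k) = 0"
    by (simp only: tint_cmult[OF continuous_on_character])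
  have "fst k \<noteq> 0 \<or> snd k \<noteq> 0" using False by (auto simp: prod_eq_iff)
  then show ?thesis using 1 2 False \<gamma> by auto
qed

definition trig_poly :: "real \<Rightarrow> (int \<times> int) set \<Rightarrow> (int \<times> int \<Rightarrow> complex) \<Rightarrow> real \<times> real \<Rightarrow> complex" where
  "trig_poly \<gamma> K c x = (\<Sum>k\<in>K. c k * character \<gamma> k x)"

lemma continuous_on_trig_poly [continuous_intros]: "continuous_on A (trig_poly \<gamma> K c)"
  unfolding trig_poly_def by (intro continuous_intros)

lemma torus_periodic_trig_poly: "\<gamma> > 0 \<Longrightarrow> torus_periodic \<gamma> (trig_poly \<gamma> K c)"
  using torus_periodic_character[of \<gamma>] unfolding torus_periodic_def trig_poly_def by simp

lemma trig_poly_has_derivative: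
  "(trig_poly \<gamma> K c has_derivative (\<lambda>h. trig_poly \<gamma> K (\<lambda>k. c k * (\<i> * of_real (freq \<gamma> k \<bullet> h))) x)) (at x within A)"
proof -
  have "((\<lambda>x. \<Sum>k\<in>K. c k * character \<gamma> k x) has_derivative (\<lambda>h. \<Sum>k\<in>K. c k * (\<i> * of_real (freq \<gamma> k \<bullet> h) * character \<gamma> k x))) (at x within A)"
    by (intro has_derivative_sum has_derivative_mult_right character_has_derivative)
  then show ?thesis by (simp add: trig_poly_def[abs_def] mult.assoc)
qed

text \<open>
  Directional derivatives of trigonometric polynomials are trigonometric polynomials with the same frequencies;
  this is the coinduction invariant.
\<close>

lemma smooth_trig_poly: "smooth_on A (trig_poly \<gamma> K c)"
proof -
  have "\<exists>c. f = trig_poly \<gamma> K c \<Longrightarrow> smooth_on A f" for f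
  proof (coinduction arbitrary: f rule: smooth_on.coinduct)
    case smooth_on
    then obtain c where f: "f = trig_poly \<gamma> K c" by blast
    show ?case
      unfolding f using trig_poly_has_derivative
      by (intro exI[of _ "\<lambda>x h. trig_poly \<gamma> K (\<lambda>k. c k * (\<i> * of_real (freq \<gamma> k \<bullet> h))) x"]
            exI[of _ "trig_poly \<gamma> K c"]) blast
  qed
  then show ?thesis by blast
qed

lemma smooth_torus_trig_poly: "\<gamma> > 0 \<Longrightarrow> smooth_torus \<gamma> (trig_poly \<gamma> K c)"
  by (simp add: smooth_torus_def torus_periodic_trig_poly smooth_trig_poly)

lemma norm_trig_poly_le: "norm (trig_poly \<gamma> K c x) \<le> (\<Sum>k\<in>K. norm (c k))"
  unfolding trig_poly_def by (rule order_trans[OF norm_sum]) (simp add: norm_mult)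

lemma tint_trig_poly_mult_cnj_character:
  assumes "\<gamma> > 0" "finite K"
  shows "tint \<gamma> (\<lambda>x. trig_poly \<gamma> K c x * cnj (character \<gamma> l x)) = (if l \<in> K then of_real (4 * pi\<^sup>2 * \<gamma>) * c l else 0)"
proof -
  have "tint \<gamma> (\<lambda>x. trig_poly \<gamma> K c x * cnj (character \<gamma> l x)) = tint \<gamma> (\<lambda>x. \<Sum>k\<in>K. c k * character \<gamma> (k - l) x)"
    by (simp add: trig_poly_def character_diff sum_distrib_right mult.assoc)
  also have "\<dots> = (\<Sum>k\<in>K. c k * tint \<gamma> (character \<gamma> (k - l)))"
    by (subst tint_sum) (auto intro!: continuous_intros sum.cong tint_cmult)
  also have "\<dots> = (\<Sum>k\<in>K. if k = l then of_real (4 * pi\<^sup>2 * \<gamma>) * c l else 0)"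
    using assms by (intro sum.cong) (auto simp: tint_character)
  also have "\<dots> = (if l \<in> K then of_real (4 * pi\<^sup>2 * \<gamma>) * c l else 0)" using assms by simp
  finally show ?thesis .
qed

lemma tint_norm_trig_poly_squared:
  assumes "\<gamma> > 0" "finite K"
  shows "tint \<gamma> (\<lambda>x. (norm (trig_poly \<gamma> K c x))\<^sup>2) = 4 * pi\<^sup>2 * \<gamma> * (\<Sum>k\<in>K. (norm (c k))\<^sup>2)"
proof -
  have "complex_of_real (tint \<gamma> (\<lambda>x. (norm (trig_poly \<gamma> K c x))\<^sup>2)) = tint \<gamma> (\<lambda>x. of_real ((norm (trig_poly \<gamma> K c x))\<^sup>2))"
    by (rule tint_of_real[symmetric]) (intro continuous_intros)
  also have "\<dots> = tint \<gamma> (\<lambda>x. \<Sum>l\<in>K. cnj (c l) * (trig_poly \<gamma> K c x * cnj (character \<gamma> l x)))"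
  proof (rule arg_cong[where f = "tint \<gamma>"], rule ext)
    fix x
    define P where "P = trig_poly \<gamma> K c x"
    have "cnj P = (\<Sum>l\<in>K. cnj (c l) * cnj (character \<gamma> l x))" by (simp add: P_def trig_poly_def)
    then have "P * cnj P = (\<Sum>l\<in>K. cnj (c l) * (P * cnj (character \<gamma> l x)))"
      by (simp add: sum_distrib_left mult_ac)
    then show "complex_of_real ((norm (trig_poly \<gamma> K c x))\<^sup>2) = (\<Sum>l\<in>K. cnj (c l) * (trig_poly \<gamma> K c x * cnj (character \<gamma> l x)))"
      by (simp only: complex_norm_square P_def)
  qed
  also have "\<dots> = (\<Sum>l\<in>K. cnj (c l) * (of_real (4 * pi\<^sup>2 * \<gamma>) * c l))"
  proof (subst tint_sum)
    show "continuous_on UNIV (\<lambda>x. cnj (c l) * (trig_poly \<gamma> K c x * cnj (character \<gamma> l x)))" for l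
      by (intro continuous_intros)
    have "tint \<gamma> (\<lambda>x. cnj (c l) * (trig_poly \<gamma> K c x * cnj (character \<gamma> l x)))
       = cnj (c l) * tint \<gamma> (\<lambda>x. trig_poly \<gamma> K c x * cnj (character \<gamma> l x))" for l
      by (rule tint_cmult) (intro continuous_intros)
    then show "(\<Sum>l\<in>K. tint \<gamma> (\<lambda>x. cnj (c l) * (trig_poly \<gamma> K c x * cnj (character \<gamma> l x))))
       = (\<Sum>l\<in>K. cnj (c l) * (of_real (4 * pi\<^sup>2 * \<gamma>) * c l))"
      using tint_trig_poly_mult_cnj_character[OF assms, of c] by (intro sum.cong) simp_all
  qed
  also have "\<dots> = of_real (4 * pi\<^sup>2 * \<gamma> * (\<Sum>k\<in>K. (norm (c k))\<^sup>2))"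
    by (simp only: of_real_mult of_real_sum complex_norm_square) (simp add: sum_distrib_left mult_ac)
  finally show ?thesis by (simp only: of_real_eq_iff)
qed

section \<open>Linear waves with large space-time norm\<close>

definition free_wave :: "real \<Rightarrow> (int \<times> int) set \<Rightarrow> real \<Rightarrow> real \<times> real \<Rightarrow> complex" where
  "free_wave \<gamma> K t = trig_poly \<gamma> K (\<lambda>k. exp (- \<i> * of_real ((norm (freq \<gamma> k))\<^sup>2 * t)))"

lemma continuous_on_free_wave: "continuous_on A (\<lambda>(t, x). free_wave \<gamma> K t x)"
  unfolding free_wave_def trig_poly_def character_def case_prod_unfold by (intro continuous_intros)

lemma tint_norm_free_wave_squared:
  "\<gamma> > 0 \<Longrightarrow> finite K \<Longrightarrow> tint \<gamma> (\<lambda>x. (norm (free_wave \<gamma> K t x))\<^sup>2) = 4 * pi\<^sup>2 * \<gamma> * card K"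
  unfolding free_wave_def by (subst tint_norm_trig_poly_squared) (auto simp: norm_exp_eq_Re)

text \<open>
  In the expansion of \<open>v v cnj(v) cnj(v)\<close> only the frequencies with \<open>k1 + k2 = k3 + k4\<close>
  survive integration in space; the phases combine to the cosine after taking real parts.
\<close>

lemma tint_norm_free_wave_fourth:
  assumes \<gamma>: "\<gamma> > 0" and K: "finite K"
  shows "tint \<gamma> (\<lambda>x. norm (free_wave \<gamma> K t x) ^ 4) = 4 * pi\<^sup>2 * \<gamma> *
    (\<Sum>k1\<in>K. \<Sum>k2\<in>K. \<Sum>k3\<in>K. \<Sum>k4\<in>K. if k1 + k2 = k3 + k4 then
       cos (t * ((norm (freq \<gamma> k1))\<^sup>2 + (norm (freq \<gamma> k2))\<^sup>2 - (norm (freq \<gamma> k3))\<^sup>2 - (norm (freq \<gamma> k4))\<^sup>2)) else 0)"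
proof -
  let ?w = "\<lambda>k. (norm (freq \<gamma> k))\<^sup>2"
  define e where "e k = exp (- \<i> * of_real (?w k * t))" for k
  define E where "E k1 k2 k3 k4 = e k1 * e k2 * cnj (e k3) * cnj (e k4)" for k1 k2 k3 k4
  have Re_E: "Re (E k1 k2 k3 k4) = cos (t * (?w k1 + ?w k2 - ?w k3 - ?w k4))" for k1 k2 k3 k4
  proof -
    have "e k = cis (- (?w k * t))" for k by (simp add: e_def cis_conv_exp)
    then have "E k1 k2 k3 k4 = cis (- (t * (?w k1 + ?w k2 - ?w k3 - ?w k4)))"
      by (simp add: E_def cis_cnj cis_mult algebra_simps)
    then show ?thesis by (simp only: cis.sel cos_minus)
  qed
  have fourth: "complex_of_real (norm (free_wave \<gamma> K t x) ^ 4) =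
     (\<Sum>k1\<in>K. \<Sum>k2\<in>K. \<Sum>k3\<in>K. \<Sum>k4\<in>K. E k1 k2 k3 k4 * character \<gamma> (k1 + k2 - (k3 + k4)) x)" for x
  proof -
    define a where "a k = e k * character \<gamma> k x" for k
    have v: "free_wave \<gamma> K t x = (\<Sum>k\<in>K. a k)" by (simp add: free_wave_def trig_poly_def a_def e_def)
    have "complex_of_real (norm z ^ 4) = z * (z * (cnj z * cnj z))" for z :: complex
    proof -
      have "complex_of_real (norm z ^ 4) = (complex_of_real ((norm z)\<^sup>2))\<^sup>2" by simp
      also have "\<dots> = (z * cnj z)\<^sup>2" by (simp only: complex_norm_square)
      finally show ?thesis by (simp add: power2_eq_square mult_ac)
    qed
    then have "complex_of_real (norm (free_wave \<gamma> K t x) ^ 4) =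
      (\<Sum>k\<in>K. a k) * ((\<Sum>k\<in>K. a k) * ((\<Sum>k\<in>K. cnj (a k)) * (\<Sum>k\<in>K. cnj (a k))))"
      unfolding v by simp
    also have "\<dots> = (\<Sum>k1\<in>K. \<Sum>k2\<in>K. \<Sum>k3\<in>K. \<Sum>k4\<in>K. a k1 * (a k2 * (cnj (a k3) * cnj (a k4))))"
    proof -
      have prod: "(\<Sum>k\<in>K. a k) * X = (\<Sum>k\<in>K. a k * X)" for X by (rule sum_distrib_right)
      show ?thesis unfolding prod sum_product by (simp only: sum_distrib_left)
    qed
    also have "\<dots> = (\<Sum>k1\<in>K. \<Sum>k2\<in>K. \<Sum>k3\<in>K. \<Sum>k4\<in>K. E k1 k2 k3 k4 * character \<gamma> (k1 + k2 - (k3 + k4)) x)"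
      by (simp add: a_def E_def character_diff character_add mult_ac)
    finally show ?thesis .
  qed
  have "complex_of_real (tint \<gamma> (\<lambda>x. norm (free_wave \<gamma> K t x) ^ 4)) = tint \<gamma> (\<lambda>x. of_real (norm (free_wave \<gamma> K t x) ^ 4))"
    unfolding free_wave_def by (intro tint_of_real[symmetric] continuous_intros)
  also have "\<dots> = (\<Sum>k1\<in>K. \<Sum>k2\<in>K. \<Sum>k3\<in>K. \<Sum>k4\<in>K. E k1 k2 k3 k4 * tint \<gamma> (character \<gamma> (k1 + k2 - (k3 + k4))))"
    unfolding fourth by (simp add: tint_sum tint_cmult continuous_intros)
  also have "\<dots> = (\<Sum>k1\<in>K. \<Sum>k2\<in>K. \<Sum>k3\<in>K. \<Sum>k4\<in>K. if k1 + k2 = k3 + k4 then of_real (4 * pi\<^sup>2 * \<gamma>) * E k1 k2 k3 k4 else 0)"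
    by (intro sum.cong refl) (simp add: tint_character[OF \<gamma>])
  finally have "tint \<gamma> (\<lambda>x. norm (free_wave \<gamma> K t x) ^ 4) =
      Re (\<Sum>k1\<in>K. \<Sum>k2\<in>K. \<Sum>k3\<in>K. \<Sum>k4\<in>K. if k1 + k2 = k3 + k4 then of_real (4 * pi\<^sup>2 * \<gamma>) * E k1 k2 k3 k4 else 0)"
    by (metis Re_complex_of_real)
  also have "\<dots> = (\<Sum>k1\<in>K. \<Sum>k2\<in>K. \<Sum>k3\<in>K. \<Sum>k4\<in>K. if k1 + k2 = k3 + k4 then
       (4 * pi\<^sup>2 * \<gamma>) * cos (t * (?w k1 + ?w k2 - ?w k3 - ?w k4)) else 0)"
    unfolding Re_sum by (intro sum.cong refl) (simp add: Re_E[symmetric])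
  also have "\<dots> = 4 * pi\<^sup>2 * \<gamma> * (\<Sum>k1\<in>K. \<Sum>k2\<in>K. \<Sum>k3\<in>K. \<Sum>k4\<in>K. if k1 + k2 = k3 + k4 then
       cos (t * (?w k1 + ?w k2 - ?w k3 - ?w k4)) else 0)"
    unfolding sum_distrib_left by (intro sum.cong refl) simp
  finally show ?thesis .
qed

lemma abs_cos_diff_le: "\<bar>cos x - cos y\<bar> \<le> \<bar>x - y :: real\<bar>"
proof -
  have "\<bar>cos x - cos y\<bar> = 2 * \<bar>sin ((x + y) / 2)\<bar> * \<bar>sin ((y - x) / 2)\<bar>"
    by (simp add: cos_diff_cos abs_mult)
  also have "\<dots> \<le> 2 * 1 * \<bar>(y - x) / 2\<bar>"
    by (intro mult_mono abs_sin_x_le_abs_x) auto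
  finally show ?thesis by simp
qed

text \<open>
  For \<open>\<omega> = \<sigma> m\<close> the integral over whole periods is \<open>T\<close> or
  \<open>0\<close>. The phase \<open>t\<omega>\<close> deviates from \<open>t\<sigma>m\<close> by at most
  \<open>\<delta>\<close> on \<open>[0,T]\<close>, and the cosine is Lipschitz.
\<close>

lemma integral_cos_perturbed_ge:
  fixes \<omega> \<delta> \<sigma> T :: real and m :: int and j :: nat
  assumes \<sigma>: "\<sigma> > 0" and \<omega>: "\<bar>\<omega> - \<sigma> * of_int m\<bar> * T \<le> \<delta>" and T: "T = 2 * pi * real j / \<sigma>"
  shows "integral {0..T} (\<lambda>t. cos (t * \<omega>)) \<ge> (if m = 0 then T else 0) - T * \<delta>"
proof -
  have T0: "T \<ge> 0" using \<sigma> by (simp add: T)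
  have base: "integral {0..T} (\<lambda>t. cos (t * (\<sigma> * of_int m))) = (if m = 0 then T else 0)"
  proof (cases "m = 0")
    case False
    let ?a = "\<sigma> * real_of_int m"
    have a: "?a \<noteq> 0" using \<sigma> False by simp
    have "((\<lambda>t. cos (t * ?a)) has_integral (sin (T * ?a) / ?a - sin (0 * ?a) / ?a)) {0..T}"
    proof (rule fundamental_theorem_of_calculus[OF T0])
      fix t
      have "((\<lambda>t. sin (t * ?a) / ?a) has_real_derivative cos (t * ?a)) (at t within {0..T})"
        using a by (auto intro!: derivative_eq_intros)
      then show "((\<lambda>t. sin (t * ?a) / ?a) has_vector_derivative cos (t * ?a)) (at t within {0..T})"
        by (simp add: has_real_derivative_iff_has_vector_derivative)
    qed
    moreover have "T * ?a = 2 * pi * of_int (int j * m)" using \<sigma> by (simp add: T)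
    then have "sin (T * ?a) = 0" by (simp only: sin_int_2pin)
    ultimately show ?thesis using False by (simp add: integral_unique)
  qed (use T0 in simp)
  have "(if m = 0 then T else 0) - T * \<delta> = integral {0..T} (\<lambda>t. cos (t * (\<sigma> * of_int m)) - \<delta>)"
    using base T0 by (subst integral_diff) (auto intro!: integrable_continuous_real continuous_intros)
  also have "\<dots> \<le> integral {0..T} (\<lambda>t. cos (t * \<omega>))"
  proof (intro integral_le integrable_continuous_real continuous_intros)
    fix t assume t: "t \<in> {0..T}"
    have "\<bar>cos (t * (\<sigma> * of_int m)) - cos (t * \<omega>)\<bar> \<le> \<bar>t * (\<sigma> * of_int m) - t * \<omega>\<bar>" by (rule abs_cos_diff_le)
    also have "\<dots> = \<bar>\<omega> - \<sigma> * of_int m\<bar> * t"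
    proof -
      have "t * (\<sigma> * of_int m) - t * \<omega> = - ((\<omega> - \<sigma> * of_int m) * t)" by (simp add: algebra_simps)
      then show ?thesis using t by (simp add: abs_mult)
    qed
    also have "\<dots> \<le> \<bar>\<omega> - \<sigma> * of_int m\<bar> * T" using t by (intro mult_left_mono) auto
    finally show "cos (t * (\<sigma> * of_int m)) - \<delta> \<le> cos (t * \<omega>)" using \<omega> by linarith
  qed
  finally show ?thesis .
qed

text \<open>
  On the frequencies \<open>(qa, pb/\<gamma>)\<close> the quadratic form is \<open>q\<^sup>2(a\<^sup>2 +
  b\<^sup>2)\<close> up to the error \<open>(q\<^sup>2 - p\<^sup>2/\<gamma>\<^sup>2) b\<^sup>2\<close>. Each
  rectangle contributes \<open>T\<close>, every other quadruple with \<open>k1 + k2 = k3 + k4\<close> contributes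
  nothing, and each of the at most \<open>N\<^sup>8\<close> quadruples carries an error of at most \<open>T
  \<sqdot> 2T\<epsilon>N\<^sup>2\<close>.
\<close>

lemma integral_free_wave_ge:
  fixes p q N j :: nat
  assumes \<gamma>: "\<gamma> > 0" and pq: "p \<ge> 1" "q \<ge> 1" and T: "T = 2 * pi * real j / (real q)\<^sup>2"
    and ap: "\<bar>(real q)\<^sup>2 - (real p)\<^sup>2 / \<gamma>\<^sup>2\<bar> \<le> \<epsilon>"
  defines "K \<equiv> (\<lambda>(a, b). (int (q * a), int (p * b))) ` ({0..<N} \<times> {0..<N})"
  shows "integral {0..T} (\<lambda>t. tint \<gamma> (\<lambda>x. norm (free_wave \<gamma> K t x) ^ 4))
     \<ge> 4 * pi\<^sup>2 * \<gamma> * T * (real (card (rectangles N)) - 2 * T * \<epsilon> * real N ^ 10)"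
proof -
  define B where "B = {0..<N} \<times> {0..<N}"
  define \<kappa> where "\<kappa> = (\<lambda>(a, b). (int (q * a), int (p * b)))"
  have inj: "inj_on \<kappa> B" using pq by (auto simp: inj_on_def \<kappa>_def)
  have T0: "T \<ge> 0" by (simp add: T)
  define w where "w j = (norm (freq \<gamma> (\<kappa> j)))\<^sup>2" for j
  define \<omega> where "\<omega> = (\<lambda>(j1, j2, j3, j4). w j1 + w j2 - w j3 - w j4)"
  define Q where "Q = {(j1, j2, j3, j4). j1 \<in> B \<and> j2 \<in> B \<and> j3 \<in> B \<and> j4 \<in> B \<and>
     fst j1 + fst j2 = fst j3 + fst j4 \<and> snd j1 + snd j2 = snd j3 + snd j4}"
  have finB: "finite B" by (simp add: B_def)
  have QB: "Q \<subseteq> B \<times> B \<times> B \<times> B" by (auto simp: Q_def)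
  have finQ: "finite Q" by (rule finite_subset[OF QB]) (simp add: finB)
  have cardQ: "real (card Q) \<le> real N ^ 8"
  proof -
    have "card Q \<le> card (B \<times> B \<times> B \<times> B)" by (rule card_mono[OF _ QB]) (simp add: finB)
    also have "\<dots> = N ^ 8" by (simp add: card_cartesian_product B_def numeral_eq_Suc mult_ac)
    finally show ?thesis by (metis of_nat_le_iff of_nat_power)
  qed
  have h: "tint \<gamma> (\<lambda>x. norm (free_wave \<gamma> K t x) ^ 4) = 4 * pi\<^sup>2 * \<gamma> * (\<Sum>s\<in>Q. cos (t * \<omega> s))" for t
  proof -
    have KB: "K = \<kappa> ` B" by (simp add: K_def B_def \<kappa>_def)
    have eqv: "\<kappa> j1 + \<kappa> j2 = \<kappa> j3 + \<kappa> j4 \<longleftrightarrow> fst j1 + fst j2 = fst j3 + fst j4 \<and> snd j1 + snd j2 = snd j3 + snd j4" for j1 j2 j3 j4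
    proof -
      have "\<kappa> j1 + \<kappa> j2 = \<kappa> j3 + \<kappa> j4 \<longleftrightarrow>
         q * (fst j1 + fst j2) = q * (fst j3 + fst j4) \<and> p * (snd j1 + snd j2) = p * (snd j3 + snd j4)"
        unfolding \<kappa>_def case_prod_unfold prod_eq_iff by (simp add: distrib_left flip: of_nat_add of_nat_mult)
      then show ?thesis using pq by simp
    qed
    have "tint \<gamma> (\<lambda>x. norm (free_wave \<gamma> K t x) ^ 4) = 4 * pi\<^sup>2 * \<gamma> *
      (\<Sum>j1\<in>B. \<Sum>j2\<in>B. \<Sum>j3\<in>B. \<Sum>j4\<in>B. if fst j1 + fst j2 = fst j3 + fst j4 \<and> snd j1 + snd j2 = snd j3 + snd j4
        then cos (t * (w j1 + w j2 - w j3 - w j4)) else 0)"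
      unfolding KB w_def by (subst tint_norm_free_wave_fourth[OF \<gamma>]) (simp_all add: finB sum.reindex[OF inj] eqv)
    also have "(\<Sum>j1\<in>B. \<Sum>j2\<in>B. \<Sum>j3\<in>B. \<Sum>j4\<in>B. if fst j1 + fst j2 = fst j3 + fst j4 \<and> snd j1 + snd j2 = snd j3 + snd j4
        then cos (t * (w j1 + w j2 - w j3 - w j4)) else 0)
      = (\<Sum>s\<in>B \<times> B \<times> B \<times> B. if s \<in> Q then cos (t * \<omega> s) else 0)"
      unfolding sum.cartesian_product by (intro sum.cong refl) (auto simp: Q_def \<omega>_def split: if_splits)
    also have "\<dots> = (\<Sum>s\<in>Q. cos (t * \<omega> s))"
      using QB finB by (simp add: sum.If_cases Int_absorb1)
    finally show ?thesis .
  qed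
  define m :: "(nat \<times> nat) \<times> (nat \<times> nat) \<times> (nat \<times> nat) \<times> (nat \<times> nat) \<Rightarrow> int" where
    "m = (\<lambda>(j1, j2, j3, j4). int ((fst j1)\<^sup>2 + (snd j1)\<^sup>2 + (fst j2)\<^sup>2 + (snd j2)\<^sup>2)
        - int ((fst j3)\<^sup>2 + (snd j3)\<^sup>2 + (fst j4)\<^sup>2 + (snd j4)\<^sup>2))"
  have wj: "w j = (real q)\<^sup>2 * (real (fst j))\<^sup>2 + (real p)\<^sup>2 / \<gamma>\<^sup>2 * (real (snd j))\<^sup>2" for j
    by (cases j) (simp add: w_def \<kappa>_def freq_def norm_Pair power_mult_distrib power_divide)
  have rect: "rectangles N = {s \<in> Q. m s = 0}"
    unfolding rectangles_def Q_def B_def m_def by (auto simp flip: of_nat_add of_nat_power)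
  have Q_int: "integral {0..T} (\<lambda>t. cos (t * \<omega> s)) \<ge> (if m s = 0 then T else 0) - T * (2 * T * \<epsilon> * (real N)\<^sup>2)"
    if s: "s \<in> Q" for s
  proof (rule integral_cos_perturbed_ge[OF _ _ T])
    show "(real q)\<^sup>2 > 0" using pq by simp
    obtain j1 j2 j3 j4 where s': "s = (j1, j2, j3, j4)" by (metis prod_cases4)
    have lt: "real (snd j1) \<le> real N" "real (snd j2) \<le> real N" "real (snd j3) \<le> real N" "real (snd j4) \<le> real N"
      using s unfolding s' Q_def B_def by auto
    define d where "d = (real (snd j1))\<^sup>2 + (real (snd j2))\<^sup>2 - (real (snd j3))\<^sup>2 - (real (snd j4))\<^sup>2"
    have "(real (snd j1))\<^sup>2 \<le> (real N)\<^sup>2" "(real (snd j2))\<^sup>2 \<le> (real N)\<^sup>2" "(real (snd j3))\<^sup>2 \<le> (real N)\<^sup>2" "(real (snd j4))\<^sup>2 \<le> (real N)\<^sup>2"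
      using lt by (auto intro!: power_mono)
    then have d: "\<bar>d\<bar> \<le> 2 * (real N)\<^sup>2" unfolding d_def
      using zero_le_power2[of "real (snd j1)"] zero_le_power2[of "real (snd j2)"] zero_le_power2[of "real (snd j3)"] zero_le_power2[of "real (snd j4)"] by linarith
    have "\<omega> s - (real q)\<^sup>2 * of_int (m s) = - (((real q)\<^sup>2 - (real p)\<^sup>2 / \<gamma>\<^sup>2) * d)"
      unfolding s' \<omega>_def m_def d_def by (simp add: wj algebra_simps)
    then have "\<bar>\<omega> s - (real q)\<^sup>2 * of_int (m s)\<bar> = \<bar>(real q)\<^sup>2 - (real p)\<^sup>2 / \<gamma>\<^sup>2\<bar> * \<bar>d\<bar>" by (simp add: abs_mult)
    also have "\<dots> \<le> \<epsilon> * (2 * (real N)\<^sup>2)" using ap d by (intro mult_mono) auto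
    finally show "\<bar>\<omega> s - (real q)\<^sup>2 * of_int (m s)\<bar> * T \<le> 2 * T * \<epsilon> * (real N)\<^sup>2"
      using mult_right_mono[OF _ T0] by (fastforce simp: mult_ac)
  qed
  have eps: "\<epsilon> \<ge> 0" using ap by linarith
  have "integral {0..T} (\<lambda>t. tint \<gamma> (\<lambda>x. norm (free_wave \<gamma> K t x) ^ 4)) = 4 * pi\<^sup>2 * \<gamma> * (\<Sum>s\<in>Q. integral {0..T} (\<lambda>t. cos (t * \<omega> s)))"
    unfolding h by (subst integral_mult_right, subst integral_sum) (auto intro!: finQ integrable_continuous_real continuous_intros)
  moreover have "(\<Sum>s\<in>Q. integral {0..T} (\<lambda>t. cos (t * \<omega> s))) \<ge> (\<Sum>s\<in>Q. (if m s = 0 then T else 0) - T * (2 * T * \<epsilon> * (real N)\<^sup>2))"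
    by (intro sum_mono Q_int)
  moreover have "(\<Sum>s\<in>Q. (if m s = 0 then T else 0) - T * (2 * T * \<epsilon> * (real N)\<^sup>2))
     = T * real (card (rectangles N)) - real (card Q) * (T * (2 * T * \<epsilon> * (real N)\<^sup>2))"
    by (simp add: sum_subtractf sum.If_cases finQ rect Int_def conj_commute mult.commute)
  moreover have "real (card Q) * (T * (2 * T * \<epsilon> * (real N)\<^sup>2)) \<le> real N ^ 8 * (T * (2 * T * \<epsilon> * (real N)\<^sup>2))"
    using T0 eps by (intro mult_right_mono cardQ) auto
  moreover have "real N ^ 8 * (T * (2 * T * \<epsilon> * (real N)\<^sup>2)) = T * (2 * T * \<epsilon> * real N ^ 10)"
    by (simp add: power_add[of _ 8 2, simplified] mult_ac)
  ultimately have "(\<Sum>s\<in>Q. integral {0..T} (\<lambda>t. cos (t * \<omega> s))) \<ge> T * (real (card (rectangles N)) - 2 * T * \<epsilon> * real N ^ 10)"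
    unfolding right_diff_distrib by linarith
  then have "4 * pi\<^sup>2 * \<gamma> * (T * (real (card (rectangles N)) - 2 * T * \<epsilon> * real N ^ 10)) \<le> 4 * pi\<^sup>2 * \<gamma> * (\<Sum>s\<in>Q. integral {0..T} (\<lambda>t. cos (t * \<omega> s)))"
    using \<gamma> by (intro mult_left_mono) auto
  then show ?thesis unfolding \<open>integral {0..T} (\<lambda>t. tint \<gamma> (\<lambda>x. norm (free_wave \<gamma> K t x) ^ 4)) = _\<close>
    by (simp add: mult_ac)
qed

lemma continuous_on_tint_free_wave:
  "\<gamma> > 0 \<Longrightarrow> finite K \<Longrightarrow> continuous_on A (\<lambda>t. tint \<gamma> (\<lambda>x. norm (free_wave \<gamma> K t x) ^ 4))"
proof -
  have c: "continuous_on A (\<lambda>t. if b then cos (t * w) else 0)" for b and w :: real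
    by (cases b) (simp_all, intro continuous_intros)
  assume "\<gamma> > 0" "finite K"
  then show ?thesis
    by (simp only: tint_norm_free_wave_fourth) (intro continuous_on_mult continuous_on_const continuous_on_sum c)
qed

lemma tint_free_wave_fourth_nonneg: "tint \<gamma> (\<lambda>x. norm (free_wave \<gamma> K t x) ^ 4) \<ge> 0"
  unfolding free_wave_def by (intro tint_nonneg continuous_intros) auto

text \<open>
  The number \<open>4\<pi>\<^sup>2\<gamma> card K\<close> is the squared \<open>L\<^sup>2\<close> norm of the
  wave. The box size \<open>N\<close> is chosen first, from the excess of rectangles over
  \<open>N\<^sup>4\<close>. The approximation error is then chosen small in terms of \<open>N\<close> and
  \<open>T\<close>, for a multiple \<open>(np', nq')\<close> whose period \<open>2\<pi>/q\<^sup>2\<close> is at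
  most \<open>T/2\<close>.
\<close>

lemma free_wave_strichartz_ratio_unbounded:
  assumes \<gamma>: "\<gamma> > 0" and wa: "well_approximable \<gamma>" and T: "T > 0"
  shows "\<exists>K. finite K \<and> integral {0..T} (\<lambda>t. tint \<gamma> (\<lambda>x. norm (free_wave \<gamma> K t x) ^ 4))
      > C * (4 * pi\<^sup>2 * \<gamma> * real (card K))\<^sup>2"
proof -
  define V where "V = 4 * pi\<^sup>2 * \<gamma>"
  have V: "V > 0" using \<gamma> by (simp add: V_def)
  \<comment> \<open>the summand \<open>1\<close> pays for the error of one rectangle\<close>
  define B where "B = 2 * \<bar>C\<bar> * V / T + 1"
  have B: "B \<ge> 1" using V T by (simp add: B_def)
  obtain N where N: "N \<ge> 1" "real (card (rectangles N)) > B * real N ^ 4"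
    using rectangles_superquartic by blast
  define R where "R = real (card (rectangles N))"
  \<comment> \<open>the multiple that makes the period at most \<open>T/2\<close>\<close>
  obtain n :: nat where n: "real n > max 1 (4 * pi / T)" using reals_Archimedean2 by blast
  \<comment> \<open>the error term of \<open>integral_free_wave_ge\<close> then amounts to at most one rectangle\<close>
  define \<epsilon> where "\<epsilon> = 1 / (2 * T * real N ^ 10)"
  have eps: "\<epsilon> > 0" using T N by (simp add: \<epsilon>_def)
  then have "\<epsilon> / (real n)\<^sup>2 > 0" using n by simp
  then obtain p' q' :: nat where pq': "p' \<ge> 1" "q' \<ge> 1" "\<bar>(real q')\<^sup>2 - (real p')\<^sup>2 / \<gamma>\<^sup>2\<bar> < \<epsilon> / (real n)\<^sup>2"
    using wa unfolding well_approximable_def by blast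
  define p q where "p = n * p'" and "q = n * q'"
  have n1: "n \<ge> 1" using n by (cases n) auto
  have pq: "p \<ge> 1" "q \<ge> 1" using pq' n1 by (auto simp: p_def q_def Suc_le_eq)
  have "(real q)\<^sup>2 - (real p)\<^sup>2 / \<gamma>\<^sup>2 = (real n)\<^sup>2 * ((real q')\<^sup>2 - (real p')\<^sup>2 / \<gamma>\<^sup>2)"
    by (simp add: p_def q_def power_mult_distrib right_diff_distrib)
  then have "\<bar>(real q)\<^sup>2 - (real p)\<^sup>2 / \<gamma>\<^sup>2\<bar> = (real n)\<^sup>2 * \<bar>(real q')\<^sup>2 - (real p')\<^sup>2 / \<gamma>\<^sup>2\<bar>" by (simp add: abs_mult)
  also have "\<dots> \<le> (real n)\<^sup>2 * (\<epsilon> / (real n)\<^sup>2)" using pq' by (intro mult_left_mono) auto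
  also have "\<dots> = \<epsilon>" using n1 by simp
  finally have ap: "\<bar>(real q)\<^sup>2 - (real p)\<^sup>2 / \<gamma>\<^sup>2\<bar> \<le> \<epsilon>" .
  have "4 * pi / T < real n" using n by simp
  also have "\<dots> \<le> real q" using pq' mult_left_mono[of 1 "real q'" "real n"] by (simp add: q_def)
  also have "\<dots> \<le> (real q)\<^sup>2" using pq by (simp add: power2_eq_square)
  finally have q2: "4 * pi < T * (real q)\<^sup>2" using T by (simp add: field_simps)
  \<comment> \<open>the number of periods \<open>2\<pi>/q\<^sup>2\<close> that fit into \<open>[0,T]\<close>\<close>
  define j where "j = nat \<lfloor>T * (real q)\<^sup>2 / (2 * pi)\<rfloor>"
  define T' where "T' = 2 * pi * real j / (real q)\<^sup>2"
  have jr: "real j \<le> T * (real q)\<^sup>2 / (2 * pi)" "real j > T * (real q)\<^sup>2 / (2 * pi) - 1"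
    using T unfolding j_def by (auto intro: of_nat_floor)
  have T'le: "T' \<le> T"
    using jr(1) pq by (simp add: T'_def field_simps)
  have T'ge: "T' \<ge> T / 2"
  proof -
    have "real j * (2 * pi) \<ge> T * (real q)\<^sup>2 - 2 * pi" using jr(2) by (simp add: field_simps)
    then have "real j * (2 * pi) \<ge> T * (real q)\<^sup>2 / 2" using q2 by linarith
    then show ?thesis using pq by (simp add: T'_def field_simps)
  qed
  define K where "K = (\<lambda>(a, b). (int (q * a), int (p * b))) ` ({0..<N} \<times> {0..<N})"
  have "inj_on (\<lambda>(a, b). (int (q * a), int (p * b))) ({0..<N} \<times> {0..<N})" using pq by (auto simp: inj_on_def)
  then have cardK: "card K = N * N" by (simp add: K_def card_image)
  have finK: "finite K" by (simp add: K_def)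
  let ?h = "\<lambda>t. tint \<gamma> (\<lambda>x. norm (free_wave \<gamma> K t x) ^ 4)"
  have cont: "continuous_on A ?h" for A by (rule continuous_on_tint_free_wave[OF \<gamma> finK])
  have N4: "real N ^ 4 \<ge> 1" using N by simp
  have R1: "R - 1 > (B - 1) * real N ^ 4" unfolding R_def left_diff_distrib using N(2) N4 by linarith
  have R0: "R - 1 \<ge> 0" using R1 B N4 by (smt (verit) mult_nonneg_nonneg)
  have "C * (V * real (card K))\<^sup>2 \<le> \<bar>C\<bar> * (V * real (card K))\<^sup>2" by (intro mult_right_mono) auto
  also have "\<dots> = V * (T / 2) * ((B - 1) * real N ^ 4)"
    using T by (simp add: B_def cardK power_mult_distrib power4_eq_xxxx power2_eq_square)
  also have "\<dots> < V * (T / 2) * (R - 1)" using R1 V T by (intro mult_strict_left_mono) auto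
  also have "\<dots> \<le> V * T' * (R - 1)" using T'ge V R0 by (intro mult_right_mono mult_left_mono) auto
  also have "\<dots> \<le> V * T' * (R - 2 * T' * \<epsilon> * real N ^ 10)"
  proof -
    have "2 * T' * \<epsilon> * real N ^ 10 \<le> 2 * T * \<epsilon> * real N ^ 10" using T'le eps by (intro mult_right_mono mult_left_mono) auto
    also have "\<dots> = 1" using T N by (simp add: \<epsilon>_def)
    finally show ?thesis using V T'ge T by (intro mult_left_mono) auto
  qed
  also have "\<dots> \<le> integral {0..T'} ?h"
    using integral_free_wave_ge[OF \<gamma> pq T'_def ap, of N] unfolding V_def R_def K_def .
  also have "\<dots> \<le> integral {0..T} ?h"
    using T'le T'ge T by (intro integral_subset_le integrable_continuous_real cont) (auto simp: tint_free_wave_fourth_nonneg)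
  finally show ?thesis using finK unfolding V_def by blast
qed

section \<open>Failure of the Strichartz estimate\<close>

lemma fourier_coeff_eq:
  "fourier_coeff \<gamma> f k = (LINT x|torus_measure \<gamma>. f x * cnj (character \<gamma> k x)) / of_real (4 * pi\<^sup>2 * \<gamma>)"
  by (simp add: fourier_coeff_def character_def exp_cnj)

lemma fourier_coeff_trig_poly:
  assumes "\<gamma> > 0" "finite K"
  shows "fourier_coeff \<gamma> (trig_poly \<gamma> K c) k = (if k \<in> K then c k else 0)"
proof -
  have "(LINT x|torus_measure \<gamma>. trig_poly \<gamma> K c x * cnj (character \<gamma> k x)) = tint \<gamma> (\<lambda>x. trig_poly \<gamma> K c x * cnj (character \<gamma> k x))"
    by (intro torus_integral_eq continuous_intros)
  then show ?thesis using assms by (simp add: fourier_coeff_eq tint_trig_poly_mult_cnj_character)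
qed

lemma continuous_periodic_in_L2:
  assumes "continuous_on UNIV f" "torus_periodic \<gamma> f"
  shows "f \<in> vecs (L2 \<gamma>)"
proof -
  have "integrable (torus_measure \<gamma>) (\<lambda>x. (norm (f x))\<^sup>2)"
    by (intro integrable_torus continuous_intros assms)
  then show ?thesis using assms by (simp add: L2_def borel_measurable_continuous_onI)
qed

lemma snorm_L2_eq:
  assumes "continuous_on UNIV f"
  shows "snorm (L2 \<gamma>) f = sqrt (tint \<gamma> (\<lambda>x. (norm (f x))\<^sup>2))"
proof -
  have "(LINT x|torus_measure \<gamma>. (norm (f x))\<^sup>2) = tint \<gamma> (\<lambda>x. (norm (f x))\<^sup>2)"
    by (intro torus_integral_eq continuous_intros assms)
  then show ?thesis by (simp add: L2_def)
qed

lemma free_wave_in_L2: "\<gamma> > 0 \<Longrightarrow> free_wave \<gamma> K t \<in> vecs (L2 \<gamma>)"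
  unfolding free_wave_def by (intro continuous_periodic_in_L2 continuous_intros torus_periodic_trig_poly)

lemma snorm_free_wave: "\<gamma> > 0 \<Longrightarrow> finite K \<Longrightarrow> snorm (L2 \<gamma>) (free_wave \<gamma> K t) = sqrt (4 * pi\<^sup>2 * \<gamma> * card K)"
  using tint_norm_free_wave_squared[of \<gamma> K t] snorm_L2_eq[of "free_wave \<gamma> K t" \<gamma>]
  by (simp add: free_wave_def continuous_on_trig_poly)

lemma finite_torus_measure: "finite_measure (torus_measure \<gamma>)"
proof (rule finite_measureI)
  let ?A = "{0..<2 * pi} \<times> {0..<2 * pi * \<gamma>}"
  have A: "?A \<in> sets lborel" by (simp add: borel_prod[symmetric])
  have "emeasure lborel ?A \<le> emeasure lborel (cbox (0, 0) (2 * pi, 2 * pi * \<gamma>))"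
    by (intro emeasure_mono) (auto simp: mem_box Basis_prod_def)
  also have "\<dots> < \<infinity>" by (rule emeasure_lborel_cbox_finite)
  finally show "emeasure (torus_measure \<gamma>) (space (torus_measure \<gamma>)) \<noteq> \<infinity>"
    using A by (simp add: torus_measure_def space_restrict_space emeasure_restrict_space)
qed

lemma measurable_torus: "f \<in> borel_measurable borel \<Longrightarrow> f \<in> borel_measurable (torus_measure \<gamma>)"
  unfolding torus_measure_def by (intro measurable_restrict_space1) simp

lemma L2_integrable:
  assumes "f \<in> vecs (L2 \<gamma>)"
  shows "integrable (torus_measure \<gamma>) f"
proof -
  interpret finite_measure "torus_measure \<gamma>" by (rule finite_torus_measure)
  have f: "f \<in> borel_measurable borel" "integrable (torus_measure \<gamma>) (\<lambda>x. (norm (f x))\<^sup>2)"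
    using assms by (auto simp: L2_def)
  have "integrable (torus_measure \<gamma>) (\<lambda>x. 1 + (norm (f x))\<^sup>2)"
    using f by (intro Bochner_Integration.integrable_add integrable_const)
  then show ?thesis
  proof (rule Bochner_Integration.integrable_bound)
    show "f \<in> borel_measurable (torus_measure \<gamma>)" by (rule measurable_torus[OF f(1)])
    have "norm (f x) \<le> 1 + (norm (f x))\<^sup>2" for x
      using sum_squares_bound[of 1 "norm (f x)"] norm_ge_zero[of "f x"] by (simp only: power_one mult_1_right)
    then show "AE x in torus_measure \<gamma>. norm (f x) \<le> norm (1 + (norm (f x))\<^sup>2)"
      by (intro AE_I2) (simp add: abs_of_nonneg)
  qed
qed

lemma young_fourth:
  fixes a b :: real
  shows "a * b ^ 3 \<le> a ^ 4 / 4 + 3 / 4 * b ^ 4"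
proof -
  have "a ^ 4 + 3 * b ^ 4 - 4 * (a * b ^ 3) = (a - b)\<^sup>2 * ((a + b)\<^sup>2 + 2 * b\<^sup>2)"
    by (simp add: power4_eq_xxxx power3_eq_cube power2_eq_square algebra_simps)
  also have "\<dots> \<ge> 0" by (intro mult_nonneg_nonneg add_nonneg_nonneg) auto
  finally show ?thesis by simp
qed

text \<open>
  With \<open>P\<close> the trigonometric polynomial, \<open>\<integral>|P|\<^sup>4 = \<integral> P
  cnj(|P|\<^sup>2 P) = \<integral> f cnj(|P|\<^sup>2 P)\<close>, because \<open>|P|\<^sup>2 P\<close> is again a
  trigonometric polynomial and \<open>f\<close> has the same Fourier coefficients as \<open>P\<close>. Young's
  inequality bounds the right-hand side by \<open>\<integral>|f|\<^sup>4 / 4 + 3 \<integral>|P|\<^sup>4 /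
  4\<close>. The last term is absorbed on the left.
\<close>

lemma L4_norm_trig_poly_le:
  assumes \<gamma>: "\<gamma> > 0" and K: "finite K" and f: "f \<in> vecs (L2 \<gamma>)"
    and coeff: "\<And>k. fourier_coeff \<gamma> f k = fourier_coeff \<gamma> (trig_poly \<gamma> K c) k"
  shows "ennreal (tint \<gamma> (\<lambda>x. norm (trig_poly \<gamma> K c x) ^ 4)) \<le> (\<integral>\<^sup>+ x. ennreal (norm (f x) ^ 4) \<partial>torus_measure \<gamma>)"
proof (cases "integrable (torus_measure \<gamma>) (\<lambda>x. norm (f x) ^ 4)")
  case False
  have "f \<in> borel_measurable (torus_measure \<gamma>)" using f by (intro measurable_torus) (simp add: L2_def)
  then have "(\<lambda>x. norm (f x) ^ 4) \<in> borel_measurable (torus_measure \<gamma>)" by measurable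
  then have "(\<integral>\<^sup>+ x. ennreal (norm (f x) ^ 4) \<partial>torus_measure \<gamma>) = \<infinity>"
    using False by (simp add: integrable_iff_bounded flip: less_top)
  then show ?thesis by simp
next
  case True
  let ?M = "torus_measure \<gamma>"
  define P where "P = trig_poly \<gamma> K c"
  have contP: "continuous_on UNIV P" unfolding P_def by (rule continuous_on_trig_poly)
  have fi: "integrable ?M f" by (rule L2_integrable[OF f])
  \<comment> \<open>the functions \<open>W\<close> against which \<open>f\<close> and \<open>P\<close> have the same integral\<close>
  define good where "good W \<longleftrightarrow> integrable ?M (\<lambda>x. f x * cnj (W x)) \<and> integrable ?M (\<lambda>x. P x * cnj (W x)) \<and>
     (LINT x|?M. f x * cnj (W x)) = (LINT x|?M. P x * cnj (W x))" for W
  have good_sum: "good (\<lambda>x. \<Sum>i\<in>I. W i x)" if "\<And>i. i \<in> I \<Longrightarrow> good (W i)" for I :: "(int \<times> int) set" and W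
    using that unfolding good_def by (simp add: sum_distrib_left)
  have good_char: "good (\<lambda>x. a * character \<gamma> k x)" for a k
  proof -
    have meas: "character \<gamma> l \<in> borel_measurable ?M" for l
      by (intro measurable_torus borel_measurable_continuous_onI continuous_intros)
    have int: "integrable ?M (\<lambda>x. g x * cnj (character \<gamma> k x))" if "integrable ?M g" for g
    proof (rule Bochner_Integration.integrable_bound[OF that])
      show "(\<lambda>x. g x * cnj (character \<gamma> k x)) \<in> borel_measurable ?M"
        unfolding character_uminus[symmetric]
        by (intro borel_measurable_times borel_measurable_integrable[OF that] meas)
    qed (simp add: norm_mult)
    have "(LINT x|?M. f x * cnj (character \<gamma> k x)) = (LINT x|?M. P x * cnj (character \<gamma> k x))"
      using coeff[of k] \<gamma> by (simp add: fourier_coeff_eq P_def)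
    moreover have "(\<lambda>x. f x * cnj (a * character \<gamma> k x)) = (\<lambda>x. cnj a * (f x * cnj (character \<gamma> k x)))"
      "(\<lambda>x. P x * cnj (a * character \<gamma> k x)) = (\<lambda>x. cnj a * (P x * cnj (character \<gamma> k x)))"
      by (simp_all add: mult_ac)
    ultimately show ?thesis
      unfolding good_def using int[OF fi] int[OF integrable_torus[OF contP]] by simp
  qed
  define W where "W x = P x * P x * cnj (P x)" for x
  have "good (\<lambda>x. \<Sum>k1\<in>K. \<Sum>k2\<in>K. \<Sum>k3\<in>K. (c k1 * c k2 * cnj (c k3)) * character \<gamma> (k1 + k2 - k3) x)"
    by (intro good_sum good_char)
  also have "(\<lambda>x. \<Sum>k1\<in>K. \<Sum>k2\<in>K. \<Sum>k3\<in>K. (c k1 * c k2 * cnj (c k3)) * character \<gamma> (k1 + k2 - k3) x) = W"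
  proof
    fix x
    have "(\<Sum>k1\<in>K. \<Sum>k2\<in>K. \<Sum>k3\<in>K. (c k1 * c k2 * cnj (c k3)) * character \<gamma> (k1 + k2 - k3) x)
      = (\<Sum>k1\<in>K. \<Sum>k2\<in>K. \<Sum>k3\<in>K. (c k1 * character \<gamma> k1 x) * (c k2 * character \<gamma> k2 x) * cnj (c k3 * character \<gamma> k3 x))"
      by (simp add: character_add character_diff mult_ac)
    also have "\<dots> = W x"
      unfolding W_def P_def trig_poly_def cnj_sum by (simp only: sum_distrib_left[symmetric] sum_distrib_right[symmetric])
    finally show "(\<Sum>k1\<in>K. \<Sum>k2\<in>K. \<Sum>k3\<in>K. (c k1 * c k2 * cnj (c k3)) * character \<gamma> (k1 + k2 - k3) x) = W x" .
  qed
  finally have W: "good W" .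
  define A where "A = tint \<gamma> (\<lambda>x. norm (P x) ^ 4)"
  have contP4: "continuous_on UNIV (\<lambda>x. norm (P x) ^ 4)" by (intro continuous_intros contP)
  have A: "(LINT x|?M. norm (P x) ^ 4) = A" unfolding A_def by (rule torus_integral_eq[OF contP4])
  have A0: "A \<ge> 0" unfolding A_def by (rule tint_nonneg[OF contP4]) auto
  have "(LINT x|?M. P x * cnj (W x)) = (LINT x|?M. of_real (norm (P x) ^ 4))"
  proof (rule Bochner_Integration.integral_cong[OF refl])
    fix x
    have "P x * cnj (W x) = (P x * cnj (P x))\<^sup>2" by (simp add: W_def power2_eq_square mult_ac)
    also have "\<dots> = (complex_of_real ((norm (P x))\<^sup>2))\<^sup>2" by (simp only: complex_norm_square)
    finally show "P x * cnj (W x) = of_real (norm (P x) ^ 4)" by simp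
  qed
  also have "\<dots> = of_real A" by (simp only: integral_complex_of_real A)
  finally have "A = norm (LINT x|?M. f x * cnj (W x))" using W A0 by (simp add: good_def)
  also have "\<dots> \<le> (LINT x|?M. norm (f x * cnj (W x)))" by (rule integral_norm_bound)
  also have "\<dots> \<le> (LINT x|?M. norm (f x) ^ 4 / 4 + 3 / 4 * norm (P x) ^ 4)"
  proof (rule integral_mono)
    show "integrable ?M (\<lambda>x. norm (f x * cnj (W x)))" using W by (simp add: good_def)
    show "integrable ?M (\<lambda>x. norm (f x) ^ 4 / 4 + 3 / 4 * norm (P x) ^ 4)"
      using True integrable_torus[OF contP4] by simp
    fix x
    have "norm (f x * cnj (W x)) = norm (f x) * norm (P x) ^ 3" by (simp add: W_def norm_mult power3_eq_cube)
    then show "norm (f x * cnj (W x)) \<le> norm (f x) ^ 4 / 4 + 3 / 4 * norm (P x) ^ 4"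
      using young_fourth[of "norm (f x)" "norm (P x)"] by simp
  qed
  also have "\<dots> = (LINT x|?M. norm (f x) ^ 4) / 4 + 3 / 4 * A"
    using True integrable_torus[OF contP4] by (simp add: A)
  finally have "A \<le> (LINT x|?M. norm (f x) ^ 4)" by simp
  also have "ennreal \<dots> = (\<integral>\<^sup>+ x. ennreal (norm (f x) ^ 4) \<partial>?M)"
    using True by (intro nn_integral_eq_integral[symmetric]) auto
  finally show ?thesis by (simp add: A_def P_def ennreal_leI)
qed

text \<open>
  \<open>L4_norm_trig_poly_le\<close> holds at every time, so Tonelli's theorem transfers the lower bound for the
  explicit wave to whichever evolution is selected in the definition of \<open>schroedinger\<close>.
\<close>

theorem not_L4_strichartz:
  assumes \<gamma>: "\<gamma> > 0" and wa: "well_approximable \<gamma>" and T: "T > 0"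
  shows "\<not> L4_strichartz \<gamma> T"
proof
  assume "L4_strichartz \<gamma> T"
  then obtain C where C: "\<And>\<phi>. \<phi> \<in> vecs (L2 \<gamma>) \<Longrightarrow> L4_norm T \<gamma> (schroedinger \<gamma> \<phi>) \<le> ennreal (C * snorm (L2 \<gamma>) \<phi>)"
    unfolding L4_strichartz_def by blast
  obtain K where K: "finite K" and big: "integral {0..T} (\<lambda>t. tint \<gamma> (\<lambda>x. norm (free_wave \<gamma> K t x) ^ 4))
      > C ^ 4 * (4 * pi\<^sup>2 * \<gamma> * real (card K))\<^sup>2"
    using free_wave_strichartz_ratio_unbounded[OF \<gamma> wa T] by blast
  define \<phi> where "\<phi> = free_wave \<gamma> K 0"
  define u where "u = schroedinger \<gamma> \<phi>"
  define h where "h t = tint \<gamma> (\<lambda>x. norm (free_wave \<gamma> K t x) ^ 4)" for t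
  define good where "good u \<longleftrightarrow> (\<lambda>(t, x). u t x) \<in> borel_measurable borel \<and>
     (\<forall>t. u t \<in> vecs (L2 \<gamma>) \<and>
        (\<forall>k. fourier_coeff \<gamma> (u t) k =
               exp (- \<i> * of_real ((norm (freq \<gamma> k))\<^sup>2 * t)) * fourier_coeff \<gamma> \<phi> k))" for u
  have "good (free_wave \<gamma> K)"
    unfolding good_def
  proof (intro conjI allI)
    show "(\<lambda>(t, x). free_wave \<gamma> K t x) \<in> borel_measurable borel"
      by (rule borel_measurable_continuous_onI[OF continuous_on_free_wave])
    show "free_wave \<gamma> K t \<in> vecs (L2 \<gamma>)" for t by (rule free_wave_in_L2[OF \<gamma>])
    show "fourier_coeff \<gamma> (free_wave \<gamma> K t) k = exp (- \<i> * of_real ((norm (freq \<gamma> k))\<^sup>2 * t)) * fourier_coeff \<gamma> \<phi> k" for t k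
      by (simp add: \<phi>_def free_wave_def fourier_coeff_trig_poly[OF \<gamma> K])
  qed
  moreover have "u = (SOME u. good u)" unfolding u_def schroedinger_def good_def ..
  ultimately have "good u" by (metis someI)
  then have um: "(\<lambda>(t, x). u t x) \<in> borel_measurable borel" and u2: "\<And>t. u t \<in> vecs (L2 \<gamma>)"
    and uc: "\<And>t k. fourier_coeff \<gamma> (u t) k = fourier_coeff \<gamma> (free_wave \<gamma> K t) k"
    using \<open>good (free_wave \<gamma> K)\<close> unfolding good_def by auto
  have slice: "ennreal (h t) \<le> (\<integral>\<^sup>+ x. ennreal (norm (u t x) ^ 4) \<partial>torus_measure \<gamma>)" for t
    unfolding h_def free_wave_def
    by (rule L4_norm_trig_poly_le[OF \<gamma> K u2]) (simp add: uc free_wave_def)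
  let ?R = "restrict_space lborel {0..T}"
  let ?M = "?R \<Otimes>\<^sub>M torus_measure \<gamma>"
  let ?g = "\<lambda>(t, x). norm (u t x) ^ 4"
  have le: "L4_norm T \<gamma> u \<le> ennreal (C * snorm (L2 \<gamma>) \<phi>)"
    unfolding u_def \<phi>_def by (intro C free_wave_in_L2 \<gamma>)
  have int: "integrable ?M ?g"
    using le unfolding L4_norm_def Let_def by (cases "integrable ?M ?g") (auto simp: top_unique)
  define J where "J = integral\<^sup>L ?M ?g"
  have J0: "J \<ge> 0" unfolding J_def by (intro Bochner_Integration.integral_nonneg) auto
  have le': "ennreal (root 4 J) \<le> ennreal (C * snorm (L2 \<gamma>) \<phi>)"
    using le int unfolding L4_norm_def Let_def J_def by simp
  have hcont: "continuous_on {0..T} h" unfolding h_def by (rule continuous_on_tint_free_wave[OF \<gamma> K])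
  have h0: "h t \<ge> 0" for t unfolding h_def by (rule tint_free_wave_fourth_nonneg)
  interpret finite_measure "torus_measure \<gamma>" by (rule finite_torus_measure)
  have seth: "set_integrable lborel {0..T} h"
    unfolding set_integrable_def by (intro borel_integrable_compact hcont) auto
  have "ennreal (integral {0..T} h) = (\<integral>\<^sup>+ t. ennreal (h t) \<partial>?R)"
  proof -
    have "integrable ?R h" using seth by (simp add: integrable_restrict_space set_integrable_def)
    moreover have "integral\<^sup>L ?R h = integral {0..T} h"
      using set_borel_integral_eq_integral(2)[OF seth] by (simp add: integral_restrict_space set_lebesgue_integral_def)
    ultimately show ?thesis using h0 by (subst nn_integral_eq_integral) auto
  qed
  also have "\<dots> \<le> (\<integral>\<^sup>+ t. (\<integral>\<^sup>+ x. ennreal (norm (u t x) ^ 4) \<partial>torus_measure \<gamma>) \<partial>?R)"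
    by (intro nn_integral_mono slice)
  also have "\<dots> = (\<integral>\<^sup>+ z. ennreal (?g z) \<partial>?M)"
    using nn_integral_fst[of "\<lambda>z. ennreal (?g z)" ?R] borel_measurable_integrable[OF int] by simp
  also have "\<dots> = ennreal J"
    unfolding J_def using int by (intro nn_integral_eq_integral) auto
  finally have hJ: "integral {0..T} h \<le> J" using J0 by simp
  have pos: "integral {0..T} h > 0" using big unfolding h_def
    by (rule le_less_trans[rotated]) (intro mult_nonneg_nonneg, auto)
  then have "root 4 J > 0" using hJ by simp
  then have "root 4 J \<le> C * snorm (L2 \<gamma>) \<phi>" using le'
    by (metis ennreal_le_iff2 less_le_not_le order_less_imp_le linorder_not_le)
  then have "(root 4 J) ^ 4 \<le> (C * snorm (L2 \<gamma>) \<phi>) ^ 4" using \<open>root 4 J > 0\<close> by (intro power_mono) auto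
  also have "(root 4 J) ^ 4 = J" using J0 by simp
  also have "(C * snorm (L2 \<gamma>) \<phi>) ^ 4 = C ^ 4 * ((snorm (L2 \<gamma>) \<phi>)\<^sup>2)\<^sup>2" by (simp add: power_mult_distrib)
  also have "(snorm (L2 \<gamma>) \<phi>)\<^sup>2 = 4 * pi\<^sup>2 * \<gamma> * real (card K)"
    unfolding \<phi>_def using \<gamma> by (simp add: snorm_free_wave[OF \<gamma> K])
  finally show False using big hJ unfolding h_def by linarith
qed

section \<open>Third order Taylor expansion in seminormed spaces\<close>

definition seminormed_space :: "'a::real_vector seminormed \<Rightarrow> bool" where
  "seminormed_space E \<longleftrightarrow>
     0 \<in> vecs E \<and>
     (\<forall>x\<in>vecs E. \<forall>y\<in>vecs E. x + y \<in> vecs E \<and> snorm E (x + y) \<le> snorm E x + snorm E y) \<and>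
     (\<forall>c. \<forall>x\<in>vecs E. c *\<^sub>R x \<in> vecs E \<and> snorm E (c *\<^sub>R x) = \<bar>c\<bar> * snorm E x)"

lemma seminormed_spaceI:
  assumes "0 \<in> vecs E"
    and "\<And>x y. x \<in> vecs E \<Longrightarrow> y \<in> vecs E \<Longrightarrow> x + y \<in> vecs E"
    and "\<And>x y. x \<in> vecs E \<Longrightarrow> y \<in> vecs E \<Longrightarrow> snorm E (x + y) \<le> snorm E x + snorm E y"
    and "\<And>c x. x \<in> vecs E \<Longrightarrow> c *\<^sub>R x \<in> vecs E"
    and le: "\<And>c x. x \<in> vecs E \<Longrightarrow> snorm E (c *\<^sub>R x) \<le> \<bar>c\<bar> * snorm E x"
    and nonneg: "\<And>x. x \<in> vecs E \<Longrightarrow> snorm E x \<ge> 0"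
  shows "seminormed_space E"
proof -
  have "snorm E (c *\<^sub>R x) = \<bar>c\<bar> * snorm E x" if x: "x \<in> vecs E" for c x
  proof (cases "c = 0")
    case True
    then show ?thesis using le[OF x, of 0] nonneg[of "0 *\<^sub>R x"] assms(1) by simp
  next
    case False
    have "snorm E x = snorm E (inverse c *\<^sub>R (c *\<^sub>R x))" using False by simp
    also have "\<dots> \<le> \<bar>inverse c\<bar> * snorm E (c *\<^sub>R x)" using assms(4)[OF x] by (rule le)
    finally have "\<bar>c\<bar> * snorm E x \<le> snorm E (c *\<^sub>R x)" using False by (simp add: field_simps abs_inverse)
    then show ?thesis using le[OF x, of c] by simp
  qed
  then show ?thesis unfolding seminormed_space_def using assms(1-4) by simp
qed

context
  fixes E :: "'a::real_vector seminormed"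
  assumes E: "seminormed_space E"
begin

lemma vecs_zero: "0 \<in> vecs E" and
  vecs_add: "\<And>x y. x \<in> vecs E \<Longrightarrow> y \<in> vecs E \<Longrightarrow> x + y \<in> vecs E" and
  vecs_scaleR: "\<And>x c. x \<in> vecs E \<Longrightarrow> c *\<^sub>R x \<in> vecs E" and
  snorm_triangle: "\<And>x y. x \<in> vecs E \<Longrightarrow> y \<in> vecs E \<Longrightarrow> snorm E (x + y) \<le> snorm E x + snorm E y" and
  snorm_scaleR: "\<And>x c. x \<in> vecs E \<Longrightarrow> snorm E (c *\<^sub>R x) = \<bar>c\<bar> * snorm E x"
  using E unfolding seminormed_space_def by blast+

lemma vecs_diff: "x \<in> vecs E \<Longrightarrow> y \<in> vecs E \<Longrightarrow> x - y \<in> vecs E"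
  using vecs_add[of x "-1 *\<^sub>R y"] vecs_scaleR[of y "-1"] by simp

lemma snorm_zero: "snorm E 0 = 0"
  using snorm_scaleR[of 0 0] vecs_zero by simp

lemma snorm_minus: "x \<in> vecs E \<Longrightarrow> snorm E (- x) = snorm E x"
  using snorm_scaleR[of x "-1"] by simp

lemma snorm_diff_triangle: "x \<in> vecs E \<Longrightarrow> y \<in> vecs E \<Longrightarrow> snorm E (x - y) \<le> snorm E x + snorm E y"
  using snorm_triangle[of x "-y"] vecs_scaleR[of y "-1"] snorm_minus[of y] by simp

lemma snorm_nonneg: "x \<in> vecs E \<Longrightarrow> snorm E x \<ge> 0"
  using snorm_diff_triangle[of x x] snorm_zero by simp

lemma snorm_triangle_sub: "x \<in> vecs E \<Longrightarrow> y \<in> vecs E \<Longrightarrow> snorm E x \<le> snorm E y + snorm E (x - y)"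
  using snorm_triangle[of y "x - y"] vecs_diff[of x y] by simp

lemma snorm_eq_0_add:
  assumes "x \<in> vecs E" "y \<in> vecs E" "snorm E x = 0" "snorm E y = 0"
  shows "snorm E (x + y) = 0"
  using snorm_triangle[OF assms(1,2)] snorm_nonneg[OF vecs_add[OF assms(1,2)]] assms by simp

end

text \<open>
  Continuity on the compact interval makes \<open>t \<mapsto> snorm F (u t)\<close> bounded, so that the supremum
  in the definition of the seminorm is meaningful.
\<close>

lemma seminormed_space_curve:
  assumes F: "seminormed_space F" and T: "T \<ge> 0"
  shows "seminormed_space (curve_space T F)"
    and "\<And>u t. u \<in> vecs (curve_space T F) \<Longrightarrow> t \<in> {0..T} \<Longrightarrow> snorm F (u t) \<le> snorm (curve_space T F) u"
proof -
  have ne: "{0..T} \<noteq> {}" using T by simp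
  have bdd: "bdd_above ((\<lambda>t. snorm F (u t)) ` {0..T})" if u: "u \<in> vecs (curve_space T F)" for u
  proof -
    have uF: "u t \<in> vecs F" if "t \<in> {0..T}" for t using u that by (simp add: curve_space_def)
    have "continuous_on {0..T} (\<lambda>t. snorm F (u t))"
      unfolding continuous_on_def
    proof
      fix t assume t: "t \<in> {0..T}"
      have lim: "((\<lambda>s. snorm F (u s - u t)) \<longlongrightarrow> 0) (at t within {0..T})"
        using u t by (simp add: curve_space_def)
      have "((\<lambda>s. snorm F (u s) - snorm F (u t)) \<longlongrightarrow> 0) (at t within {0..T})"
      proof (rule Lim_null_comparison[OF _ lim])
        show "\<forall>\<^sub>F s in at t within {0..T}. norm (snorm F (u s) - snorm F (u t)) \<le> snorm F (u s - u t)"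
          unfolding eventually_at_filter
        proof (intro always_eventually allI impI)
          fix s assume "s \<noteq> t" "s \<in> {0..T}"
          then have *: "u s \<in> vecs F" "u t \<in> vecs F" using uF t by auto
          show "norm (snorm F (u s) - snorm F (u t)) \<le> snorm F (u s - u t)"
            using snorm_triangle_sub[OF F *] snorm_triangle_sub[OF F *(2,1)]
              snorm_minus[OF F vecs_diff[OF F *]] by simp
        qed
      qed
      then show "((\<lambda>t. snorm F (u t)) \<longlongrightarrow> snorm F (u t)) (at t within {0..T})"
        by (simp add: LIM_zero_iff)
    qed
    then show ?thesis
      by (intro bounded_imp_bdd_above compact_imp_bounded compact_continuous_image) auto
  qed
  show up: "snorm F (u t) \<le> snorm (curve_space T F) u" if "u \<in> vecs (curve_space T F)" "t \<in> {0..T}" for u t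
    using cSUP_upper[OF that(2) bdd[OF that(1)]] by (simp add: curve_space_def)
  have least: "snorm (curve_space T F) u \<le> B" if "\<And>t. t \<in> {0..T} \<Longrightarrow> snorm F (u t) \<le> B" for u B
    using ne that by (auto simp: curve_space_def intro!: cSUP_least)
  have vec: "u t \<in> vecs F" if "u \<in> vecs (curve_space T F)" "t \<in> {0..T}" for u t
    using that by (simp add: curve_space_def)
  show "seminormed_space (curve_space T F)"
  proof (rule seminormed_spaceI)
    show "0 \<in> vecs (curve_space T F)"
      using vecs_zero[OF F] snorm_zero[OF F] by (simp add: curve_space_def)
  next
    fix u v assume uv: "u \<in> vecs (curve_space T F)" "v \<in> vecs (curve_space T F)"
    show "u + v \<in> vecs (curve_space T F)"
      unfolding curve_space_def
    proof (simp, intro ballI conjI)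
      fix t assume t: "t \<in> {0..T}"
      show "u t + v t \<in> vecs F" using uv t vec vecs_add[OF F] by blast
      have lim: "((\<lambda>s. snorm F (u s - u t) + snorm F (v s - v t)) \<longlongrightarrow> 0 + 0) (at t within {0..T})"
        using uv t by (intro tendsto_add) (auto simp: curve_space_def)
      show "((\<lambda>s. snorm F (u s + v s - (u t + v t))) \<longlongrightarrow> 0) (at t within {0..T})"
      proof (rule Lim_null_comparison[OF _ lim[simplified]])
        show "\<forall>\<^sub>F s in at t within {0..T}. norm (snorm F (u s + v s - (u t + v t))) \<le> snorm F (u s - u t) + snorm F (v s - v t)"
          unfolding eventually_at_filter
        proof (intro always_eventually allI impI)
          fix s assume "s \<noteq> t" "s \<in> {0..T}"
          then have *: "u s - u t \<in> vecs F" "v s - v t \<in> vecs F" using vec uv t vecs_diff[OF F] by auto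
          have "u s + v s - (u t + v t) = (u s - u t) + (v s - v t)" by simp
          then show "norm (snorm F (u s + v s - (u t + v t))) \<le> snorm F (u s - u t) + snorm F (v s - v t)"
            using snorm_triangle[OF F *] snorm_nonneg[OF F vecs_add[OF F *]] by (simp only: real_norm_def abs_of_nonneg)
        qed
      qed
    qed
    show "snorm (curve_space T F) (u + v) \<le> snorm (curve_space T F) u + snorm (curve_space T F) v"
    proof (rule least)
      fix t assume t: "t \<in> {0..T}"
      show "snorm F ((u + v) t) \<le> snorm (curve_space T F) u + snorm (curve_space T F) v"
        using snorm_triangle[OF F vec[OF uv(1) t] vec[OF uv(2) t]] up[OF uv(1) t] up[OF uv(2) t] by simp
    qed
  next
    fix u and c :: real assume u: "u \<in> vecs (curve_space T F)"
    show "c *\<^sub>R u \<in> vecs (curve_space T F)"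
      unfolding curve_space_def
    proof (simp add: scaleR_fun_def, intro ballI conjI)
      fix t assume t: "t \<in> {0..T}"
      show "c *\<^sub>R u t \<in> vecs F" using u t vec vecs_scaleR[OF F] by blast
      have lim: "((\<lambda>s. \<bar>c\<bar> * snorm F (u s - u t)) \<longlongrightarrow> \<bar>c\<bar> * 0) (at t within {0..T})"
        using u t by (intro tendsto_mult_left) (auto simp: curve_space_def)
      show "((\<lambda>s. snorm F (c *\<^sub>R u s - c *\<^sub>R u t)) \<longlongrightarrow> 0) (at t within {0..T})"
      proof (rule Lim_null_comparison[OF _ lim[simplified]])
        show "\<forall>\<^sub>F s in at t within {0..T}. norm (snorm F (c *\<^sub>R u s - c *\<^sub>R u t)) \<le> \<bar>c\<bar> * snorm F (u s - u t)"
          unfolding eventually_at_filter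
        proof (intro always_eventually allI impI)
          fix s assume "s \<noteq> t" "s \<in> {0..T}"
          then have *: "u s - u t \<in> vecs F" using vec u t vecs_diff[OF F] by auto
          show "norm (snorm F (c *\<^sub>R u s - c *\<^sub>R u t)) \<le> \<bar>c\<bar> * snorm F (u s - u t)"
            using snorm_scaleR[OF F *, of c] snorm_nonneg[OF F *] by (simp flip: scaleR_diff_right)
        qed
      qed
    qed
    show "snorm (curve_space T F) (c *\<^sub>R u) \<le> \<bar>c\<bar> * snorm (curve_space T F) u"
    proof (rule least)
      fix t assume t: "t \<in> {0..T}"
      show "snorm F ((c *\<^sub>R u) t) \<le> \<bar>c\<bar> * snorm (curve_space T F) u"
        using snorm_scaleR[OF F vec[OF u t], of c] up[OF u t] by (simp add: scaleR_fun_def mult_left_mono)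
    qed
    have "0 \<in> {0..T}" using T by simp
    then show "snorm (curve_space T F) u \<ge> 0"
      using up[OF u, of 0] snorm_nonneg[OF F vec[OF u, of 0]] by simp
  qed
qed

lemma blin_bdd_above:
  assumes E: "seminormed_space E" and A: "bounded_lin E F A"
  shows "bdd_above ((\<lambda>x. snorm F (A x)) ` snorm_cball E 1)"
proof -
  obtain K where K: "\<And>x. x \<in> vecs E \<Longrightarrow> snorm F (A x) \<le> K * snorm E x"
    using A unfolding bounded_lin_def by blast
  show ?thesis
  proof (rule bdd_aboveI2)
    fix x assume "x \<in> snorm_cball E 1"
    then have x: "x \<in> vecs E" "snorm E x \<le> 1" by (auto simp: snorm_cball_def)
    have "snorm F (A x) \<le> K * snorm E x" by (rule K[OF x(1)])
    also have "\<dots> \<le> \<bar>K\<bar> * 1" using x snorm_nonneg[OF E x(1)] by (intro mult_mono) auto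
    finally show "snorm F (A x) \<le> \<bar>K\<bar>" by simp
  qed
qed

text \<open>
  Homogeneity of \<open>A\<close> holds only modulo vectors of seminorm zero, and the unit ball can be reached by
  rescaling only for vectors of positive seminorm; on the others the bound in \<open>bounded_lin\<close> forces
  \<open>A x\<close> to have seminorm zero.
\<close>

lemma blin_bound:
  assumes E: "seminormed_space E" and F: "seminormed_space F"
    and A: "bounded_lin E F A" and x: "x \<in> vecs E"
  shows "snorm F (A x) \<le> snorm (blin_space E F) A * snorm E x"
proof -
  obtain K where K: "\<And>x. x \<in> vecs E \<Longrightarrow> snorm F (A x) \<le> K * snorm E x"
    using A unfolding bounded_lin_def by blast
  have AF: "\<And>x. x \<in> vecs E \<Longrightarrow> A x \<in> vecs F" using A unfolding bounded_lin_def by blast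
  note bdd = blin_bdd_above[OF E A]
  show ?thesis
  proof (cases "snorm E x = 0")
    case True
    then show ?thesis using K[OF x] by simp
  next
    case False
    define c where "c = snorm E x"
    have c: "c > 0" using False snorm_nonneg[OF E x] by (simp add: c_def)
    define y where "y = inverse c *\<^sub>R x"
    have y: "y \<in> vecs E" using vecs_scaleR[OF E x] by (simp add: y_def)
    have "y \<in> snorm_cball E 1"
      using y snorm_scaleR[OF E x, of "inverse c"] c by (simp add: snorm_cball_def y_def c_def)
    then have Ay: "snorm F (A y) \<le> snorm (blin_space E F) A"
      using cSUP_upper[OF _ bdd] by (simp add: blin_space_def)
    have xy: "x = c *\<^sub>R y" using c by (simp add: y_def)
    have "snorm F (A (c *\<^sub>R y) - c *\<^sub>R A y) = 0" using A y unfolding bounded_lin_def by blast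
    then have "snorm F (A x) \<le> snorm F (c *\<^sub>R A y)"
      using snorm_triangle_sub[OF F AF[OF x] vecs_scaleR[OF F AF[OF y]], of c] xy by simp
    also have "\<dots> = c * snorm F (A y)" using snorm_scaleR[OF F AF[OF y], of c] c by simp
    also have "\<dots> \<le> c * snorm (blin_space E F) A" using Ay c by (intro mult_left_mono) auto
    finally show ?thesis by (simp add: c_def mult.commute)
  qed
qed

lemma blin_least:
  assumes E: "seminormed_space E"
    and "\<And>x. x \<in> vecs E \<Longrightarrow> snorm E x \<le> 1 \<Longrightarrow> snorm F (A x) \<le> B"
  shows "snorm (blin_space E F) A \<le> B"
proof -
  have "0 \<in> snorm_cball E 1" using vecs_zero[OF E] snorm_zero[OF E] by (simp add: snorm_cball_def)
  then show ?thesis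
    using assms(2) by (auto simp: blin_space_def snorm_cball_def intro!: cSUP_least)
qed

lemma seminormed_space_blin:
  assumes E: "seminormed_space E" and F: "seminormed_space F"
  shows "seminormed_space (blin_space E F)"
proof (rule seminormed_spaceI)
  have ve: "A \<in> vecs (blin_space E F) \<longleftrightarrow> bounded_lin E F A" for A by (simp add: blin_space_def)
  show "0 \<in> vecs (blin_space E F)"
    unfolding ve bounded_lin_def using vecs_zero[OF F] snorm_zero[OF F] by (auto intro: exI[of _ 0])
  have nonneg: "snorm (blin_space E F) A \<ge> 0" if A: "A \<in> vecs (blin_space E F)" for A
  proof -
    have A': "bounded_lin E F A" using A by (simp add: ve)
    then have AF: "\<And>x. x \<in> vecs E \<Longrightarrow> A x \<in> vecs F" unfolding bounded_lin_def by blast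
    have "0 \<in> snorm_cball E 1" using vecs_zero[OF E] snorm_zero[OF E] by (simp add: snorm_cball_def)
    from cSUP_upper[OF this blin_bdd_above[OF E A']] show ?thesis
      using snorm_nonneg[OF F AF[OF vecs_zero[OF E]]] by (simp add: blin_space_def)
  qed
  fix A assume A: "A \<in> vecs (blin_space E F)"
  then have Al: "bounded_lin E F A" by (simp add: ve)
  from Al have AF: "\<And>x. x \<in> vecs E \<Longrightarrow> A x \<in> vecs F" unfolding bounded_lin_def by blast
  show "snorm (blin_space E F) A \<ge> 0" by (rule nonneg[OF A])
  fix c :: real
  show "c *\<^sub>R A \<in> vecs (blin_space E F)"
    unfolding ve bounded_lin_def scaleR_fun_def
  proof (intro conjI ballI allI exI)
    fix x y assume x: "x \<in> vecs E" and y: "y \<in> vecs E"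
    show "c *\<^sub>R A x \<in> vecs F" using AF x vecs_scaleR[OF F] by blast
    have "c *\<^sub>R A (x + y) - (c *\<^sub>R A x + c *\<^sub>R A y) = c *\<^sub>R (A (x + y) - (A x + A y))"
      by (simp add: algebra_simps)
    moreover have "A (x + y) - (A x + A y) \<in> vecs F"
      using AF x y vecs_add[OF E x y] by (intro vecs_diff[OF F] vecs_add[OF F]) auto
    moreover have "snorm F (A (x + y) - (A x + A y)) = 0" using Al x y unfolding bounded_lin_def by blast
    ultimately show "snorm F (c *\<^sub>R A (x + y) - (c *\<^sub>R A x + c *\<^sub>R A y)) = 0"
      using snorm_scaleR[OF F] by simp
  next
    fix d x assume x: "x \<in> vecs E"
    have "c *\<^sub>R A (d *\<^sub>R x) - d *\<^sub>R c *\<^sub>R A x = c *\<^sub>R (A (d *\<^sub>R x) - d *\<^sub>R A x)"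
      by (simp add: algebra_simps)
    moreover have "A (d *\<^sub>R x) - d *\<^sub>R A x \<in> vecs F"
      using AF x vecs_scaleR[OF E x] by (intro vecs_diff[OF F] vecs_scaleR[OF F]) auto
    moreover have "snorm F (A (d *\<^sub>R x) - d *\<^sub>R A x) = 0" using Al x unfolding bounded_lin_def by blast
    ultimately show "snorm F (c *\<^sub>R A (d *\<^sub>R x) - d *\<^sub>R c *\<^sub>R A x) = 0"
      using snorm_scaleR[OF F] by simp
  next
    fix x assume x: "x \<in> vecs E"
    show "snorm F (c *\<^sub>R A x) \<le> (\<bar>c\<bar> * snorm (blin_space E F) A) * snorm E x"
      using mult_left_mono[OF blin_bound[OF E F Al x], of "\<bar>c\<bar>"] snorm_scaleR[OF F AF[OF x], of c] by (simp add: mult.assoc)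
  qed
  show "snorm (blin_space E F) (c *\<^sub>R A) \<le> \<bar>c\<bar> * snorm (blin_space E F) A"
  proof (rule blin_least[OF E])
    fix x assume x: "x \<in> vecs E" "snorm E x \<le> 1"
    have "snorm F ((c *\<^sub>R A) x) = \<bar>c\<bar> * snorm F (A x)"
      using snorm_scaleR[OF F AF[OF x(1)]] by (simp add: scaleR_fun_def)
    also have "\<dots> \<le> \<bar>c\<bar> * (snorm (blin_space E F) A * 1)"
      using blin_bound[OF E F Al x(1)] mult_left_mono[OF x(2) nonneg[OF A]] by (intro mult_left_mono) auto
    finally show "snorm F ((c *\<^sub>R A) x) \<le> \<bar>c\<bar> * snorm (blin_space E F) A" by simp
  qed
  fix B assume B: "B \<in> vecs (blin_space E F)"
  then have Bl: "bounded_lin E F B" by (simp add: ve)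
  from Bl have BF: "\<And>x. x \<in> vecs E \<Longrightarrow> B x \<in> vecs F" unfolding bounded_lin_def by blast
  have sum: "snorm F (A x + B x) \<le> (snorm (blin_space E F) A + snorm (blin_space E F) B) * snorm E x" if x: "x \<in> vecs E" for x
    using snorm_triangle[OF F AF[OF x] BF[OF x]] blin_bound[OF E F Al x] blin_bound[OF E F Bl x]
    by (simp add: algebra_simps)
  show "A + B \<in> vecs (blin_space E F)"
    unfolding ve bounded_lin_def plus_fun_def
  proof (intro conjI ballI allI exI)
    fix x y assume x: "x \<in> vecs E" and y: "y \<in> vecs E"
    show "A x + B x \<in> vecs F" using AF BF x vecs_add[OF F] by blast
    have "A (x + y) + B (x + y) - (A x + B x + (A y + B y)) = (A (x + y) - (A x + A y)) + (B (x + y) - (B x + B y))"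
      by (simp add: algebra_simps)
    moreover have "snorm F ((A (x + y) - (A x + A y)) + (B (x + y) - (B x + B y))) = 0"
      using AF BF x y vecs_add[OF E x y] Al Bl unfolding bounded_lin_def
      by (intro snorm_eq_0_add[OF F] vecs_diff[OF F] vecs_add[OF F]) auto
    ultimately show "snorm F (A (x + y) + B (x + y) - (A x + B x + (A y + B y))) = 0" by (simp only:)
  next
    fix d x assume x: "x \<in> vecs E"
    have "A (d *\<^sub>R x) + B (d *\<^sub>R x) - d *\<^sub>R (A x + B x) = (A (d *\<^sub>R x) - d *\<^sub>R A x) + (B (d *\<^sub>R x) - d *\<^sub>R B x)"
      by (simp add: algebra_simps)
    moreover have "snorm F ((A (d *\<^sub>R x) - d *\<^sub>R A x) + (B (d *\<^sub>R x) - d *\<^sub>R B x)) = 0"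
      using AF BF x vecs_scaleR[OF E x] Al Bl unfolding bounded_lin_def
      by (intro snorm_eq_0_add[OF F] vecs_diff[OF F] vecs_scaleR[OF F]) auto
    ultimately show "snorm F (A (d *\<^sub>R x) + B (d *\<^sub>R x) - d *\<^sub>R (A x + B x)) = 0" by (simp only:)
  next
    fix x assume "x \<in> vecs E"
    then show "snorm F (A x + B x) \<le> (snorm (blin_space E F) A + snorm (blin_space E F) B) * snorm E x"
      by (rule sum)
  qed
  show "snorm (blin_space E F) (A + B) \<le> snorm (blin_space E F) A + snorm (blin_space E F) B"
  proof (rule blin_least[OF E])
    fix x assume x: "x \<in> vecs E" "snorm E x \<le> 1"
    show "snorm F ((A + B) x) \<le> snorm (blin_space E F) A + snorm (blin_space E F) B"
      using sum[OF x(1)] mult_left_mono[OF x(2), of "snorm (blin_space E F) A + snorm (blin_space E F) B"]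
        nonneg[OF A] nonneg[OF B] by simp
  qed
qed

text \<open>
  Real functionals reduce Frechet derivatives in these spaces to derivatives of real functions of one variable.
  The bound \<open>L\<close> is an explicit parameter because the final estimate needs its dependence on the
  direction.
\<close>

definition bounded_functional :: "'a::real_vector seminormed \<Rightarrow> ('a \<Rightarrow> real) \<Rightarrow> real \<Rightarrow> bool" where
  "bounded_functional E \<Lambda> L \<longleftrightarrow>
     (\<forall>x\<in>vecs E. \<forall>y\<in>vecs E. \<Lambda> (x + y) = \<Lambda> x + \<Lambda> y) \<and>
     (\<forall>c. \<forall>x\<in>vecs E. \<Lambda> (c *\<^sub>R x) = c * \<Lambda> x) \<and>
     (\<forall>x\<in>vecs E. \<bar>\<Lambda> x\<bar> \<le> L * snorm E x) \<and> L \<ge> 0"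

lemma bounded_functional_diff:
  assumes "seminormed_space E" "bounded_functional E \<Lambda> L" "x \<in> vecs E" "y \<in> vecs E"
  shows "\<Lambda> (x - y) = \<Lambda> x - \<Lambda> y"
proof -
  have "\<Lambda> (x + -1 *\<^sub>R y) = \<Lambda> x + \<Lambda> (-1 *\<^sub>R y)" "\<Lambda> (-1 *\<^sub>R y) = -1 * \<Lambda> y"
    using assms vecs_scaleR[OF assms(1,4), of "-1"] unfolding bounded_functional_def by blast+
  then show ?thesis by simp
qed

text \<open>
  Evaluation at \<open>h\<close> lifts a functional to the space of bounded linear maps. Iterating it yields the
  functionals that test the first, second and third derivative in the direction \<open>h\<close>.
\<close>

lemma bounded_functional_eval:
  assumes E: "seminormed_space E" and F: "seminormed_space F"
    and L: "bounded_functional F \<Lambda> L" and h: "h \<in> vecs E"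
  shows "bounded_functional (blin_space E F) (\<lambda>A. \<Lambda> (A h)) (L * snorm E h)"
  unfolding bounded_functional_def
proof (intro conjI ballI allI)
  have ve: "A \<in> vecs (blin_space E F) \<longleftrightarrow> bounded_lin E F A" for A by (simp add: blin_space_def)
  show "L * snorm E h \<ge> 0" using L snorm_nonneg[OF E h] by (auto simp: bounded_functional_def)
  fix A assume A: "A \<in> vecs (blin_space E F)"
  then have Ah: "A h \<in> vecs F" using h by (simp add: ve bounded_lin_def)
  show "\<Lambda> ((c *\<^sub>R A) h) = c * \<Lambda> (A h)" for c
    using L Ah by (simp add: bounded_functional_def scaleR_fun_def)
  have "\<bar>\<Lambda> (A h)\<bar> \<le> L * snorm F (A h)" using L Ah by (simp add: bounded_functional_def)
  also have "\<dots> \<le> L * (snorm (blin_space E F) A * snorm E h)"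
    using blin_bound[OF E F _ h] A L by (intro mult_left_mono) (auto simp: ve bounded_functional_def)
  finally show "\<bar>\<Lambda> (A h)\<bar> \<le> L * snorm E h * snorm (blin_space E F) A" by (simp add: mult_ac)
  fix B assume B: "B \<in> vecs (blin_space E F)"
  then have Bh: "B h \<in> vecs F" using h by (simp add: ve bounded_lin_def)
  show "\<Lambda> ((A + B) h) = \<Lambda> (A h) + \<Lambda> (B h)"
    using L Ah Bh by (simp add: bounded_functional_def)
qed

lemma has_frechet_imp_DERIV:
  assumes E: "seminormed_space E" and F: "seminormed_space F"
    and L: "bounded_functional F \<Lambda> L" and h: "h \<in> vecs E"
    and f: "has_frechet E F f A (t *\<^sub>R h)"
    and \<rho>: "\<rho> > 0" "\<And>y. y \<in> vecs E \<Longrightarrow> snorm E (y - t *\<^sub>R h) < \<rho> \<Longrightarrow> f y \<in> vecs F"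
  shows "((\<lambda>s. \<Lambda> (f (s *\<^sub>R h))) has_real_derivative \<Lambda> (A h)) (at t)"
  unfolding has_field_derivative_def has_derivative_at_alt
proof (intro conjI allI impI)
  show "bounded_linear ((*) (\<Lambda> (A h)))" by (rule bounded_linear_mult_right)
  fix e :: real assume e: "e > 0"
  have A: "bounded_lin E F A" using f by (simp add: has_frechet_def)
  have AF: "\<And>x. x \<in> vecs E \<Longrightarrow> A x \<in> vecs F" using A unfolding bounded_lin_def by blast
  have L0: "L \<ge> 0" using L by (simp add: bounded_functional_def)
  have h0: "snorm E h \<ge> 0" by (rule snorm_nonneg[OF E h])
  define e' where "e' = e / (L * snorm E h + 1)"
  have p: "L * snorm E h + 1 > 0" using L0 h0 by (simp add: add_nonneg_pos)
  then have e': "e' > 0" using e by (simp add: e'_def)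
  then obtain d where d: "d > 0" "\<And>k. k \<in> vecs E \<Longrightarrow> snorm E k < d \<Longrightarrow>
     snorm F (f (t *\<^sub>R h + k) - f (t *\<^sub>R h) - A k) \<le> e' * snorm E k"
    using f unfolding has_frechet_def by meson
  define d' where "d' = min d \<rho> / (snorm E h + 1)"
  have d': "d' > 0" using d \<rho> h0 by (simp add: d'_def)
  show "\<exists>d>0. \<forall>y. norm (y - t) < d \<longrightarrow>
     norm (\<Lambda> (f (y *\<^sub>R h)) - \<Lambda> (f (t *\<^sub>R h)) - \<Lambda> (A h) * (y - t)) \<le> e * norm (y - t)"
  proof (intro exI[of _ d'] conjI allI impI d')
    fix y :: real assume y: "norm (y - t) < d'"
    define k where "k = (y - t) *\<^sub>R h"
    have k: "k \<in> vecs E" using vecs_scaleR[OF E h] by (simp add: k_def)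
    have nk: "snorm E k = \<bar>y - t\<bar> * snorm E h" using snorm_scaleR[OF E h] by (simp add: k_def)
    have "snorm E k \<le> \<bar>y - t\<bar> * (snorm E h + 1)" unfolding nk by (intro mult_left_mono) auto
    also have "\<dots> < min d \<rho>" using y h0 by (simp add: d'_def pos_less_divide_eq)
    finally have kd: "snorm E k < d" "snorm E k < \<rho>" by auto
    have yk: "y *\<^sub>R h = t *\<^sub>R h + k" by (simp add: k_def algebra_simps)
    have v1: "f (t *\<^sub>R h + k) \<in> vecs F"
      using \<rho>(2)[OF vecs_add[OF E vecs_scaleR[OF E h] k]] kd by simp
    have v2: "f (t *\<^sub>R h) \<in> vecs F"
      using \<rho>(2)[OF vecs_scaleR[OF E h]] \<rho>(1) snorm_zero[OF E] by simp
    have "snorm F (A ((y - t) *\<^sub>R h) - (y - t) *\<^sub>R A h) = 0" using A h unfolding bounded_lin_def by blast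
    then have "\<bar>\<Lambda> (A k - (y - t) *\<^sub>R A h)\<bar> \<le> L * 0"
      using L AF[OF k] vecs_diff[OF F AF[OF k] vecs_scaleR[OF F AF[OF h], of "y - t"]]
      unfolding bounded_functional_def k_def by metis
    then have "\<Lambda> (A k) = \<Lambda> ((y - t) *\<^sub>R A h)"
      using bounded_functional_diff[OF F L AF[OF k] vecs_scaleR[OF F AF[OF h], of "y - t"]] by simp
    also have "\<dots> = \<Lambda> (A h) * (y - t)" using L AF[OF h] by (simp add: bounded_functional_def)
    finally have "\<Lambda> (f (y *\<^sub>R h)) - \<Lambda> (f (t *\<^sub>R h)) - \<Lambda> (A h) * (y - t) = \<Lambda> (f (t *\<^sub>R h + k) - f (t *\<^sub>R h) - A k)"
      using bounded_functional_diff[OF F L vecs_diff[OF F v1 v2] AF[OF k]] bounded_functional_diff[OF F L v1 v2] yk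
      by simp
    also have "norm \<dots> \<le> L * snorm F (f (t *\<^sub>R h + k) - f (t *\<^sub>R h) - A k)"
      using L vecs_diff[OF F vecs_diff[OF F v1 v2] AF[OF k]] by (simp add: bounded_functional_def)
    also have "\<dots> \<le> L * (e' * snorm E k)" using d(2)[OF k kd(1)] L0 by (intro mult_left_mono) auto
    also have "\<dots> = e * \<bar>y - t\<bar> * (L * snorm E h / (L * snorm E h + 1))" by (simp add: e'_def nk)
    also have "\<dots> \<le> e * \<bar>y - t\<bar> * 1" using e p by (intro mult_left_mono) auto
    finally show "norm (\<Lambda> (f (y *\<^sub>R h)) - \<Lambda> (f (t *\<^sub>R h)) - \<Lambda> (A h) * (y - t)) \<le> e * norm (y - t)"
      by simp
  qed
qed

lemma real_le_of_small_error:
  fixes a b K d :: real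
  assumes "d > 0" "\<And>h. 0 < h \<Longrightarrow> h < d \<Longrightarrow> a \<le> b + K * h"
  shows "a \<le> b"
proof (rule field_le_epsilon)
  fix e :: real assume e: "e > 0"
  define h where "h = min (d / 2) (e / (\<bar>K\<bar> + 1))"
  have h: "h > 0" "h < d" using assms(1) e by (auto simp: h_def)
  have "K * h \<le> (\<bar>K\<bar> + 1) * h" using h by (intro mult_right_mono) auto
  also have "\<dots> \<le> (\<bar>K\<bar> + 1) * (e / (\<bar>K\<bar> + 1))" by (intro mult_left_mono) (auto simp: h_def)
  also have "\<dots> = e" by simp
  finally show "a \<le> b + e" using assms(2)[OF h] by linarith
qed

lemma real_zero_of_small_error:
  fixes a K d :: real
  assumes "d > 0" "\<And>h. 0 < h \<Longrightarrow> h < d \<Longrightarrow> \<bar>a\<bar> \<le> K * h"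
  shows "a = 0"
  using real_le_of_small_error[of d "\<bar>a\<bar>" 0 K] assms by simp

text \<open>
  Divide successively by the lowest remaining power and let \<open>h\<close> tend to zero.
\<close>

lemma quadratic_zero_of_cubic_bound:
  fixes a b c K d :: real
  assumes d: "d > 0" and bd: "\<And>h. 0 < h \<Longrightarrow> h < d \<Longrightarrow> \<bar>a + b * h + c * h\<^sup>2\<bar> \<le> K * h ^ 3"
  shows "a = 0 \<and> b = 0 \<and> c = 0"
proof -
  have d1: "min d 1 > 0" using d by simp
  have K: "K \<ge> 0"
  proof -
    have "0 \<le> K * (d/2) ^ 3" using bd[of "d/2"] d by (intro order_trans[OF abs_ge_zero]) auto
    then show ?thesis using d by (simp add: zero_le_mult_iff)
  qed
  have a: "a = 0"
  proof (rule real_zero_of_small_error[OF d1])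
    fix h assume h: "0 < h" "h < min d 1"
    have "\<bar>b * h\<bar> = \<bar>b\<bar> * h" "\<bar>c * h\<^sup>2\<bar> = \<bar>c\<bar> * h\<^sup>2" using h by (simp_all add: abs_mult)
    then have "\<bar>a\<bar> \<le> K * h ^ 3 + \<bar>b\<bar> * h + \<bar>c\<bar> * h\<^sup>2" using bd[of h] h by linarith
    also have "K * h ^ 3 \<le> K * h" using K h power_decreasing[of 1 3 h] by (intro mult_left_mono) auto
    also have "\<bar>c\<bar> * h\<^sup>2 \<le> \<bar>c\<bar> * h" using h by (intro mult_left_mono) (auto simp: power2_eq_square)
    finally show "\<bar>a\<bar> \<le> (K + \<bar>b\<bar> + \<bar>c\<bar>) * h" by (simp add: algebra_simps)
  qed
  have b: "b = 0"
  proof (rule real_zero_of_small_error[OF d1])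
    fix h assume h: "0 < h" "h < min d 1"
    have "h * \<bar>b + c * h\<bar> = \<bar>a + b * h + c * h\<^sup>2\<bar>"
    proof -
      have "a + b * h + c * h\<^sup>2 = h * (b + c * h)" using a by (simp add: power2_eq_square algebra_simps)
      then show ?thesis using h by (simp add: abs_mult)
    qed
    also have "\<dots> \<le> K * h ^ 3" using bd[of h] h by simp
    also have "\<dots> = h * (K * h\<^sup>2)" by (simp add: power2_eq_square power3_eq_cube)
    finally have "h * \<bar>b + c * h\<bar> \<le> h * (K * h\<^sup>2)" .
    then have "\<bar>b + c * h\<bar> \<le> K * h\<^sup>2" using h by simp
    moreover have "\<bar>c * h\<bar> = \<bar>c\<bar> * h" using h by (simp add: abs_mult)
    ultimately have "\<bar>b\<bar> \<le> K * h\<^sup>2 + \<bar>c\<bar> * h" by linarith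
    also have "K * h\<^sup>2 \<le> K * h" using K h by (intro mult_left_mono) (auto simp: power2_eq_square)
    finally show "\<bar>b\<bar> \<le> (K + \<bar>c\<bar>) * h" by (simp add: algebra_simps)
  qed
  have "c = 0"
  proof (rule real_zero_of_small_error[OF d1])
    fix h assume h: "0 < h" "h < min d 1"
    have "h\<^sup>2 * \<bar>c\<bar> \<le> h\<^sup>2 * (K * h)" using bd[of h] h a b
      by (simp add: abs_mult power2_eq_square power3_eq_cube algebra_simps)
    then show "\<bar>c\<bar> \<le> K * h" using h by simp
  qed
  then show ?thesis using a b by simp
qed

text \<open>
  Along the ray \<open>s h\<close> a bounded functional of \<open>S\<close> is a real function with three
  derivatives, and its third derivative near \<open>0\<close> is at most \<open>(D + 1) L
  \<parallel>h\<parallel>\<^sup>3\<close> by continuity, where \<open>D\<close> is the norm of the third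
  derivative of \<open>S\<close> at \<open>0\<close>. Maclaurin's theorem and the vanishing of the lower
  coefficients turn this into a bound on \<open>X\<close>. The constant depends on \<open>S\<close> alone, which
  is the point of the statement.
\<close>

lemma C3_near_cubic_coefficient:
  assumes E: "seminormed_space E" and F: "seminormed_space F" and S: "C3_near E F S 0"
  shows "\<exists>M. \<forall>h \<Lambda> L X C d. h \<in> vecs E \<longrightarrow> bounded_functional F \<Lambda> L \<longrightarrow> d > 0 \<longrightarrow>
      (\<forall>s. 0 < s \<and> s < d \<longrightarrow> \<bar>\<Lambda> (S (s *\<^sub>R h)) - X * s ^ 3\<bar> \<le> C * s ^ 4) \<longrightarrow>
      \<bar>X\<bar> \<le> M * L * snorm E h ^ 3"
proof -
  let ?F1 = "blin_space E F" let ?F2 = "blin_space E ?F1" let ?F3 = "blin_space E ?F2"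
  have F1: "seminormed_space ?F1" by (rule seminormed_space_blin[OF E F])
  have F2: "seminormed_space ?F2" by (rule seminormed_space_blin[OF E F1])
  have F3: "seminormed_space ?F3" by (rule seminormed_space_blin[OF E F2])
  obtain \<rho> f1 f2 f3 where \<rho>: "\<rho> > 0" and
    D': "\<forall>x\<in>{x \<in> vecs E. snorm E (x - 0) < \<rho>}. S x \<in> vecs F \<and> has_frechet E F S (f1 x) x \<and>
           has_frechet E ?F1 f1 (f2 x) x \<and> has_frechet E ?F2 f2 (f3 x) x" and
    cont': "snorm_continuous_on E ?F3 {x \<in> vecs E. snorm E (x - 0) < \<rho>} f3"
    using S unfolding C3_near_def Let_def by blast
  have D: "S x \<in> vecs F \<and> has_frechet E F S (f1 x) x \<and>
           has_frechet E ?F1 f1 (f2 x) x \<and> has_frechet E ?F2 f2 (f3 x) x"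
    if "x \<in> vecs E" "snorm E x < \<rho>" for x using D' that by simp
  have cont: "snorm_continuous_on E ?F3 {x \<in> vecs E. snorm E x < \<rho>} f3" using cont' by simp
  have f1: "f1 x \<in> vecs ?F1" and f2: "f2 x \<in> vecs ?F2" and f3: "f3 x \<in> vecs ?F3"
    if "x \<in> vecs E" "snorm E x < \<rho>" for x
    using D[OF that] unfolding has_frechet_def blin_space_def by auto
  have 0: "(0::'a) \<in> vecs E" "snorm E 0 < \<rho>" using vecs_zero[OF E] snorm_zero[OF E] \<rho> by auto
  then have "\<forall>e>0. \<exists>d>0. \<forall>y\<in>{x \<in> vecs E. snorm E x < \<rho>}. snorm E (y - 0) < d \<longrightarrow> snorm ?F3 (f3 y - f3 0) < e"
    using cont unfolding snorm_continuous_on_def by blast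
  then have "\<exists>d>0. \<forall>y\<in>{x \<in> vecs E. snorm E x < \<rho>}. snorm E (y - 0) < d \<longrightarrow> snorm ?F3 (f3 y - f3 0) < 1"
    using zero_less_one by blast
  then obtain d1 where d1: "d1 > 0" "\<And>y. y \<in> vecs E \<Longrightarrow> snorm E y < \<rho> \<Longrightarrow> snorm E y < d1 \<Longrightarrow> snorm ?F3 (f3 y - f3 0) < 1"
    by auto
  define N where "N = snorm ?F3 (f3 0) + 1"
  have N: "snorm ?F3 (f3 y) \<le> N" if "y \<in> vecs E" "snorm E y < \<rho>" "snorm E y < d1" for y
    using snorm_triangle_sub[OF F3 f3[OF that(1,2)] f3[OF 0]] d1(2)[OF that] by (simp add: N_def)
  show ?thesis
  proof (intro exI[of _ "N / 6"] allI impI)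
    fix h \<Lambda> L X C and d :: real
    assume h: "h \<in> vecs E" and L: "bounded_functional F \<Lambda> L" and d: "d > 0"
      and bd: "\<forall>s. 0 < s \<and> s < d \<longrightarrow> \<bar>\<Lambda> (S (s *\<^sub>R h)) - X * s ^ 3\<bar> \<le> C * s ^ 4"
    define n where "n = snorm E h"
    have n: "n \<ge> 0" using snorm_nonneg[OF E h] by (simp add: n_def)
    define g where "g = (\<lambda>(m::nat) s. if m = 0 then \<Lambda> (S (s *\<^sub>R h)) else if m = 1 then \<Lambda> (f1 (s *\<^sub>R h) h)
       else if m = 2 then \<Lambda> (f2 (s *\<^sub>R h) h h) else \<Lambda> (f3 (s *\<^sub>R h) h h h))"
    note L1 = bounded_functional_eval[OF E F L h]
    note L2 = bounded_functional_eval[OF E F1 L1 h]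
    note L3 = bounded_functional_eval[OF E F2 L2 h]
    define d2 where "d2 = min (min d 1) (min \<rho> d1 / (n + 1))"
    have d2: "d2 > 0" using d \<rho> d1 n by (simp add: d2_def)
    have small: "s *\<^sub>R h \<in> vecs E \<and> snorm E (s *\<^sub>R h) < \<rho> \<and> snorm E (s *\<^sub>R h) < d1" if "\<bar>s\<bar> < d2" for s
    proof -
      have "snorm E (s *\<^sub>R h) \<le> \<bar>s\<bar> * (n + 1)" using snorm_scaleR[OF E h, of s] n by (simp add: n_def algebra_simps)
      also have "\<dots> < min \<rho> d1" using that n by (simp add: d2_def pos_less_divide_eq)
      finally show ?thesis using vecs_scaleR[OF E h] by simp
    qed
    have near: "snorm E y < \<rho>" if "\<bar>s\<bar> < d2" "y \<in> vecs E" "snorm E (y - s *\<^sub>R h) < \<rho> - snorm E (s *\<^sub>R h)" for s y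
      using snorm_triangle_sub[OF E that(2), of "s *\<^sub>R h"] small[OF that(1)] that(3) by simp
    have der: "DERIV (g m) s :> g (Suc m) s" if "m < 3" "\<bar>s\<bar> < d2" for m s
    proof -
      note sm = small[OF that(2)]
      have pos: "\<rho> - snorm E (s *\<^sub>R h) > 0" using sm by simp
      have "DERIV (g 0) s :> g 1 s" unfolding g_def
        using has_frechet_imp_DERIV[OF E F L h _ pos, of S "f1 (s *\<^sub>R h)"] D sm near[OF that(2)] by simp
      moreover have "DERIV (g 1) s :> g 2 s" unfolding g_def
        using has_frechet_imp_DERIV[OF E F1 L1 h _ pos, of f1 "f2 (s *\<^sub>R h)"] D sm near[OF that(2)] f1 by simp
      moreover have "DERIV (g 2) s :> g 3 s" unfolding g_def
        using has_frechet_imp_DERIV[OF E F2 L2 h _ pos, of f2 "f3 (s *\<^sub>R h)"] D sm near[OF that(2)] f2 by simp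
      moreover have "m = 0 \<or> m = 1 \<or> m = 2" using that by auto
      ultimately show ?thesis by (auto simp: numeral_eq_Suc)
    qed
    define Bd where "Bd = N * L * n ^ 3"
    have g3: "\<bar>g 3 s\<bar> \<le> Bd" if "\<bar>s\<bar> < d2" for s
    proof -
      note sm = small[OF that]
      have "\<bar>g 3 s\<bar> \<le> L * snorm E h * snorm E h * snorm E h * snorm ?F3 (f3 (s *\<^sub>R h))"
        using L3 f3 sm unfolding bounded_functional_def g_def by simp
      also have "\<dots> \<le> L * snorm E h * snorm E h * snorm E h * N"
        using N sm L n by (intro mult_left_mono) (auto simp: n_def bounded_functional_def)
      finally show ?thesis by (simp add: Bd_def n_def power3_eq_cube mult_ac)
    qed
    have taylor: "\<bar>g 0 s - (g 0 0 + g 1 0 * s + g 2 0 / 2 * s\<^sup>2)\<bar> \<le> Bd / 6 * s ^ 3" if s: "0 < s" "s < d2" for s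
    proof -
      have "\<exists>t. 0 < t \<and> t < s \<and> g 0 s = (\<Sum>m<3. g m 0 / fact m * s ^ m) + g 3 t / fact 3 * s ^ 3"
        using s der by (intro Maclaurin) auto
      then obtain t where t: "0 < t" "t < s" "g 0 s = (\<Sum>m<3. g m 0 / fact m * s ^ m) + g 3 t / fact 3 * s ^ 3" by blast
      have "(\<Sum>m<3. g m 0 / fact m * s ^ m) = g 0 0 + g 1 0 * s + g 2 0 / 2 * s\<^sup>2"
        by (simp add: numeral_eq_Suc)
      then have "g 0 s - (g 0 0 + g 1 0 * s + g 2 0 / 2 * s\<^sup>2) = g 3 t / 6 * s ^ 3"
        using t(3) by (simp add: fact_numeral)
      also have "\<bar>\<dots>\<bar> = \<bar>g 3 t\<bar> / 6 * s ^ 3" using s by (simp add: abs_mult)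
      also have "\<dots> \<le> Bd / 6 * s ^ 3" using g3[of t] t s by (intro mult_right_mono divide_right_mono) auto
      finally show ?thesis .
    qed
    have bd': "\<bar>g 0 s - X * s ^ 3\<bar> \<le> \<bar>C\<bar> * s ^ 4" if s: "0 < s" "s < d2" for s
    proof -
      have "\<bar>g 0 s - X * s ^ 3\<bar> \<le> C * s ^ 4" using bd s by (auto simp: g_def d2_def)
      also have "\<dots> \<le> \<bar>C\<bar> * s ^ 4" using s by (intro mult_right_mono) auto
      finally show ?thesis .
    qed
    have s43: "s ^ 4 \<le> s ^ 3" if s: "0 < s" "s < d2" for s :: real
      using s by (intro power_decreasing) (auto simp: d2_def)
    have "g 0 0 = 0 \<and> g 1 0 = 0 \<and> g 2 0 / 2 = 0"
    proof (rule quadratic_zero_of_cubic_bound[OF d2])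
      fix s assume s: "0 < s" "s < d2"
      have "\<bar>C\<bar> * s ^ 4 \<le> \<bar>C\<bar> * s ^ 3" using s43[OF s] by (intro mult_left_mono) auto
      moreover have "\<bar>X * s ^ 3\<bar> = \<bar>X\<bar> * s ^ 3" using s by (simp add: abs_mult)
      ultimately have "\<bar>g 0 0 + g 1 0 * s + g 2 0 / 2 * s\<^sup>2\<bar> \<le> Bd / 6 * s ^ 3 + \<bar>C\<bar> * s ^ 3 + \<bar>X\<bar> * s ^ 3"
        using taylor[OF s] bd'[OF s] by linarith
      then show "\<bar>g 0 0 + g 1 0 * s + g 2 0 / 2 * s\<^sup>2\<bar> \<le> (Bd / 6 + \<bar>C\<bar> + \<bar>X\<bar>) * s ^ 3"
        by (simp add: algebra_simps)
    qed
    then have g0: "\<bar>g 0 s\<bar> \<le> Bd / 6 * s ^ 3" if "0 < s" "s < d2" for s using taylor[OF that] by simp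
    have "\<bar>X\<bar> \<le> Bd / 6"
    proof (rule real_le_of_small_error[OF d2])
      fix s assume s: "0 < s" "s < d2"
      have "s ^ 3 * \<bar>X\<bar> = \<bar>X * s ^ 3\<bar>" using s by (simp add: abs_mult)
      also have "\<dots> \<le> Bd / 6 * s ^ 3 + \<bar>C\<bar> * s ^ 4" using g0[OF s] bd'[OF s] by linarith
      also have "\<dots> = s ^ 3 * (Bd / 6 + \<bar>C\<bar> * s)" by (simp add: algebra_simps power_eq_if)
      finally show "\<bar>X\<bar> \<le> Bd / 6 + \<bar>C\<bar> * s" using s by simp
    qed
    then show "\<bar>X\<bar> \<le> N / 6 * L * snorm E h ^ 3" by (simp add: Bd_def n_def)
  qed
qed

section \<open>Integration by parts and the Ladyzhenskaya inequality\<close>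

text \<open>
  Treating both coordinate directions through a vector \<open>e\<close> of the standard basis avoids duplicating
  every statement, and matches the form of \<open>laplacian\<close>.
\<close>

definition deriv_along :: "real \<times> real \<Rightarrow> (real \<times> real \<Rightarrow> complex) \<Rightarrow> (real \<times> real \<Rightarrow> complex) \<Rightarrow> bool" where
  "deriv_along e f f' \<longleftrightarrow> (\<forall>z. ((\<lambda>s. f (z + s *\<^sub>R e)) has_vector_derivative f' z) (at 0))"

lemma deriv_along_at:
  assumes "deriv_along e f f'"
  shows "((\<lambda>r. f (z + r *\<^sub>R e)) has_vector_derivative f' (z + s *\<^sub>R e)) (at s)"
proof -
  have "((\<lambda>r. f (z + s *\<^sub>R e + r *\<^sub>R e)) has_vector_derivative f' (z + s *\<^sub>R e)) (at (s - s))"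
    using assms[unfolded deriv_along_def, rule_format, of "z + s *\<^sub>R e"] by simp
  then have "(((\<lambda>r. f (z + s *\<^sub>R e + r *\<^sub>R e)) \<circ> (\<lambda>r. r - s)) has_vector_derivative 1 *\<^sub>R f' (z + s *\<^sub>R e)) (at s)"
    by (intro vector_diff_chain_at) (auto intro!: derivative_eq_intros)
  then show ?thesis by (simp add: o_def algebra_simps)
qed

lemma Basis_plane: "Basis = {(1, 0), (0, 1 :: real) :: real \<times> real}"
  by (auto simp: Basis_prod_def)

lemma tint_deriv_along_eq_0:
  assumes \<gamma>: "\<gamma> > 0" and e: "e \<in> Basis" and f: "deriv_along e f f'"
    and c: "continuous_on UNIV f'" and per: "torus_periodic \<gamma> f"
  shows "tint \<gamma> f' = 0"
proof -
  from e consider "e = (1, 0)" | "e = (0, 1)" by (auto simp: Basis_plane)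
  then show ?thesis
  proof cases
    case 1
    show ?thesis
    proof (rule tint_deriv_fst_eq_0[OF _ c])
      show "((\<lambda>s. f (s, y)) has_vector_derivative f' (x, y)) (at x)" for x y
        using deriv_along_at[OF f, of "(0, y)" x] 1 by simp
      show "f (2 * pi, y) = f (0, y)" for y
        using per[unfolded torus_periodic_def, rule_format, of 0 y] by simp
    qed
  next
    case 2
    show ?thesis
    proof (rule tint_deriv_snd_eq_0[OF \<gamma> _ c])
      show "((\<lambda>s. f (x, s)) has_vector_derivative f' (x, y)) (at y)" for x y
        using deriv_along_at[OF f, of "(x, 0)" y] 2 by simp
      show "f (x, 2 * pi * \<gamma>) = f (x, 0)" for x
        using per[unfolded torus_periodic_def, rule_format, of x 0] by simp
    qed
  qed
qed

lemma deriv_along_cnj: "deriv_along e f f' \<Longrightarrow> deriv_along e (\<lambda>x. cnj (f x)) (\<lambda>x. cnj (f' x))"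
  unfolding deriv_along_def by (simp add: has_vector_derivative_cnj)

lemma deriv_along_mult:
  assumes "deriv_along e f f'" "deriv_along e g g'"
  shows "deriv_along e (\<lambda>x. f x * g x) (\<lambda>x. f x * g' x + f' x * g x)"
  unfolding deriv_along_def
proof
  fix z
  show "((\<lambda>s. f (z + s *\<^sub>R e) * g (z + s *\<^sub>R e)) has_vector_derivative f z * g' z + f' z * g z) (at 0)"
    using has_vector_derivative_mult[of "\<lambda>s. f (z + s *\<^sub>R e)" "f' z" 0 UNIV "\<lambda>s. g (z + s *\<^sub>R e)" "g' z"] assms
    unfolding deriv_along_def by simp
qed

lemma torus_periodic_cnj: "torus_periodic \<gamma> f \<Longrightarrow> torus_periodic \<gamma> (\<lambda>x. cnj (f x))"
  and torus_periodic_mult: "torus_periodic \<gamma> f \<Longrightarrow> torus_periodic \<gamma> g \<Longrightarrow> torus_periodic \<gamma> (\<lambda>x. f x * g x)"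
  unfolding torus_periodic_def by auto

lemma tint_by_parts:
  assumes "\<gamma> > 0" "e \<in> Basis" "deriv_along e f f'" "deriv_along e g g'"
    and [continuous_intros]: "continuous_on UNIV f" "continuous_on UNIV f'" "continuous_on UNIV g" "continuous_on UNIV g'"
    and "torus_periodic \<gamma> f" "torus_periodic \<gamma> g"
  shows "tint \<gamma> (\<lambda>x. f' x * cnj (g x)) = - tint \<gamma> (\<lambda>x. f x * cnj (g' x))"
proof -
  have "tint \<gamma> (\<lambda>x. f x * cnj (g' x) + f' x * cnj (g x)) = 0"
    using assms by (intro tint_deriv_along_eq_0[OF _ _ deriv_along_mult[OF _ deriv_along_cnj]] torus_periodic_mult torus_periodic_cnj continuous_intros) auto
  moreover have "tint \<gamma> (\<lambda>x. f x * cnj (g' x) + f' x * cnj (g x)) = tint \<gamma> (\<lambda>x. f x * cnj (g' x)) + tint \<gamma> (\<lambda>x. f' x * cnj (g x))"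
    by (intro tint_add continuous_intros)
  ultimately show ?thesis by (simp add: add_eq_0_iff)
qed

lemma continuous_on_slice:
  assumes "continuous_on (A \<times> UNIV) (\<lambda>(t, x). f t x)" "t \<in> A"
  shows "continuous_on UNIV (f t)"
proof -
  have "continuous_on UNIV (\<lambda>x. case (t, x) of (t, x) \<Rightarrow> f t x)"
    by (rule continuous_on_compose2[OF assms(1)]) (use assms(2) in \<open>auto intro!: continuous_intros\<close>)
  then show ?thesis by simp
qed

lemma tint_has_vector_derivative:
  fixes f f' :: "real \<Rightarrow> real \<times> real \<Rightarrow> 'a::euclidean_space"
  assumes "\<And>t x. t \<in> {a..b} \<Longrightarrow> ((\<lambda>s. f s x) has_vector_derivative f' t x) (at t within {a..b})"
    and "\<And>t. t \<in> {a..b} \<Longrightarrow> continuous_on UNIV (f t)"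
    and "continuous_on ({a..b} \<times> UNIV) (\<lambda>(t, x). f' t x)" and "t0 \<in> {a..b}"
  shows "((\<lambda>t. tint \<gamma> (f t)) has_vector_derivative tint \<gamma> (f' t0)) (at t0 within {a..b})"
  unfolding tint_def
  using assms by (intro leibniz_rule_vector_derivative tint_integrable) (auto intro: continuous_on_subset)

text \<open>
  One-dimensional Sobolev inequality: \<open>h x \<le> h s + \<integral>|h'|\<close> for every \<open>s\<close>;
  average over \<open>s\<close>.
\<close>

lemma abs_integral_dominates:
  fixes h h' :: "real \<Rightarrow> real"
  assumes L: "L > 0" and d: "\<And>x. x \<in> {0..L} \<Longrightarrow> (h has_vector_derivative h' x) (at x within {0..L})"
    and c: "continuous_on {0..L} h'" and x: "x \<in> {0..L}"
  shows "h x \<le> integral {0..L} h / L + integral {0..L} (\<lambda>s. \<bar>h' s\<bar>)"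
proof -
  define I where "I = integral {0..L} (\<lambda>s. \<bar>h' s\<bar>)"
  have ca: "continuous_on {0..L} (\<lambda>s. \<bar>h' s\<bar>)" using c by (intro continuous_intros)
  have ch: "continuous_on {0..L} h" by (rule continuous_on_vector_derivative) (rule d)
  have inc: "\<bar>h b - h a\<bar> \<le> I" if ab: "a \<le> b" "a \<in> {0..L}" "b \<in> {0..L}" for a b
  proof -
    have sub: "{a..b} \<subseteq> {0..L}" using ab by auto
    have "(h' has_integral h b - h a) {a..b}"
    proof (rule fundamental_theorem_of_calculus[OF ab(1)])
      fix x assume "x \<in> {a..b}"
      then have "x \<in> {0..L}" using sub by blast
      from has_vector_derivative_within_subset[OF d[OF this] sub]
      show "(h has_vector_derivative h' x) (at x within {a..b})" .
    qed
    then have "\<bar>h b - h a\<bar> = \<bar>integral {a..b} h'\<bar>" by (simp add: integral_unique)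
    also have "\<dots> \<le> integral {a..b} (\<lambda>s. \<bar>h' s\<bar>)"
      using integral_norm_bound_integral[of h' "{a..b}" "\<lambda>s. \<bar>h' s\<bar>"] continuous_on_subset[OF c sub] continuous_on_subset[OF ca sub]
      by (simp add: integrable_continuous_real)
    also have "\<dots> \<le> I" unfolding I_def
      using continuous_on_subset[OF ca sub] ca sub by (intro integral_subset_le integrable_continuous_real) auto
    finally show ?thesis .
  qed
  have "L * h x - L * I = integral {0..L} (\<lambda>s. h x - I)" using L by (simp add: right_diff_distrib)
  also have "\<dots> \<le> integral {0..L} h"
  proof (intro integral_le integrable_continuous_real ch continuous_intros)
    fix s assume s: "s \<in> {0..L}"
    show "h x - I \<le> h s" using inc[of s x] inc[of x s] s x by (cases "s \<le> x") auto
  qed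
  finally have "h x - I \<le> integral {0..L} h / L" using L by (simp add: field_simps)
  then show ?thesis by (simp add: I_def)
qed

text \<open>
  Optimisation over \<open>s\<close> recovers the Cauchy-Schwarz form of a bound proved with the inequality of
  arithmetic and geometric means.
\<close>

lemma square_le_of_amgm:
  fixes I a b :: real
  assumes "I \<ge> 0" "a \<ge> 0" "b \<ge> 0" and bd: "\<And>s. s > 0 \<Longrightarrow> I \<le> s * a + b / s"
  shows "I\<^sup>2 \<le> 4 * a * b"
proof (cases "I = 0 \<or> a = 0")
  case True
  have "I = 0"
  proof (rule ccontr)
    assume I: "I \<noteq> 0"
    with True have a: "a = 0" by simp
    \<comment> \<open>any \<open>s\<close> with \<open>b/s < I\<close> contradicts the bound\<close>
    have "2 * (b + 1) / I > 0" using I assms by simp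
    from bd[OF this] have "I \<le> b * I / (2 * (b + 1))" using a by simp
    also have "\<dots> \<le> I / 2" using assms by (simp add: divide_simps) (simp add: algebra_simps)
    finally show False using I assms by simp
  qed
  then show ?thesis using assms by simp
next
  case False
  then have pos: "I > 0" "a > 0" using assms by auto
  have "I \<le> I / (2 * a) * a + b / (I / (2 * a))" using pos by (intro bd) simp
  then have "I \<le> I / 2 + 2 * a * b / I" using pos by (simp add: field_simps)
  then have "I * I \<le> (I / 2 + 2 * a * b / I) * I" using pos by (intro mult_right_mono) auto
  then show ?thesis using pos by (simp add: algebra_simps power2_eq_square)
qed

text \<open>
  Apply \<open>abs_integral_dominates\<close> to \<open>g = |f|\<^sup>2\<close> in each variable. This gives
  \<open>g(x,y) \<le> A(y)\<close> and \<open>g(x,y) \<le> B(x)\<close>, so \<open>\<integral>g\<^sup>2 \<le>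
  \<integral>A \<sqdot> \<integral>B\<close>, where both factors are at most \<open>c \<integral>|f|\<^sup>2 + 2
  (\<integral>|f|\<^sup>2 \<integral>|\<nabla>f|\<^sup>2)\<^bsup>1/2\<^esup>\<close> by Cauchy-Schwarz. The factor
  \<open>m\<close> in front of \<open>k\<close> is what makes the inequality useful for small mass.
\<close>

lemma ladyzhenskaya:
  assumes \<gamma>: "\<gamma> > 0"
    and d: "\<And>e. e \<in> Basis \<Longrightarrow> deriv_along e f (fd e)"
    and cf [continuous_intros]: "continuous_on UNIV f" and cfd: "\<And>e. e \<in> Basis \<Longrightarrow> continuous_on UNIV (fd e)"
  defines "c \<equiv> 1 / (2 * pi) + 1 / (2 * pi * \<gamma>)"
  defines "m \<equiv> tint \<gamma> (\<lambda>x. (norm (f x))\<^sup>2)"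
  defines "k \<equiv> \<Sum>e\<in>Basis. tint \<gamma> (\<lambda>x. (norm (fd e x))\<^sup>2)"
  shows "tint \<gamma> (\<lambda>x. norm (f x) ^ 4) \<le> 2 * c\<^sup>2 * m\<^sup>2 + 8 * m * k"
proof -
  define g where "g x = (norm (f x))\<^sup>2" for x
  define gd where "gd e x = 2 * Re (fd e x * cnj (f x))" for e x
  have cg: "continuous_on A g" for A unfolding g_def by (intro continuous_intros continuous_on_subset[OF cf]) auto
  have cgd: "continuous_on UNIV (gd e)" if "e \<in> Basis" for e
    unfolding gd_def using that by (intro continuous_intros cfd)
  have m0: "m \<ge> 0" unfolding m_def by (intro tint_nonneg continuous_intros) auto
  have ke0: "tint \<gamma> (\<lambda>x. (norm (fd e x))\<^sup>2) \<ge> 0" if "e \<in> Basis" for e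
    using that by (intro tint_nonneg continuous_intros cfd) auto
  have k0: "k \<ge> 0" unfolding k_def using ke0 by (intro sum_nonneg)
  have gder: "((\<lambda>r. g (z + r *\<^sub>R e)) has_vector_derivative gd e (z + s *\<^sub>R e)) (at s within A)" if e: "e \<in> Basis" for e z s A
  proof -
    have "deriv_along e (\<lambda>x. f x * cnj (f x)) (\<lambda>x. f x * cnj (fd e x) + fd e x * cnj (f x))"
      using d[OF e] by (intro deriv_along_mult deriv_along_cnj)
    from deriv_along_at[OF this, of z s]
    have der: "((\<lambda>r. Re (f (z + r *\<^sub>R e) * cnj (f (z + r *\<^sub>R e)))) has_vector_derivative
        Re (f (z + s *\<^sub>R e) * cnj (fd e (z + s *\<^sub>R e)) + fd e (z + s *\<^sub>R e) * cnj (f (z + s *\<^sub>R e)))) (at s)"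
      by (rule bounded_linear.has_vector_derivative[OF bounded_linear_Re])
    have eq1: "Re (w * cnj w) = (norm w)\<^sup>2" for w :: complex
      by (simp add: complex_norm_square[symmetric] del: complex_mult_cnj)
    have eq2: "Re (w * cnj w' + w' * cnj w) = 2 * Re (w' * cnj w)" for w w' :: complex by simp
    show ?thesis
      unfolding g_def gd_def by (rule has_vector_derivative_at_within[OF der[unfolded eq1 eq2]])
  qed
  define J where "J e = tint \<gamma> (\<lambda>x. \<bar>gd e x\<bar>)" for e
  have J: "J e \<le> 2 * sqrt (m * k)" if e: "e \<in> Basis" for e
  proof -
    have J0: "J e \<ge> 0" unfolding J_def using e by (intro tint_nonneg continuous_intros cgd) auto
    have "(J e)\<^sup>2 \<le> 4 * m * tint \<gamma> (\<lambda>x. (norm (fd e x))\<^sup>2)"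
    proof (rule square_le_of_amgm[OF J0 m0 ke0[OF e]])
      fix s :: real assume s: "s > 0"
      have "J e \<le> tint \<gamma> (\<lambda>x. s * (norm (f x))\<^sup>2 + (1 / s) * (norm (fd e x))\<^sup>2)"
        unfolding J_def
      proof (rule tint_mono)
        show "continuous_on UNIV (\<lambda>x. \<bar>gd e x\<bar>)" using e by (intro continuous_intros cgd)
        show "continuous_on UNIV (\<lambda>x. s * (norm (f x))\<^sup>2 + (1 / s) * (norm (fd e x))\<^sup>2)"
          using e by (intro continuous_intros cfd)
        fix x
        have "\<bar>gd e x\<bar> \<le> 2 * (norm (fd e x) * norm (f x))"
          unfolding gd_def using abs_Re_le_cmod[of "fd e x * cnj (f x)"] by (simp add: norm_mult abs_mult)
        also have "\<dots> = 2 * (sqrt s * norm (f x)) * (norm (fd e x) / sqrt s)" using s by simp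
        also have "\<dots> \<le> (sqrt s * norm (f x))\<^sup>2 + (norm (fd e x) / sqrt s)\<^sup>2" by (rule sum_squares_bound)
        also have "\<dots> = s * (norm (f x))\<^sup>2 + (1 / s) * (norm (fd e x))\<^sup>2" using s by (simp add: power_mult_distrib power_divide)
        finally show "\<bar>gd e x\<bar> \<le> s * (norm (f x))\<^sup>2 + (1 / s) * (norm (fd e x))\<^sup>2" .
      qed
      also have "\<dots> = s * m + tint \<gamma> (\<lambda>x. (norm (fd e x))\<^sup>2) / s"
      proof -
        have "tint \<gamma> (\<lambda>x. s * (norm (f x))\<^sup>2) = s * m"
          unfolding m_def by (intro tint_cmult_real continuous_intros)
        moreover have "tint \<gamma> (\<lambda>x. (1 / s) * (norm (fd e x))\<^sup>2) = (1 / s) * tint \<gamma> (\<lambda>x. (norm (fd e x))\<^sup>2)"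
          using e by (intro tint_cmult_real continuous_intros cfd)
        moreover have "tint \<gamma> (\<lambda>x. s * (norm (f x))\<^sup>2 + (1 / s) * (norm (fd e x))\<^sup>2)
          = tint \<gamma> (\<lambda>x. s * (norm (f x))\<^sup>2) + tint \<gamma> (\<lambda>x. (1 / s) * (norm (fd e x))\<^sup>2)"
          using e by (intro tint_add continuous_intros cfd)
        ultimately show ?thesis by simp
      qed
      finally show "J e \<le> s * m + tint \<gamma> (\<lambda>x. (norm (fd e x))\<^sup>2) / s" .
    qed
    also have "\<dots> \<le> 4 * m * k"
      unfolding k_def using e ke0 m0 by (intro mult_left_mono member_le_sum) auto
    also have "\<dots> = (2 * sqrt (m * k))\<^sup>2" using m0 k0 by (simp add: power_mult_distrib)
    finally show ?thesis using m0 k0 by (auto intro: power2_le_imp_le)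
  qed
  define L1 L2 where "L1 = 2 * pi" and "L2 = 2 * pi * \<gamma>"
  have L: "L1 > 0" "L2 > 0" using \<gamma> by (auto simp: L1_def L2_def)
  define A where "A y = integral {0..L1} (\<lambda>x. g (x, y)) / L1 + integral {0..L1} (\<lambda>x. \<bar>gd (1, 0) (x, y)\<bar>)" for y
  define B where "B x = integral {0..L2} (\<lambda>y. g (x, y)) / L2 + integral {0..L2} (\<lambda>y. \<bar>gd (0, 1) (x, y)\<bar>)" for x
  have Bas: "(1, 0) \<in> (Basis :: (real \<times> real) set)" "(0, 1) \<in> (Basis :: (real \<times> real) set)" by (auto simp: Basis_plane)
  have c2: "continuous_on C (\<lambda>x. q (p x))" if "continuous_on UNIV q" "continuous_on C p" for C :: "'b::topological_space set" and p :: "'b \<Rightarrow> real \<times> real" and q :: "real \<times> real \<Rightarrow> real"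
    using continuous_on_compose2[OF that(1,2)] by auto
  have gA: "g (x, y) \<le> A y" if "x \<in> {0..L1}" for x y
    unfolding A_def
  proof (rule abs_integral_dominates[OF L(1) _ _ that])
    show "((\<lambda>x. g (x, y)) has_vector_derivative gd (1, 0) (s, y)) (at s within {0..L1})" for s
      using gder[OF Bas(1), of "(0, y)" s] by simp
    show "continuous_on {0..L1} (\<lambda>s. gd (1, 0) (s, y))" by (intro c2[OF cgd[OF Bas(1)]] continuous_intros)
  qed
  have gB: "g (x, y) \<le> B x" if "y \<in> {0..L2}" for x y
    unfolding B_def
  proof (rule abs_integral_dominates[OF L(2) _ _ that])
    show "((\<lambda>y. g (x, y)) has_vector_derivative gd (0, 1) (x, s)) (at s within {0..L2})" for s
      using gder[OF Bas(2), of "(x, 0)" s] by simp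
    show "continuous_on {0..L2} (\<lambda>s. gd (0, 1) (x, s))" by (intro c2[OF cgd[OF Bas(2)]] continuous_intros)
  qed
  have pc1: "continuous_on (UNIV \<times> cbox 0 L1) (\<lambda>(y, x). g (x, y))" "continuous_on (UNIV \<times> cbox 0 L1) (\<lambda>(y, x). \<bar>gd (1, 0) (x, y)\<bar>)"
    unfolding case_prod_unfold by (intro continuous_intros c2[OF cg] c2[OF cgd[OF Bas(1)]])+
  have pc2: "continuous_on (UNIV \<times> cbox 0 L2) (\<lambda>(x, y). g (x, y))" "continuous_on (UNIV \<times> cbox 0 L2) (\<lambda>(x, y). \<bar>gd (0, 1) (x, y)\<bar>)"
    unfolding case_prod_unfold by (intro continuous_intros c2[OF cg] c2[OF cgd[OF Bas(2)]])+
  have cAs: "continuous_on UNIV (\<lambda>y. integral {0..L1} (\<lambda>x. g (x, y)))" "continuous_on UNIV (\<lambda>y. integral {0..L1} (\<lambda>x. \<bar>gd (1, 0) (x, y)\<bar>))"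
    using integral_continuous_on_param[OF pc1(1)] integral_continuous_on_param[OF pc1(2)] by simp_all
  have cBs: "continuous_on UNIV (\<lambda>x. integral {0..L2} (\<lambda>y. g (x, y)))" "continuous_on UNIV (\<lambda>x. integral {0..L2} (\<lambda>y. \<bar>gd (0, 1) (x, y)\<bar>))"
    using integral_continuous_on_param[OF pc2(1)] integral_continuous_on_param[OF pc2(2)] by simp_all
  have cA: "continuous_on UNIV A" and cB: "continuous_on UNIV B"
    unfolding A_def B_def using L by (intro continuous_intros cAs cBs; simp)+
  have tint_iter: "tint \<gamma> q = integral {0..L1} (\<lambda>x. integral {0..L2} (\<lambda>y. q (x, y)))" if "continuous_on UNIV q" for q :: "real \<times> real \<Rightarrow> real"
    using integral_prod_continuous[of 0 0 L1 L2 q] that by (simp add: tint_def L1_def L2_def continuous_on_subset)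
  have tint_iter': "tint \<gamma> q = integral {0..L2} (\<lambda>y. integral {0..L1} (\<lambda>x. q (x, y)))" if q: "continuous_on UNIV q" for q :: "real \<times> real \<Rightarrow> real"
  proof -
    have "continuous_on (cbox (0, 0) (L1, L2)) (\<lambda>(x, y). q (x, y))" using q by (auto intro: continuous_on_subset)
    from integral_swap_continuous[OF this] show ?thesis using tint_iter[OF q] by simp
  qed
  have intA: "integral {0..L2} A = m / L1 + J (1, 0)"
  proof -
    have "integral {0..L2} A = integral {0..L2} (\<lambda>y. integral {0..L1} (\<lambda>x. g (x, y)) / L1) + integral {0..L2} (\<lambda>y. integral {0..L1} (\<lambda>x. \<bar>gd (1, 0) (x, y)\<bar>))"
      unfolding A_def using L
      by (intro integral_add integrable_continuous_real continuous_intros continuous_on_subset[OF cAs(1)] continuous_on_subset[OF cAs(2)]) auto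
    also have "\<dots> = m / L1 + J (1, 0)"
      using tint_iter'[OF cg] tint_iter'[of "\<lambda>x. \<bar>gd (1, 0) x\<bar>"] continuous_on_rabs[OF cgd[OF Bas(1)]]
      by (simp add: m_def J_def g_def[symmetric])
    finally show ?thesis .
  qed
  have intB: "integral {0..L1} B = m / L2 + J (0, 1)"
  proof -
    have "integral {0..L1} B = integral {0..L1} (\<lambda>x. integral {0..L2} (\<lambda>y. g (x, y)) / L2) + integral {0..L1} (\<lambda>x. integral {0..L2} (\<lambda>y. \<bar>gd (0, 1) (x, y)\<bar>))"
      unfolding B_def using L
      by (intro integral_add integrable_continuous_real continuous_intros continuous_on_subset[OF cBs(1)] continuous_on_subset[OF cBs(2)]) auto
    also have "\<dots> = m / L2 + J (0, 1)"
      using tint_iter[OF cg] tint_iter[of "\<lambda>x. \<bar>gd (0, 1) x\<bar>"] continuous_on_rabs[OF cgd[OF Bas(2)]]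
      by (simp add: m_def J_def g_def[symmetric])
    finally show ?thesis .
  qed
  have g0: "g x \<ge> 0" for x by (simp add: g_def)
  have "tint \<gamma> (\<lambda>x. norm (f x) ^ 4) = integral {0..L1} (\<lambda>x. integral {0..L2} (\<lambda>y. g (x, y) * g (x, y)))"
  proof -
    have "norm (f x) ^ 4 = g x * g x" for x by (simp add: g_def power4_eq_xxxx power2_eq_square)
    then show ?thesis using tint_iter[of "\<lambda>x. g x * g x"] by (simp add: continuous_on_mult cg)
  qed
  also have "\<dots> \<le> integral {0..L1} (\<lambda>x. integral {0..L2} (\<lambda>y. A y * B x))"
  proof (rule integral_le)
    have "continuous_on (UNIV \<times> cbox 0 L2) (\<lambda>(x, y). g (x, y) * g (x, y))"
      unfolding case_prod_unfold by (intro continuous_intros c2[OF cg])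
    from integral_continuous_on_param[OF this]
    show "(\<lambda>x. integral {0..L2} (\<lambda>y. g (x, y) * g (x, y))) integrable_on {0..L1}"
      by (intro integrable_continuous_real) (auto intro: continuous_on_subset)
    show "(\<lambda>x. integral {0..L2} (\<lambda>y. A y * B x)) integrable_on {0..L1}"
      by (simp, intro integrable_continuous_real continuous_intros continuous_on_subset[OF cB]) auto
    fix x assume x: "x \<in> {0..L1}"
    show "integral {0..L2} (\<lambda>y. g (x, y) * g (x, y)) \<le> integral {0..L2} (\<lambda>y. A y * B x)"
    proof (intro integral_le integrable_continuous_real)
      show "continuous_on {0..L2} (\<lambda>y. g (x, y) * g (x, y))" by (intro continuous_intros c2[OF cg])
      show "continuous_on {0..L2} (\<lambda>y. A y * B x)" by (intro continuous_intros continuous_on_subset[OF cA]) auto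
      fix y assume y: "y \<in> {0..L2}"
      show "g (x, y) * g (x, y) \<le> A y * B x"
        using gA[OF x, of y] gB[OF y, of x] g0[of "(x, y)"] by (intro mult_mono) auto
    qed
  qed
  also have "\<dots> = integral {0..L2} A * integral {0..L1} B" by simp
  also have "\<dots> = (m / L1 + J (1, 0)) * (m / L2 + J (0, 1))" by (simp only: intA intB)
  also have "\<dots> \<le> (c * m + 2 * sqrt (m * k)) * (c * m + 2 * sqrt (m * k))"
  proof (rule mult_mono)
    have "c = 1 / L1 + 1 / L2" by (simp add: c_def L1_def L2_def)
    then have "c * m = m / L1 + m / L2" by (simp add: distrib_right)
    moreover have "m / L1 \<ge> 0" "m / L2 \<ge> 0" using m0 L by auto
    ultimately have "m / L1 \<le> c * m" "m / L2 \<le> c * m" by linarith+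
    then show "m / L1 + J (1, 0) \<le> c * m + 2 * sqrt (m * k)" "m / L2 + J (0, 1) \<le> c * m + 2 * sqrt (m * k)"
      using J[OF Bas(1)] J[OF Bas(2)] by linarith+
    have "J (0, 1) \<ge> 0" unfolding J_def using Bas by (intro tint_nonneg continuous_intros cgd) auto
    then show "m / L2 + J (0, 1) \<ge> 0" using m0 L by simp
    have "c \<ge> 0" using \<gamma> by (simp add: c_def)
    then show "c * m + 2 * sqrt (m * k) \<ge> 0" using m0 k0 by simp
  qed
  also have "\<dots> \<le> 2 * (c * m)\<^sup>2 + 2 * (2 * sqrt (m * k))\<^sup>2"
    using sum_squares_bound[of "c * m" "2 * sqrt (m * k)"] by (simp add: power2_eq_square algebra_simps)
  also have "\<dots> = 2 * c\<^sup>2 * m\<^sup>2 + 8 * m * k" using m0 k0 by (simp add: power_mult_distrib)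
  finally show ?thesis .
qed

section \<open>Conservation laws for smooth solutions\<close>

lemma smooth_on_derivative:
  assumes "smooth_on S f"
  obtains D where "\<And>x. x \<in> S \<Longrightarrow> (f has_derivative D x) (at x within S)" "\<And>h. smooth_on S (\<lambda>x. D x h)"
  using assms by (cases rule: smooth_on.cases) blast

lemma smooth_on_continuous_on: "smooth_on S f \<Longrightarrow> continuous_on S f"
  by (erule smooth_on_derivative) (rule has_derivative_continuous_on)

lemma has_derivative_slab_time:
  fixes U :: "real \<times> 'a::euclidean_space \<Rightarrow> 'b::real_normed_vector"
  assumes D: "(U has_derivative D) (at (t, x) within A \<times> UNIV)"
  shows "((\<lambda>s. U (s, x)) has_vector_derivative D (1, 0)) (at t within A)"
proof -
  have "((\<lambda>s. U (s, x)) has_derivative (\<lambda>h. D (h, 0))) (at t within A)"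
  proof (rule has_derivative_in_compose[where f = "\<lambda>s. (s, x)"])
    show "((\<lambda>s. (s, x)) has_derivative (\<lambda>h. (h, 0))) (at t within A)" by (auto intro!: derivative_eq_intros)
    show "(U has_derivative D) (at (t, x) within (\<lambda>s. (s, x)) ` A)" by (rule has_derivative_subset[OF D]) auto
  qed
  moreover have "(\<lambda>h. D (h, 0)) = (\<lambda>h. h *\<^sub>R D (1, 0))"
  proof
    fix h :: real
    have scale: "(h, 0::'a) = h *\<^sub>R (1, 0)" by (rule prod_eqI) simp_all
    show "D (h, 0) = h *\<^sub>R D (1, 0)"
      unfolding scale by (rule linear_scale[OF has_derivative_linear[OF D]])
  qed
  ultimately show ?thesis unfolding has_vector_derivative_def by (simp only:)
qed

lemma has_derivative_slab_space:
  fixes U :: "real \<times> 'a::euclidean_space \<Rightarrow> 'b::real_normed_vector"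
  assumes D: "(U has_derivative D) (at (t, x) within A \<times> UNIV)" and t: "t \<in> A"
  shows "((\<lambda>s. U (t, x + s *\<^sub>R e)) has_vector_derivative D (0, e)) (at 0)"
proof -
  have "((\<lambda>s. U (t, x + s *\<^sub>R e)) has_derivative (\<lambda>h. D (0, h *\<^sub>R e))) (at 0)"
  proof (rule has_derivative_in_compose[where f = "\<lambda>s. (t, x + s *\<^sub>R e)"])
    show "((\<lambda>s. (t, x + s *\<^sub>R e)) has_derivative (\<lambda>h. (0, h *\<^sub>R e))) (at 0)" by (auto intro!: derivative_eq_intros)
    show "(U has_derivative D) (at (t, x + 0 *\<^sub>R e) within range (\<lambda>s. (t, x + s *\<^sub>R e)))"
      using t by (simp, intro has_derivative_subset[OF D]) auto
  qed
  moreover have "(\<lambda>h. D (0, h *\<^sub>R e)) = (\<lambda>h. h *\<^sub>R D (0, e))"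
  proof
    fix h :: real
    have scale: "(0::real, h *\<^sub>R e) = h *\<^sub>R (0, e)" by (rule prod_eqI) simp_all
    show "D (0, h *\<^sub>R e) = h *\<^sub>R D (0, e)"
      unfolding scale by (rule linear_scale[OF has_derivative_linear[OF D]])
  qed
  ultimately show ?thesis unfolding has_vector_derivative_def by (simp only:)
qed

lemma torus_periodic_deriv_along:
  assumes f: "deriv_along e f f'" and per: "torus_periodic \<gamma> f"
  shows "torus_periodic \<gamma> f'"
proof -
  have "f' (z + p) = f' z" if p: "\<And>z. f (z + p) = f z" for z p
  proof -
    have "((\<lambda>s. f (z + p + s *\<^sub>R e)) has_vector_derivative f' (z + p)) (at 0)" using f unfolding deriv_along_def by blast
    moreover have "f (z + p + s *\<^sub>R e) = f (z + s *\<^sub>R e)" for s using p[of "z + s *\<^sub>R e"] by (simp add: algebra_simps)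
    ultimately have "((\<lambda>s. f (z + s *\<^sub>R e)) has_vector_derivative f' (z + p)) (at 0)" by simp
    moreover have "((\<lambda>s. f (z + s *\<^sub>R e)) has_vector_derivative f' z) (at 0)" using f unfolding deriv_along_def by blast
    ultimately show ?thesis by (rule vector_derivative_unique_at)
  qed
  from this[of "(2 * pi, 0)"] this[of "(0, 2 * pi * \<gamma>)"] show ?thesis
    using per unfolding torus_periodic_def by (simp add: split_paired_all)
qed

lemma has_vector_derivative_norm_squared:
  fixes w :: "real \<Rightarrow> complex"
  assumes "(w has_vector_derivative w') (at t within A)"
  shows "((\<lambda>s. (norm (w s))\<^sup>2) has_vector_derivative 2 * Re (w' * cnj (w t))) (at t within A)"
proof -
  have "((\<lambda>s. Re (w s * cnj (w s))) has_vector_derivative Re (w t * cnj w' + w' * cnj (w t))) (at t within A)"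
    using assms by (intro bounded_linear.has_vector_derivative[OF bounded_linear_Re] has_vector_derivative_mult has_vector_derivative_cnj)
  moreover have "Re (z * cnj z) = (norm z)\<^sup>2" for z :: complex
    by (simp add: complex_norm_square[symmetric] del: complex_mult_cnj)
  moreover have "Re (w t * cnj w' + w' * cnj (w t)) = 2 * Re (w' * cnj (w t))" by simp
  ultimately show ?thesis by simp
qed

text \<open>
  The derivatives of a smooth solution that the conservation laws use: \<open>ut\<close> is the time derivative,
  \<open>ud e\<close> and \<open>udd e\<close> are the first and second derivative along \<open>e\<close>, and
  \<open>udt e\<close> is the time derivative of \<open>ud e\<close>.
\<close>

locale classical_nls =
  fixes \<gamma> \<mu> T :: real and u ut :: "real \<Rightarrow> real \<times> real \<Rightarrow> complex"
    and ud udd udt :: "real \<times> real \<Rightarrow> real \<Rightarrow> real \<times> real \<Rightarrow> complex"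
  assumes gamma_pos: "\<gamma> > 0" and T_pos: "T > 0"
    and cont_u: "continuous_on ({0..T} \<times> UNIV) (\<lambda>(t, x). u t x)"
    and cont_ut: "continuous_on ({0..T} \<times> UNIV) (\<lambda>(t, x). ut t x)"
    and cont_ud: "e \<in> Basis \<Longrightarrow> continuous_on ({0..T} \<times> UNIV) (\<lambda>(t, x). ud e t x)"
    and cont_udd: "e \<in> Basis \<Longrightarrow> continuous_on ({0..T} \<times> UNIV) (\<lambda>(t, x). udd e t x)"
    and cont_udt: "e \<in> Basis \<Longrightarrow> continuous_on ({0..T} \<times> UNIV) (\<lambda>(t, x). udt e t x)"
    and periodic: "t \<in> {0..T} \<Longrightarrow> torus_periodic \<gamma> (u t)"
    and deriv_u: "t \<in> {0..T} \<Longrightarrow> ((\<lambda>s. u s x) has_vector_derivative ut t x) (at t within {0..T})"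
    and deriv_ud: "e \<in> Basis \<Longrightarrow> t \<in> {0..T} \<Longrightarrow> ((\<lambda>s. ud e s x) has_vector_derivative udt e t x) (at t within {0..T})"
    and along_u: "e \<in> Basis \<Longrightarrow> t \<in> {0..T} \<Longrightarrow> deriv_along e (u t) (ud e t)"
    and along_ud: "e \<in> Basis \<Longrightarrow> t \<in> {0..T} \<Longrightarrow> deriv_along e (ud e t) (udd e t)"
    and nls: "t \<in> {0..T} \<Longrightarrow> \<i> * ut t x + (\<Sum>e\<in>Basis. udd e t x) = of_real (\<mu> * (norm (u t x))\<^sup>2) * u t x"

lemma nls_smooth_solution_classical:
  assumes "\<gamma> > 0" and T: "T > 0" and sol: "nls_smooth_solution \<gamma> \<mu> T u0 u"
  obtains ut ud udd udt where "classical_nls \<gamma> \<mu> T u ut ud udd udt"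
proof -
  let ?S = "{0..T} \<times> (UNIV :: (real \<times> real) set)"
  define U where "U = (\<lambda>(t, x). u t x)"
  have U: "smooth_on ?S U" and per: "\<And>t. t \<in> {0..T} \<Longrightarrow> torus_periodic \<gamma> (u t)"
    and eqn: "\<And>t x. t \<in> {0..T} \<Longrightarrow> \<i> * vector_derivative (\<lambda>s. u s x) (at t within {0..T}) + laplacian (u t) x
          = of_real (\<mu> * (norm (u t x))\<^sup>2) * u t x"
    using sol unfolding nls_smooth_solution_def U_def by auto
  obtain D where D: "\<And>z. z \<in> ?S \<Longrightarrow> (U has_derivative D z) (at z within ?S)" and D_smooth: "\<And>h. smooth_on ?S (\<lambda>z. D z h)"
    using smooth_on_derivative[OF U] by blast
  have "\<forall>e. \<exists>D2. (\<forall>z\<in>?S. ((\<lambda>z. D z (0, e)) has_derivative D2 z) (at z within ?S)) \<and> (\<forall>h. smooth_on ?S (\<lambda>z. D2 z h))"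
    using smooth_on_derivative[OF D_smooth] by metis
  then obtain D2 where D2: "\<And>e z. z \<in> ?S \<Longrightarrow> ((\<lambda>z. D z (0, e)) has_derivative D2 e z) (at z within ?S)"
    and D2_smooth: "\<And>e h. smooth_on ?S (\<lambda>z. D2 e z h)" by metis
  define ut where "ut t x = D (t, x) (1, 0)" for t x
  define ud where "ud e t x = D (t, x) (0, e)" for e t x
  define udd where "udd e t x = D2 e (t, x) (0, e)" for e t x
  define udt where "udt e t x = D2 e (t, x) (1, 0)" for e t x
  have eta: "(\<lambda>(t, x). g (t, x)) = g" for g :: "real \<times> real \<times> real \<Rightarrow> complex" by auto
  have along1: "deriv_along e (u t) (ud e t)" if "t \<in> {0..T}" for e t
    unfolding deriv_along_def ud_def using has_derivative_slab_space[OF D, of t _ e] that by (simp add: U_def)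
  have along2: "deriv_along e (ud e t) (udd e t)" if "t \<in> {0..T}" for e t
    unfolding deriv_along_def ud_def udd_def using has_derivative_slab_space[OF D2, of t _ e e] that by simp
  have time1: "((\<lambda>s. u s x) has_vector_derivative ut t x) (at t within {0..T})" if "t \<in> {0..T}" for t x
    unfolding ut_def using has_derivative_slab_time[OF D, of t x] that by (simp add: U_def)
  have "classical_nls \<gamma> \<mu> T u ut ud udd udt"
  proof
    show "continuous_on ?S (\<lambda>(t, x). u t x)" using smooth_on_continuous_on[OF U] by (simp add: U_def)
    show "continuous_on ?S (\<lambda>(t, x). ut t x)" "continuous_on ?S (\<lambda>(t, x). ud e t x)"
      "continuous_on ?S (\<lambda>(t, x). udd e t x)" "continuous_on ?S (\<lambda>(t, x). udt e t x)" for e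
      unfolding ut_def ud_def udd_def udt_def using smooth_on_continuous_on[OF D_smooth] smooth_on_continuous_on[OF D2_smooth]
      by (simp_all add: eta[of "\<lambda>z. D z h" for h] eta[of "\<lambda>z. D2 e z h" for h])
    show "((\<lambda>s. ud e s x) has_vector_derivative udt e t x) (at t within {0..T})" if "t \<in> {0..T}" for e t x
      unfolding ud_def udt_def using has_derivative_slab_time[OF D2, of t x] that by simp
    fix t x assume t: "t \<in> {0..T}"
    have "vector_derivative (\<lambda>s. u s x) (at t within {0..T}) = ut t x"
      using vector_derivative_within_closed_interval[OF T t time1[OF t]] .
    moreover have "laplacian (u t) x = (\<Sum>e\<in>Basis. udd e t x)"
    proof -
      have "vector_derivative (\<lambda>r. u t (x + r *\<^sub>R e)) (at s) = ud e t (x + s *\<^sub>R e)" for e s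
        by (rule vector_derivative_at[OF deriv_along_at[OF along1[OF t]]])
      moreover have "vector_derivative (\<lambda>s. ud e t (x + s *\<^sub>R e)) (at 0) = udd e t x" for e
        using along2[OF t] unfolding deriv_along_def by (intro vector_derivative_at) blast
      ultimately show ?thesis unfolding laplacian_def by simp
    qed
    ultimately show "\<i> * ut t x + (\<Sum>e\<in>Basis. udd e t x) = of_real (\<mu> * (norm (u t x))\<^sup>2) * u t x"
      using eqn[OF t, of x] by simp
  qed (use assms per along1 along2 time1 in auto)
  then show thesis by (rule that)
qed

context classical_nls
begin

lemma slice_u: "t \<in> {0..T} \<Longrightarrow> continuous_on UNIV (u t)"
  and slice_ut: "t \<in> {0..T} \<Longrightarrow> continuous_on UNIV (ut t)"
  and slice_ud: "e \<in> Basis \<Longrightarrow> t \<in> {0..T} \<Longrightarrow> continuous_on UNIV (ud e t)"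
  and slice_udd: "e \<in> Basis \<Longrightarrow> t \<in> {0..T} \<Longrightarrow> continuous_on UNIV (udd e t)"
  and slice_udt: "e \<in> Basis \<Longrightarrow> t \<in> {0..T} \<Longrightarrow> continuous_on UNIV (udt e t)"
  using continuous_on_slice[OF cont_u] continuous_on_slice[OF cont_ut] continuous_on_slice[OF cont_ud]
    continuous_on_slice[OF cont_udd] continuous_on_slice[OF cont_udt] by blast+

lemma periodic_ud: "e \<in> Basis \<Longrightarrow> t \<in> {0..T} \<Longrightarrow> torus_periodic \<gamma> (ud e t)"
  by (rule torus_periodic_deriv_along[OF along_u periodic])

definition "nonlinearity t x = of_real (\<mu> * (norm (u t x))\<^sup>2) * u t x"

lemma slice_nonlinearity: "t \<in> {0..T} \<Longrightarrow> continuous_on UNIV (nonlinearity t)"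
  unfolding nonlinearity_def by (intro continuous_intros slice_u)

lemma ut_eq: "t \<in> {0..T} \<Longrightarrow> ut t x = \<i> * (\<Sum>e\<in>Basis. udd e t x) - \<i> * nonlinearity t x"
proof -
  assume "t \<in> {0..T}"
  then have "- \<i> * (\<i> * ut t x + (\<Sum>e\<in>Basis. udd e t x)) = - \<i> * nonlinearity t x"
    by (simp only: nls nonlinearity_def)
  then show ?thesis by (simp add: algebra_simps)
qed

text \<open>
  The weak form of the equation, used with the solution itself and with the linear wave as \<open>w\<close>.
\<close>

lemma tint_ut:
  assumes t: "t \<in> {0..T}" and w: "\<And>e. e \<in> Basis \<Longrightarrow> deriv_along e w (wd e)" "torus_periodic \<gamma> w"
    and cw: "continuous_on UNIV w" and cwd: "\<And>e. e \<in> Basis \<Longrightarrow> continuous_on UNIV (wd e)"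
  shows "tint \<gamma> (\<lambda>x. ut t x * cnj (w x)) =
    - \<i> * (\<Sum>e\<in>Basis. tint \<gamma> (\<lambda>x. ud e t x * cnj (wd e x))) - \<i> * tint \<gamma> (\<lambda>x. nonlinearity t x * cnj (w x))"
proof -
  have "tint \<gamma> (\<lambda>x. ut t x * cnj (w x)) =
      tint \<gamma> (\<lambda>x. (\<Sum>e\<in>Basis. \<i> * (udd e t x * cnj (w x))) - \<i> * (nonlinearity t x * cnj (w x)))"
    by (simp add: ut_eq[OF t] left_diff_distrib sum_distrib_left sum_distrib_right mult.assoc)
  also have "\<dots> = tint \<gamma> (\<lambda>x. \<Sum>e\<in>Basis. \<i> * (udd e t x * cnj (w x))) - tint \<gamma> (\<lambda>x. \<i> * (nonlinearity t x * cnj (w x)))"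
    using t by (intro tint_diff continuous_intros slice_udd slice_nonlinearity cw)
  also have "tint \<gamma> (\<lambda>x. \<i> * (nonlinearity t x * cnj (w x))) = \<i> * tint \<gamma> (\<lambda>x. nonlinearity t x * cnj (w x))"
    using t by (intro tint_cmult continuous_intros slice_nonlinearity cw)
  also have "tint \<gamma> (\<lambda>x. \<Sum>e\<in>Basis. \<i> * (udd e t x * cnj (w x))) = (\<Sum>e\<in>Basis. tint \<gamma> (\<lambda>x. \<i> * (udd e t x * cnj (w x))))"
    using t by (intro tint_sum continuous_intros slice_udd cw)
  also have "\<dots> = (\<Sum>e\<in>Basis. - \<i> * tint \<gamma> (\<lambda>x. ud e t x * cnj (wd e x)))"
  proof (rule sum.cong[OF refl])
    fix e :: "real \<times> real" assume e: "e \<in> Basis"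
    have "tint \<gamma> (\<lambda>x. \<i> * (udd e t x * cnj (w x))) = \<i> * tint \<gamma> (\<lambda>x. udd e t x * cnj (w x))"
      using t e by (intro tint_cmult continuous_intros slice_udd cw)
    also have "tint \<gamma> (\<lambda>x. udd e t x * cnj (w x)) = - tint \<gamma> (\<lambda>x. ud e t x * cnj (wd e x))"
      using t e w by (intro tint_by_parts[OF gamma_pos e along_ud]) (auto intro: slice_ud slice_udd cw cwd periodic_ud)
    finally show "tint \<gamma> (\<lambda>x. \<i> * (udd e t x * cnj (w x))) = - \<i> * tint \<gamma> (\<lambda>x. ud e t x * cnj (wd e x))" by simp
  qed
  finally show ?thesis by (simp add: sum_distrib_left)
qed

lemma cont_slab [continuous_intros]:
  "continuous_on ({0..T} \<times> UNIV) (\<lambda>z. u (fst z) (snd z))" "continuous_on ({0..T} \<times> UNIV) (\<lambda>z. ut (fst z) (snd z))"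
  "e \<in> Basis \<Longrightarrow> continuous_on ({0..T} \<times> UNIV) (\<lambda>z. ud e (fst z) (snd z))"
  "e \<in> Basis \<Longrightarrow> continuous_on ({0..T} \<times> UNIV) (\<lambda>z. udt e (fst z) (snd z))"
  using cont_u cont_ut cont_ud cont_udt by (simp_all add: case_prod_unfold)

lemma constant_of_zero_derivative:
  fixes h :: "real \<Rightarrow> real"
  assumes "\<And>t. t \<in> {0..T} \<Longrightarrow> (h has_vector_derivative 0) (at t within {0..T})" and t: "t \<in> {0..T}"
  shows "h t = h 0"
proof -
  have "\<exists>c. \<forall>x\<in>{0..T}. h x = c"
    using assms(1) by (intro has_derivative_zero_constant) (auto simp: has_vector_derivative_def)
  then show ?thesis using t T_pos by auto
qed

definition "mass t = tint \<gamma> (\<lambda>x. (norm (u t x))\<^sup>2)"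
definition "kinetic t = (\<Sum>e\<in>Basis. tint \<gamma> (\<lambda>x. (norm (ud e t x))\<^sup>2))"
definition "quartic t = tint \<gamma> (\<lambda>x. norm (u t x) ^ 4)"

text \<open>
  With \<open>w = u\<close> the weak form shows that \<open>\<integral>u\<^sub>t cnj(u)\<close> is purely
  imaginary.
\<close>

lemma mass_conserved:
  assumes "t \<in> {0..T}"
  shows "mass t = mass 0"
proof (rule constant_of_zero_derivative[OF _ assms])
  fix t assume t: "t \<in> {0..T}"
  have "(mass has_vector_derivative tint \<gamma> (\<lambda>x. 2 * Re (ut t x * cnj (u t x)))) (at t within {0..T})"
    unfolding mass_def
  proof (rule tint_has_vector_derivative[OF _ _ _ t])
    show "((\<lambda>s. (norm (u s x))\<^sup>2) has_vector_derivative 2 * Re (ut t x * cnj (u t x))) (at t within {0..T})"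
      if "t \<in> {0..T}" for t x by (rule has_vector_derivative_norm_squared[OF deriv_u[OF that]])
    show "continuous_on UNIV (\<lambda>x. (norm (u t x))\<^sup>2)" if "t \<in> {0..T}" for t
      using that by (intro continuous_intros slice_u)
    show "continuous_on ({0..T} \<times> UNIV) (\<lambda>(t, x). 2 * Re (ut t x * cnj (u t x)))"
      unfolding case_prod_unfold by (intro continuous_intros)
  qed
  also have "tint \<gamma> (\<lambda>x. 2 * Re (ut t x * cnj (u t x))) = 2 * Re (tint \<gamma> (\<lambda>x. ut t x * cnj (u t x)))"
  proof -
    have c: "continuous_on UNIV (\<lambda>x. ut t x * cnj (u t x))" using t by (intro continuous_intros slice_u slice_ut)
    then show ?thesis
      using tint_linear[OF bounded_linear_Re c] tint_cmult_real[of "\<lambda>x. Re (ut t x * cnj (u t x))" \<gamma> 2] continuous_on_Re[OF c] by simp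
  qed
  also have "tint \<gamma> (\<lambda>x. ut t x * cnj (u t x)) =
      - \<i> * (\<Sum>e\<in>Basis. tint \<gamma> (\<lambda>x. ud e t x * cnj (ud e t x))) - \<i> * tint \<gamma> (\<lambda>x. nonlinearity t x * cnj (u t x))"
    using t by (intro tint_ut along_u periodic slice_u slice_ud)
  also have "Re \<dots> = 0"
  proof -
    have 1: "tint \<gamma> (\<lambda>x. ud e t x * cnj (ud e t x)) = of_real (tint \<gamma> (\<lambda>x. (norm (ud e t x))\<^sup>2))" if "e \<in> Basis" for e
      unfolding complex_norm_square[symmetric] using that t by (intro tint_of_real continuous_intros slice_ud)
    have "nonlinearity t x * cnj (u t x) = of_real (\<mu> * (norm (u t x))\<^sup>2 * (norm (u t x))\<^sup>2)" for x
      unfolding nonlinearity_def mult.assoc complex_norm_square[symmetric] by simp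
    then have 2: "tint \<gamma> (\<lambda>x. nonlinearity t x * cnj (u t x)) = of_real (tint \<gamma> (\<lambda>x. \<mu> * (norm (u t x))\<^sup>2 * (norm (u t x))\<^sup>2))"
      using t by (simp only:) (intro tint_of_real continuous_intros slice_u)
    show ?thesis by (simp only: 2) (simp add: 1)
  qed
  finally show "(mass has_vector_derivative 0) (at t within {0..T})" by simp
qed

text \<open>
  Formally this is an integration by parts after exchanging the derivatives in \<open>udt\<close>. In place of the
  exchange, the identity \<open>\<integral>\<partial>\<^sub>e u(s) cnj(\<partial>\<^sub>e u(t)) = -
  \<integral>u(s) cnj(\<partial>\<^sub>e\<partial>\<^sub>e u(t))\<close> between functions of \<open>s\<close> is
  differentiated at \<open>s = t\<close>; the two derivatives agree by uniqueness.
\<close>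

lemma tint_udt:
  assumes e: "e \<in> Basis" and t: "t \<in> {0..T}"
  shows "tint \<gamma> (\<lambda>x. udt e t x * cnj (ud e t x)) = - tint \<gamma> (\<lambda>x. ut t x * cnj (udd e t x))"
proof -
  define f where "f s = tint \<gamma> (\<lambda>x. ud e s x * cnj (ud e t x))" for s
  have sl: "continuous_on ({0..T} \<times> UNIV) (\<lambda>z. ud e t (snd z))" "continuous_on ({0..T} \<times> UNIV) (\<lambda>z. udd e t (snd z))"
    using continuous_on_compose2[OF slice_ud[OF e t], of "{0..T} \<times> UNIV" snd]
      continuous_on_compose2[OF slice_udd[OF e t], of "{0..T} \<times> UNIV" snd] by (simp_all add: continuous_on_snd)
  have "(f has_vector_derivative tint \<gamma> (\<lambda>x. udt e t x * cnj (ud e t x))) (at t within {0..T})"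
    unfolding f_def
  proof (rule tint_has_vector_derivative[OF _ _ _ t, where f' = "\<lambda>r x. udt e r x * cnj (ud e t x)"])
    show "((\<lambda>s. ud e s x * cnj (ud e t x)) has_vector_derivative udt e r x * cnj (ud e t x)) (at r within {0..T})"
      if "r \<in> {0..T}" for r x by (rule has_vector_derivative_mult_left[OF deriv_ud[OF e that]])
    show "continuous_on UNIV (\<lambda>x. ud e r x * cnj (ud e t x))" if "r \<in> {0..T}" for r
      using that e t by (intro continuous_intros slice_ud)
    show "continuous_on ({0..T} \<times> UNIV) (\<lambda>(r, x). udt e r x * cnj (ud e t x))"
      unfolding case_prod_unfold by (intro continuous_intros e sl)
  qed
  moreover have "((\<lambda>s. tint \<gamma> (\<lambda>x. u s x * cnj (udd e t x))) has_vector_derivative tint \<gamma> (\<lambda>x. ut t x * cnj (udd e t x))) (at t within {0..T})"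
  proof (rule tint_has_vector_derivative[OF _ _ _ t, where f' = "\<lambda>r x. ut r x * cnj (udd e t x)"])
    show "((\<lambda>s. u s x * cnj (udd e t x)) has_vector_derivative ut r x * cnj (udd e t x)) (at r within {0..T})"
      if "r \<in> {0..T}" for r x by (rule has_vector_derivative_mult_left[OF deriv_u[OF that]])
    show "continuous_on UNIV (\<lambda>x. u r x * cnj (udd e t x))" if "r \<in> {0..T}" for r
      using that e t by (intro continuous_intros slice_u slice_udd)
    show "continuous_on ({0..T} \<times> UNIV) (\<lambda>(r, x). ut r x * cnj (udd e t x))"
      unfolding case_prod_unfold by (intro continuous_intros sl)
  qed
  then have d: "((\<lambda>s. - tint \<gamma> (\<lambda>x. u s x * cnj (udd e t x))) has_vector_derivative - tint \<gamma> (\<lambda>x. ut t x * cnj (udd e t x))) (at t within {0..T})"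
    by (rule has_vector_derivative_minus)
  have "(f has_vector_derivative - tint \<gamma> (\<lambda>x. ut t x * cnj (udd e t x))) (at t within {0..T})"
  proof (rule has_vector_derivative_transform[OF t _ d])
    fix s assume s: "s \<in> {0..T}"
    show "f s = - tint \<gamma> (\<lambda>x. u s x * cnj (udd e t x))"
      unfolding f_def
      by (rule tint_by_parts[OF gamma_pos e along_u[OF e s] along_ud[OF e t]])
        (auto intro: slice_u slice_ud slice_udd periodic periodic_ud e t s)
  qed
  ultimately show ?thesis
    using vector_derivative_unique_within_closed_interval[of 0 T t f] t T_pos by simp
qed

text \<open>
  The derivative is the integral of \<open>2 Re(u\<^sub>t cnj(\<mu>|u|\<^sup>2u - \<Delta>u)) = 2 Re(u\<^sub>t
  cnj(i u\<^sub>t)) = 0\<close>.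
\<close>

lemma energy_conserved:
  assumes "t \<in> {0..T}"
  shows "kinetic t + \<mu> / 2 * quartic t = kinetic 0 + \<mu> / 2 * quartic 0"
proof (rule constant_of_zero_derivative[OF _ assms, of "\<lambda>t. kinetic t + \<mu> / 2 * quartic t"])
  fix t assume t: "t \<in> {0..T}"
  have tRe: "tint \<gamma> (\<lambda>x. c * Re (f x)) = c * Re (tint \<gamma> f)" if "continuous_on UNIV f" for c f
    using tint_linear[OF bounded_linear_Re that] tint_cmult_real[of "\<lambda>x. Re (f x)" \<gamma> c] continuous_on_Re[OF that] by simp
  have kin: "((\<lambda>t. tint \<gamma> (\<lambda>x. (norm (ud e t x))\<^sup>2)) has_vector_derivative tint \<gamma> (\<lambda>x. - 2 * Re (ut t x * cnj (udd e t x)))) (at t within {0..T})"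
    if e: "e \<in> Basis" for e
  proof -
    have "((\<lambda>t. tint \<gamma> (\<lambda>x. (norm (ud e t x))\<^sup>2)) has_vector_derivative tint \<gamma> (\<lambda>x. 2 * Re (udt e t x * cnj (ud e t x)))) (at t within {0..T})"
    proof (rule tint_has_vector_derivative[OF _ _ _ t])
      show "((\<lambda>s. (norm (ud e s x))\<^sup>2) has_vector_derivative 2 * Re (udt e t x * cnj (ud e t x))) (at t within {0..T})"
        if "t \<in> {0..T}" for t x by (rule has_vector_derivative_norm_squared[OF deriv_ud[OF e that]])
      show "continuous_on UNIV (\<lambda>x. (norm (ud e t x))\<^sup>2)" if "t \<in> {0..T}" for t
        using that e by (intro continuous_intros slice_ud)
      show "continuous_on ({0..T} \<times> UNIV) (\<lambda>(t, x). 2 * Re (udt e t x * cnj (ud e t x)))"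
        unfolding case_prod_unfold by (intro continuous_intros e)
    qed
    also have "tint \<gamma> (\<lambda>x. 2 * Re (udt e t x * cnj (ud e t x))) = 2 * Re (tint \<gamma> (\<lambda>x. udt e t x * cnj (ud e t x)))"
      using e t by (intro tRe continuous_intros slice_ud slice_udt)
    also have "\<dots> = - 2 * Re (tint \<gamma> (\<lambda>x. ut t x * cnj (udd e t x)))" by (simp add: tint_udt[OF e t])
    also have "\<dots> = tint \<gamma> (\<lambda>x. - 2 * Re (ut t x * cnj (udd e t x)))"
      using e t by (intro tRe[symmetric] continuous_intros slice_ut slice_udd)
    finally show ?thesis .
  qed
  have quart: "(quartic has_vector_derivative tint \<gamma> (\<lambda>x. 4 * (norm (u t x))\<^sup>2 * Re (ut t x * cnj (u t x)))) (at t within {0..T})"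
    unfolding quartic_def
  proof (rule tint_has_vector_derivative[OF _ _ _ t])
    show "((\<lambda>s. norm (u s x) ^ 4) has_vector_derivative 4 * (norm (u t x))\<^sup>2 * Re (ut t x * cnj (u t x))) (at t within {0..T})"
      if "t \<in> {0..T}" for t x
    proof -
      note d = has_vector_derivative_norm_squared[OF deriv_u[OF that], of x]
      have "norm (u s x) ^ 4 = (norm (u s x))\<^sup>2 * (norm (u s x))\<^sup>2" for s by (simp add: power4_eq_xxxx power2_eq_square)
      then show ?thesis using has_vector_derivative_mult[OF d d] by (simp add: algebra_simps)
    qed
    show "continuous_on UNIV (\<lambda>x. norm (u t x) ^ 4)" if "t \<in> {0..T}" for t
      using that by (intro continuous_intros slice_u)
    show "continuous_on ({0..T} \<times> UNIV) (\<lambda>(t, x). 4 * (norm (u t x))\<^sup>2 * Re (ut t x * cnj (u t x)))"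
      unfolding case_prod_unfold by (intro continuous_intros)
  qed
  have "((\<lambda>t. kinetic t + \<mu> / 2 * quartic t) has_vector_derivative
     (\<Sum>e\<in>Basis. tint \<gamma> (\<lambda>x. - 2 * Re (ut t x * cnj (udd e t x)))) + \<mu> / 2 * tint \<gamma> (\<lambda>x. 4 * (norm (u t x))\<^sup>2 * Re (ut t x * cnj (u t x)))) (at t within {0..T})"
    unfolding kinetic_def
    by (intro has_vector_derivative_add has_vector_derivative_sum kin has_vector_derivative_mult_right quart)
  also have "(\<Sum>e\<in>Basis. tint \<gamma> (\<lambda>x. - 2 * Re (ut t x * cnj (udd e t x)))) + \<mu> / 2 * tint \<gamma> (\<lambda>x. 4 * (norm (u t x))\<^sup>2 * Re (ut t x * cnj (u t x)))
     = tint \<gamma> (\<lambda>x. (\<Sum>e\<in>Basis. - 2 * Re (ut t x * cnj (udd e t x))) + \<mu> / 2 * (4 * (norm (u t x))\<^sup>2 * Re (ut t x * cnj (u t x))))"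
  proof -
    have "(\<Sum>e\<in>Basis. tint \<gamma> (\<lambda>x. - 2 * Re (ut t x * cnj (udd e t x)))) = tint \<gamma> (\<lambda>x. \<Sum>e\<in>Basis. - 2 * Re (ut t x * cnj (udd e t x)))"
      using t by (intro tint_sum[symmetric] continuous_intros slice_ut slice_udd)
    moreover have "\<mu> / 2 * tint \<gamma> (\<lambda>x. 4 * (norm (u t x))\<^sup>2 * Re (ut t x * cnj (u t x)))
        = tint \<gamma> (\<lambda>x. \<mu> / 2 * (4 * (norm (u t x))\<^sup>2 * Re (ut t x * cnj (u t x))))"
      using t by (intro tint_cmult_real[symmetric] continuous_intros slice_ut slice_u)
    ultimately show ?thesis
      using t by (simp only:) (intro tint_add[symmetric] continuous_intros slice_ut slice_udd slice_u; simp)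
  qed
  also have "(\<lambda>x. (\<Sum>e\<in>Basis. - 2 * Re (ut t x * cnj (udd e t x))) + \<mu> / 2 * (4 * (norm (u t x))\<^sup>2 * Re (ut t x * cnj (u t x)))) = (\<lambda>x. 0)"
  proof
    fix x
    have "\<i> * ut t x = nonlinearity t x - (\<Sum>e\<in>Basis. udd e t x)"
      using nls[OF t, of x] by (simp add: nonlinearity_def algebra_simps)
    then have "Re (ut t x * cnj (nonlinearity t x - (\<Sum>e\<in>Basis. udd e t x))) = Re (ut t x * cnj (\<i> * ut t x))" by simp
    also have "\<dots> = 0" by simp
    finally have z: "Re (ut t x * cnj (nonlinearity t x)) - (\<Sum>e\<in>Basis. Re (ut t x * cnj (udd e t x))) = 0"
      by (simp only: complex_cnj_diff cnj_sum right_diff_distrib sum_distrib_left minus_complex.sel Re_sum)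
    have Re_mult_real: "Re (of_real r * w) = r * Re w" for r w by simp
    have "ut t x * cnj (nonlinearity t x) = of_real (\<mu> * (norm (u t x))\<^sup>2) * (ut t x * cnj (u t x))"
      by (simp add: nonlinearity_def)
    then have "Re (ut t x * cnj (nonlinearity t x)) = \<mu> * (norm (u t x))\<^sup>2 * Re (ut t x * cnj (u t x))"
      by (simp only: Re_mult_real)
    then show "(\<Sum>e\<in>Basis. - 2 * Re (ut t x * cnj (udd e t x))) + \<mu> / 2 * (4 * (norm (u t x))\<^sup>2 * Re (ut t x * cnj (u t x))) = 0"
      using z unfolding sum_distrib_left[symmetric] by (simp add: mult.assoc)
  qed
  finally show "((\<lambda>t. kinetic t + \<mu> / 2 * quartic t) has_vector_derivative 0) (at t within {0..T})"
    by (simp add: tint_def)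
qed

text \<open>
  The potential energy is at most half of the kinetic energy plus a constant, by Ladyzhenskaya's inequality with
  small mass. So energy conservation bounds the kinetic energy for either sign of \<open>\<mu>\<close>, and
  Ladyzhenskaya's inequality returns the bound on the quartic integral.
\<close>

lemma quartic_bound:
  assumes mu: "\<bar>\<mu>\<bar> = 1" and small: "8 * mass 0 \<le> 1" and t: "t \<in> {0..T}"
  defines "c \<equiv> 1 / (2 * pi) + 1 / (2 * pi * \<gamma>)"
  shows "quartic t \<le> 2 * c\<^sup>2 * (mass 0)\<^sup>2 + 16 * mass 0 * (kinetic 0 + quartic 0 / 2 + c\<^sup>2 * (mass 0)\<^sup>2)"
proof -
  define m where "m = mass 0"
  have z: "0 \<in> {0..T}" using T_pos by simp
  have m0: "m \<ge> 0" unfolding m_def mass_def using z by (intro tint_nonneg continuous_intros slice_u) auto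
  have q0: "quartic s \<ge> 0" if "s \<in> {0..T}" for s
    unfolding quartic_def using that by (intro tint_nonneg continuous_intros slice_u) auto
  have k0: "kinetic s \<ge> 0" if "s \<in> {0..T}" for s
    unfolding kinetic_def using that by (intro sum_nonneg tint_nonneg continuous_intros slice_ud) auto
  have lad: "quartic t \<le> 2 * c\<^sup>2 * m\<^sup>2 + 8 * m * kinetic t"
    using ladyzhenskaya[OF gamma_pos along_u[OF _ t] slice_u[OF t] slice_ud[OF _ t]] mass_conserved[OF t]
    unfolding quartic_def kinetic_def m_def c_def mass_def by simp
  have "\<mu> = 1 \<or> \<mu> = -1" using mu by linarith
  then have "kinetic t \<le> kinetic 0 + quartic 0 / 2 + quartic t / 2"
    using energy_conserved[OF t] q0[OF t] q0[OF z] by auto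
  moreover have "4 * m * kinetic t \<le> kinetic t / 2"
    using mult_right_mono[OF small k0[OF t]] by (simp add: m_def)
  ultimately have "kinetic t \<le> 2 * (kinetic 0 + quartic 0 / 2 + c\<^sup>2 * m\<^sup>2)"
  proof -
    define X Y where "X = m * kinetic t" and "Y = c\<^sup>2 * m\<^sup>2"
    assume "kinetic t \<le> kinetic 0 + quartic 0 / 2 + quartic t / 2" "4 * m * kinetic t \<le> kinetic t / 2"
    moreover have "quartic t \<le> 2 * Y + 8 * X" using lad by (simp add: X_def Y_def)
    ultimately show ?thesis unfolding Y_def[symmetric] mult.assoc X_def[symmetric] by simp
  qed
  then have "8 * m * kinetic t \<le> 8 * m * (2 * (kinetic 0 + quartic 0 / 2 + c\<^sup>2 * m\<^sup>2))" using m0 by (intro mult_left_mono) auto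
  then show ?thesis using lad unfolding m_def[symmetric] by linarith
qed

end

section \<open>Cubic expansion of the flow\<close>

definition "free_wave_t \<gamma> K t = trig_poly \<gamma> K (\<lambda>k. - \<i> * of_real ((norm (freq \<gamma> k))\<^sup>2) * exp (- \<i> * of_real ((norm (freq \<gamma> k))\<^sup>2 * t)))"
definition "free_wave_d \<gamma> K e t = trig_poly \<gamma> K (\<lambda>k. exp (- \<i> * of_real ((norm (freq \<gamma> k))\<^sup>2 * t)) * (\<i> * of_real (freq \<gamma> k \<bullet> e)))"
definition "free_wave_dd \<gamma> K e t = trig_poly \<gamma> K (\<lambda>k. exp (- \<i> * of_real ((norm (freq \<gamma> k))\<^sup>2 * t)) * (\<i> * of_real (freq \<gamma> k \<bullet> e)) * (\<i> * of_real (freq \<gamma> k \<bullet> e)))"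

lemma deriv_along_trig_poly:
  "deriv_along e (trig_poly \<gamma> K c) (trig_poly \<gamma> K (\<lambda>k. c k * (\<i> * of_real (freq \<gamma> k \<bullet> e))))"
  unfolding deriv_along_def
proof
  fix z
  have "((\<lambda>s. trig_poly \<gamma> K c (z + s *\<^sub>R e)) has_derivative (\<lambda>h. trig_poly \<gamma> K (\<lambda>k. c k * (\<i> * of_real (freq \<gamma> k \<bullet> (h *\<^sub>R e)))) (z + 0 *\<^sub>R e))) (at 0)"
    by (rule has_derivative_compose[OF _ trig_poly_has_derivative, where f = "\<lambda>s. z + s *\<^sub>R e"]) (auto intro!: derivative_eq_intros)
  moreover have "trig_poly \<gamma> K (\<lambda>k. c k * (\<i> * of_real (freq \<gamma> k \<bullet> (h *\<^sub>R e)))) (z + 0 *\<^sub>R e)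
     = h *\<^sub>R trig_poly \<gamma> K (\<lambda>k. c k * (\<i> * of_real (freq \<gamma> k \<bullet> e))) z" for h
    by (simp add: trig_poly_def sum_distrib_left scaleR_conv_of_real mult_ac)
  ultimately show "((\<lambda>s. trig_poly \<gamma> K c (z + s *\<^sub>R e)) has_vector_derivative trig_poly \<gamma> K (\<lambda>k. c k * (\<i> * of_real (freq \<gamma> k \<bullet> e))) z) (at 0)"
    unfolding has_vector_derivative_def by (simp only:)
qed

lemma free_wave_deriv_along: "deriv_along e (free_wave \<gamma> K t) (free_wave_d \<gamma> K e t)"
  and free_wave_d_deriv_along: "deriv_along e (free_wave_d \<gamma> K e t) (free_wave_dd \<gamma> K e t)"
  unfolding free_wave_def free_wave_d_def free_wave_dd_def by (rule deriv_along_trig_poly)+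

lemma free_wave_deriv_time: "((\<lambda>s. free_wave \<gamma> K s x) has_vector_derivative free_wave_t \<gamma> K t x) (at t within A)"
proof -
  have e: "((\<lambda>s. exp (- \<i> * of_real (w * s))) has_vector_derivative - \<i> * of_real w * exp (- \<i> * of_real (w * t))) (at t within A)" for w
  proof -
    have "((\<lambda>z. exp (- \<i> * (of_real w * z))) has_field_derivative exp (- \<i> * (of_real w * of_real t)) * (- \<i> * of_real w)) (at (of_real t))"
      by (auto intro!: derivative_eq_intros)
    from has_vector_derivative_real_field[OF this] show ?thesis
      by (auto intro!: has_vector_derivative_at_within simp: mult_ac)
  qed
  show ?thesis
    unfolding free_wave_def free_wave_t_def trig_poly_def
    by (intro has_vector_derivative_sum has_vector_derivative_mult_left e)
qed

lemma free_wave_schroedinger: "free_wave_t \<gamma> K t x = \<i> * (\<Sum>e\<in>Basis. free_wave_dd \<gamma> K e t x)"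
proof -
  have "(norm (freq \<gamma> k))\<^sup>2 = (\<Sum>e\<in>Basis. (freq \<gamma> k \<bullet> e)\<^sup>2)" for k
    unfolding power2_norm_eq_inner by (subst euclidean_inner) (simp add: power2_eq_square)
  then have w: "of_real ((norm (freq \<gamma> k))\<^sup>2) = (\<Sum>e\<in>Basis. (complex_of_real (freq \<gamma> k \<bullet> e))\<^sup>2)" for k by simp
  show ?thesis
    unfolding free_wave_t_def free_wave_dd_def trig_poly_def w
    by (subst sum.swap) (simp add: sum_distrib_left sum_distrib_right sum_negf power2_eq_square mult_ac)
qed

lemma continuous_on_slab_trig_poly:
  assumes "\<And>k. k \<in> K \<Longrightarrow> continuous_on A (\<lambda>t. c t k)"
  shows "continuous_on (A \<times> UNIV) (\<lambda>z. trig_poly \<gamma> K (c (fst z)) (snd z))"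
proof -
  have "continuous_on (A \<times> (UNIV :: (real \<times> real) set)) (\<lambda>z. c (fst z) k)" if "k \<in> K" for k
    by (rule continuous_on_compose2[OF assms[OF that]]) (auto intro!: continuous_intros)
  then show ?thesis unfolding trig_poly_def character_def by (intro continuous_intros) auto
qed

lemma norm_free_wave_le: "norm (free_wave \<gamma> K t x) \<le> real (card K)"
proof -
  have "norm (free_wave \<gamma> K t x) \<le> (\<Sum>k\<in>K. norm (exp (- \<i> * of_real ((norm (freq \<gamma> k))\<^sup>2 * t))))"
    unfolding free_wave_def by (rule norm_trig_poly_le)
  also have "\<dots> = real (card K)" by (simp add: norm_exp_eq_Re)
  finally show ?thesis .
qed

lemma cubic_difference_bound:
  fixes a b :: complex
  shows "norm (of_real ((norm a)\<^sup>2) * a - of_real ((norm b)\<^sup>2) * b) \<le> (norm (a - b))\<^sup>2 + 3 * norm a ^ 4 + 3 * norm b ^ 4"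
proof -
  define x y where "x = norm a" and "y = norm b"
  have nn: "x \<ge> 0" "y \<ge> 0" by (auto simp: x_def y_def)
  have "of_real ((norm a)\<^sup>2) * a - of_real ((norm b)\<^sup>2) * b = of_real (x\<^sup>2) * (a - b) + of_real (x\<^sup>2 - y\<^sup>2) * b"
    by (simp add: x_def y_def algebra_simps)
  also have "norm \<dots> \<le> x\<^sup>2 * norm (a - b) + \<bar>x\<^sup>2 - y\<^sup>2\<bar> * y"
    by (rule order_trans[OF norm_triangle_ineq]) (simp add: norm_mult y_def flip: of_real_diff of_real_power)
  also have "\<bar>x\<^sup>2 - y\<^sup>2\<bar> = \<bar>x - y\<bar> * (x + y)"
  proof -
    have "x\<^sup>2 - y\<^sup>2 = (x - y) * (x + y)" by (simp add: power2_eq_square algebra_simps)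
    then show ?thesis using nn by (simp add: abs_mult)
  qed
  also have "\<bar>x - y\<bar> * (x + y) * y \<le> norm (a - b) * (x + y) * y"
    unfolding x_def y_def by (intro mult_right_mono norm_triangle_ineq3) auto
  finally have "norm (of_real ((norm a)\<^sup>2) * a - of_real ((norm b)\<^sup>2) * b) \<le> norm (a - b) * (x\<^sup>2 + (x + y) * y)"
    by (simp add: algebra_simps)
  also have "\<dots> \<le> ((norm (a - b))\<^sup>2 + (x\<^sup>2 + (x + y) * y)\<^sup>2) / 2"
    using sum_squares_bound[of "norm (a - b)" "x\<^sup>2 + (x + y) * y"] by simp
  also have "\<dots> \<le> (norm (a - b))\<^sup>2 + 3 * x ^ 4 + 3 * y ^ 4"
  proof -
    have "2 * (x * y) \<le> x\<^sup>2 + y\<^sup>2" using sum_squares_bound[of x y] by (simp add: mult.assoc)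
    then have "x\<^sup>2 + (x + y) * y \<le> 3 / 2 * (x\<^sup>2 + y\<^sup>2)" by (simp add: power2_eq_square algebra_simps)
    then have "(x\<^sup>2 + (x + y) * y)\<^sup>2 \<le> (3 / 2 * (x\<^sup>2 + y\<^sup>2))\<^sup>2" using nn by (intro power_mono) auto
    also have "\<dots> = 9 / 4 * (x ^ 4 + y ^ 4 + 2 * x\<^sup>2 * y\<^sup>2)" by (simp add: power2_eq_square power4_eq_xxxx algebra_simps)
    also have "\<dots> \<le> 9 / 4 * (2 * x ^ 4 + 2 * y ^ 4)"
      using sum_squares_bound[of "x\<^sup>2" "y\<^sup>2"] by simp
    finally have S: "(x\<^sup>2 + (x + y) * y)\<^sup>2 \<le> 9 / 2 * x ^ 4 + 9 / 2 * y ^ 4" by simp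
    define p q r s where "p = x ^ 4" and "q = y ^ 4" and "r = (norm (a - b))\<^sup>2" and "s = (x\<^sup>2 + (x + y) * y)\<^sup>2"
    have "p \<ge> 0" "q \<ge> 0" "r \<ge> 0" "s \<le> 9 / 2 * p + 9 / 2 * q" using nn S by (auto simp: p_def q_def r_def s_def)
    then have "(r + s) / 2 \<le> r + 3 * p + 3 * q" by simp
    then show ?thesis unfolding p_def q_def r_def s_def .
  qed
  finally show ?thesis by (simp add: x_def y_def)
qed

lemma deriv_along_unique: "deriv_along e f g \<Longrightarrow> deriv_along e f h \<Longrightarrow> g = h"
  unfolding deriv_along_def fun_eq_iff by (meson vector_derivative_unique_at)

lemma deriv_along_cmult: "deriv_along e f g \<Longrightarrow> deriv_along e (\<lambda>x. c * f x) (\<lambda>x. c * g x)"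
  unfolding deriv_along_def by (auto intro: has_vector_derivative_mult_right)

text \<open>
  The linear parts of the two equations cancel in the pairing, since the Laplacian is symmetric.
\<close>

lemma (in classical_nls) pairing_free_wave_derivative:
  assumes t: "t \<in> {0..T}"
  shows "((\<lambda>t. tint \<gamma> (\<lambda>x. u t x * cnj (free_wave \<gamma> K t x))) has_vector_derivative
      - \<i> * tint \<gamma> (\<lambda>x. nonlinearity t x * cnj (free_wave \<gamma> K t x))) (at t within {0..T})"
proof -
  let ?v = "free_wave \<gamma> K"
  have cv: "continuous_on UNIV (?v t)" "continuous_on UNIV (free_wave_t \<gamma> K t)"
    "continuous_on UNIV (free_wave_d \<gamma> K e t)" "continuous_on UNIV (free_wave_dd \<gamma> K e t)" for t e
    unfolding free_wave_def free_wave_t_def free_wave_d_def free_wave_dd_def by (rule continuous_on_trig_poly)+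
  have pv: "torus_periodic \<gamma> (?v t)" "torus_periodic \<gamma> (free_wave_d \<gamma> K e t)" for t e
    unfolding free_wave_def free_wave_d_def by (rule torus_periodic_trig_poly[OF gamma_pos])+
  have sv: "continuous_on ({0..T} \<times> UNIV) (\<lambda>z. ?v (fst z) (snd z))"
    "continuous_on ({0..T} \<times> UNIV) (\<lambda>z. free_wave_t \<gamma> K (fst z) (snd z))"
    unfolding free_wave_def free_wave_t_def
    by (rule continuous_on_slab_trig_poly, intro continuous_intros)+
  have "((\<lambda>t. tint \<gamma> (\<lambda>x. u t x * cnj (?v t x))) has_vector_derivative
      tint \<gamma> (\<lambda>x. u t x * cnj (free_wave_t \<gamma> K t x) + ut t x * cnj (?v t x))) (at t within {0..T})"
  proof (rule tint_has_vector_derivative[OF _ _ _ t])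
    show "((\<lambda>s. u s x * cnj (?v s x)) has_vector_derivative u t x * cnj (free_wave_t \<gamma> K t x) + ut t x * cnj (?v t x)) (at t within {0..T})"
      if "t \<in> {0..T}" for t x
      by (intro has_vector_derivative_mult deriv_u[OF that] has_vector_derivative_cnj free_wave_deriv_time)
    show "continuous_on UNIV (\<lambda>x. u t x * cnj (?v t x))" if "t \<in> {0..T}" for t
      using that by (intro continuous_intros slice_u cv)
    show "continuous_on ({0..T} \<times> UNIV) (\<lambda>(t, x). u t x * cnj (free_wave_t \<gamma> K t x) + ut t x * cnj (?v t x))"
      unfolding case_prod_unfold by (intro continuous_intros sv)
  qed
  also have "tint \<gamma> (\<lambda>x. u t x * cnj (free_wave_t \<gamma> K t x) + ut t x * cnj (?v t x))
     = tint \<gamma> (\<lambda>x. u t x * cnj (free_wave_t \<gamma> K t x)) + tint \<gamma> (\<lambda>x. ut t x * cnj (?v t x))"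
    using t by (intro tint_add continuous_intros slice_u slice_ut cv)
  also have "tint \<gamma> (\<lambda>x. u t x * cnj (free_wave_t \<gamma> K t x)) = tint \<gamma> (\<lambda>x. \<Sum>e\<in>Basis. - \<i> * (u t x * cnj (free_wave_dd \<gamma> K e t x)))"
    by (rule arg_cong[where f = "tint \<gamma>"], rule ext)
      (simp add: free_wave_schroedinger sum_distrib_left sum_negf mult_ac)
  also have "\<dots> = (\<Sum>e\<in>Basis. tint \<gamma> (\<lambda>x. - \<i> * (u t x * cnj (free_wave_dd \<gamma> K e t x))))"
    using t by (intro tint_sum continuous_intros slice_u cv)
  also have "\<dots> = (\<Sum>e\<in>Basis. \<i> * tint \<gamma> (\<lambda>x. ud e t x * cnj (free_wave_d \<gamma> K e t x)))"
  proof (rule sum.cong[OF refl])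
    fix e :: "real \<times> real" assume e: "e \<in> Basis"
    have "tint \<gamma> (\<lambda>x. - \<i> * (u t x * cnj (free_wave_dd \<gamma> K e t x))) = - \<i> * tint \<gamma> (\<lambda>x. u t x * cnj (free_wave_dd \<gamma> K e t x))"
      using t by (intro tint_cmult continuous_intros slice_u cv)
    also have "tint \<gamma> (\<lambda>x. u t x * cnj (free_wave_dd \<gamma> K e t x)) = - tint \<gamma> (\<lambda>x. ud e t x * cnj (free_wave_d \<gamma> K e t x))"
      using tint_by_parts[OF gamma_pos e along_u[OF e t] free_wave_d_deriv_along slice_u[OF t] slice_ud[OF e t] cv(3) cv(4) periodic[OF t] pv(2)]
      by simp
    finally show "tint \<gamma> (\<lambda>x. - \<i> * (u t x * cnj (free_wave_dd \<gamma> K e t x))) = \<i> * tint \<gamma> (\<lambda>x. ud e t x * cnj (free_wave_d \<gamma> K e t x))" by simp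
  qed
  also have "tint \<gamma> (\<lambda>x. ut t x * cnj (?v t x)) =
     - \<i> * (\<Sum>e\<in>Basis. tint \<gamma> (\<lambda>x. ud e t x * cnj (free_wave_d \<gamma> K e t x))) - \<i> * tint \<gamma> (\<lambda>x. nonlinearity t x * cnj (?v t x))"
    using t by (intro tint_ut free_wave_deriv_along pv cv)
  finally show ?thesis by (simp add: sum_distrib_left sum_negf)
qed

text \<open>
  The bound \<open>\<integral>|u|\<^sup>4 \<le> A\<delta>\<^sup>4\<close> is combined with conservation of mass.
  The derivative of \<open>P(t) = \<langle>u(t), v(t)\<rangle>\<close> is \<open>-i \<langle>\<mu>|u|\<^sup>2u,
  v\<rangle>\<close>, hence \<open>O(\<delta>\<^sup>3)\<close>. As both masses are constant, \<open>\<parallel>u -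
  \<delta>v\<parallel>\<^sup>2 = 2\<delta> Re(P(0) - P(t)) = O(\<delta>\<^sup>4)\<close>. So \<open>u\<close> may
  be replaced by \<open>\<delta>v\<close> in the derivative of \<open>P\<close> at the cost of
  \<open>O(\<delta>\<^sup>4)\<close>.
\<close>

lemma (in classical_nls) first_order_bounds:
  fixes \<delta> A :: real and K :: "(int \<times> int) set"
  defines "v \<equiv> free_wave \<gamma> K" and "V \<equiv> real (card K)" and "M \<equiv> 4 * pi\<^sup>2 * \<gamma> * real (card K)"
  assumes K: "finite K" and mu: "\<bar>\<mu>\<bar> = 1" and \<delta>: "0 < \<delta>"
    and init: "u 0 = (\<lambda>x. of_real \<delta> * v 0 x)"
    and quart: "\<And>t. t \<in> {0..T} \<Longrightarrow> quartic t \<le> A * \<delta> ^ 4" and A: "A \<ge> 0"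
  defines "X \<equiv> integral {0..T} (\<lambda>t. tint \<gamma> (\<lambda>x. norm (v t x) ^ 4))"
  defines "D \<equiv> T * (V * (M + A) / 2)"
  shows "\<bar>- \<mu> * Im (tint \<gamma> (\<lambda>x. u T x * cnj (v T x))) - X * \<delta> ^ 3\<bar> \<le> T * (V * (2 * D + 3 * A + 3 * (V\<^sup>2 * M))) * \<delta> ^ 4"
proof -
  define P where "P t = tint \<gamma> (\<lambda>x. u t x * cnj (v t x))" for t
  define N where "N t = tint \<gamma> (\<lambda>x. nonlinearity t x * cnj (v t x))" for t
  have V0: "V \<ge> 0" by (simp add: V_def)
  have M0: "M \<ge> 0" using gamma_pos by (simp add: M_def)
  have cv: "continuous_on UNIV (v t)" for t unfolding v_def free_wave_def by (rule continuous_on_trig_poly)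
  have vM: "tint \<gamma> (\<lambda>x. (norm (v t x))\<^sup>2) = M" for t
    unfolding v_def M_def by (rule tint_norm_free_wave_squared[OF gamma_pos K])
  have vV: "norm (v t x) \<le> V" for t x unfolding v_def V_def by (rule norm_free_wave_le)
  have z: "0 \<in> {0..T}" using T_pos by simp
  have mass: "mass t = \<delta>\<^sup>2 * M" if t: "t \<in> {0..T}" for t
  proof -
    have "mass t = tint \<gamma> (\<lambda>x. \<delta>\<^sup>2 * (norm (v 0 x))\<^sup>2)"
      unfolding mass_conserved[OF t] unfolding mass_def init using \<delta> by (simp add: norm_mult power_mult_distrib)
    also have "\<dots> = \<delta>\<^sup>2 * M" unfolding vM[of 0, symmetric] by (intro tint_cmult_real continuous_intros cv)
    finally show ?thesis .
  qed
  have norm_N: "norm (nonlinearity t x) = norm (u t x) ^ 3" for t x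
    using mu by (simp add: nonlinearity_def norm_mult norm_power power3_eq_cube power2_eq_square)
  have Nbound: "norm (N t) \<le> V * (M + A) / 2 * \<delta> ^ 3" if t: "t \<in> {0..T}" for t
  proof -
    have "norm (N t) \<le> tint \<gamma> (\<lambda>x. (V * \<delta> / 2) * (norm (u t x))\<^sup>2 + (V / (2 * \<delta>)) * norm (u t x) ^ 4)"
      unfolding N_def
    proof (rule norm_tint_le)
      show "continuous_on UNIV (\<lambda>x. nonlinearity t x * cnj (v t x))" using t by (intro continuous_intros slice_nonlinearity cv)
      show "continuous_on UNIV (\<lambda>x. (V * \<delta> / 2) * (norm (u t x))\<^sup>2 + (V / (2 * \<delta>)) * norm (u t x) ^ 4)"
        using t by (intro continuous_intros slice_u)
      fix x
      define a where "a = norm (u t x)"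
      \<comment> \<open>the weight \<open>\<delta>\<close> balances \<open>\<integral>|u|\<^sup>2 = O(\<delta>\<^sup>2)\<close> against \<open>\<integral>|u|\<^sup>4 = O(\<delta>\<^sup>4)\<close>\<close>
      have "2 * (\<delta> * a) \<le> \<delta>\<^sup>2 + a\<^sup>2" using sum_squares_bound[of \<delta> a] by (simp add: mult.assoc)
      then have "2 * (\<delta> * a) * a\<^sup>2 \<le> (\<delta>\<^sup>2 + a\<^sup>2) * a\<^sup>2" by (intro mult_right_mono) auto
      then have a3: "a ^ 3 \<le> \<delta> / 2 * a\<^sup>2 + 1 / (2 * \<delta>) * a ^ 4"
        using \<delta> by (simp add: field_simps power2_eq_square power3_eq_cube power4_eq_xxxx)
      have "norm (nonlinearity t x * cnj (v t x)) = a ^ 3 * norm (v t x)" by (simp add: norm_mult norm_N a_def)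
      also have "\<dots> \<le> a ^ 3 * V" by (intro mult_left_mono vV) (simp add: a_def)
      also have "\<dots> \<le> (\<delta> / 2 * a\<^sup>2 + 1 / (2 * \<delta>) * a ^ 4) * V" using a3 V0 by (rule mult_right_mono)
      finally show "norm (nonlinearity t x * cnj (v t x)) \<le> (V * \<delta> / 2) * (norm (u t x))\<^sup>2 + (V / (2 * \<delta>)) * norm (u t x) ^ 4"
        by (simp add: a_def algebra_simps)
    qed
    also have "\<dots> = (V * \<delta> / 2) * mass t + (V / (2 * \<delta>)) * quartic t"
    proof -
      have "tint \<gamma> (\<lambda>x. (V * \<delta> / 2) * (norm (u t x))\<^sup>2) = (V * \<delta> / 2) * mass t"
        unfolding mass_def using t by (intro tint_cmult_real continuous_intros slice_u)
      moreover have "tint \<gamma> (\<lambda>x. (V / (2 * \<delta>)) * norm (u t x) ^ 4) = (V / (2 * \<delta>)) * quartic t"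
        unfolding quartic_def using t by (intro tint_cmult_real continuous_intros slice_u)
      moreover have "tint \<gamma> (\<lambda>x. (V * \<delta> / 2) * (norm (u t x))\<^sup>2 + (V / (2 * \<delta>)) * norm (u t x) ^ 4)
        = tint \<gamma> (\<lambda>x. (V * \<delta> / 2) * (norm (u t x))\<^sup>2) + tint \<gamma> (\<lambda>x. (V / (2 * \<delta>)) * norm (u t x) ^ 4)"
        using t by (intro tint_add continuous_intros slice_u)
      ultimately show ?thesis by simp
    qed
    also have "\<dots> \<le> (V * \<delta> / 2) * (\<delta>\<^sup>2 * M) + (V / (2 * \<delta>)) * (A * \<delta> ^ 4)"
      using quart[OF t] mass[OF t] V0 \<delta> by (intro add_mono mult_left_mono) auto
    also have "\<dots> = V * (M + A) / 2 * \<delta> ^ 3"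
      using \<delta> by (simp add: field_simps power2_eq_square power3_eq_cube power4_eq_xxxx)
    finally show ?thesis .
  qed
  have FTC: "((\<lambda>t. - \<i> * N t) has_integral P t1 - P 0) {0..t1}" if t1: "t1 \<in> {0..T}" for t1
  proof (rule fundamental_theorem_of_calculus)
    show "0 \<le> t1" using t1 by simp
    fix t assume "t \<in> {0..t1}"
    then have t: "t \<in> {0..T}" and sub: "{0..t1} \<subseteq> {0..T}" using t1 by auto
    show "(P has_vector_derivative - \<i> * N t) (at t within {0..t1})"
      unfolding P_def[abs_def] N_def v_def
      by (rule has_vector_derivative_within_subset[OF pairing_free_wave_derivative[OF t] sub])
  qed
  have P0: "P 0 = of_real (\<delta> * M)"
  proof -
    have "P 0 = tint \<gamma> (\<lambda>x. of_real (\<delta> * (norm (v 0 x))\<^sup>2))"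
      unfolding P_def init by (simp only: mult.assoc complex_norm_square[symmetric] of_real_mult)
    also have "\<dots> = of_real (tint \<gamma> (\<lambda>x. \<delta> * (norm (v 0 x))\<^sup>2))" by (intro tint_of_real continuous_intros cv)
    also have "tint \<gamma> (\<lambda>x. \<delta> * (norm (v 0 x))\<^sup>2) = \<delta> * M" unfolding vM[of 0, symmetric] by (intro tint_cmult_real continuous_intros cv)
    finally show ?thesis .
  qed
  have Pdiff: "norm (P t1 - P 0) \<le> D * \<delta> ^ 3" if t1: "t1 \<in> {0..T}" for t1
  proof -
    define B where "B = V * (M + A) / 2 * \<delta> ^ 3"
    have B0: "B \<ge> 0" unfolding B_def using V0 M0 A \<delta> by simp
    have "norm (P t1 - P 0) \<le> B * measure lborel (cbox 0 t1)"
    proof (rule has_integral_bound[OF B0])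
      show "((\<lambda>t. - \<i> * N t) has_integral P t1 - P 0) (cbox 0 t1)" using FTC[OF t1] by simp
      show "norm (- \<i> * N t) \<le> B" if "t \<in> cbox 0 t1" for t
        using Nbound[of t] that t1 by (simp add: B_def norm_mult)
    qed
    also have "\<dots> \<le> B * T" using t1 B0 by (intro mult_left_mono) auto
    finally show ?thesis by (simp add: B_def D_def mult_ac)
  qed
  have close: "tint \<gamma> (\<lambda>x. (norm (u t x - of_real \<delta> * v t x))\<^sup>2) \<le> 2 * D * \<delta> ^ 4" if t: "t \<in> {0..T}" for t
  proof -
    have "(norm (u t x - of_real \<delta> * v t x))\<^sup>2 = (norm (u t x))\<^sup>2 + \<delta>\<^sup>2 * (norm (v t x))\<^sup>2 + (- 2 * \<delta>) * Re (u t x * cnj (v t x))" for x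
      unfolding cmod_power2 by (simp add: power2_eq_square algebra_simps)
    then have "tint \<gamma> (\<lambda>x. (norm (u t x - of_real \<delta> * v t x))\<^sup>2)
       = tint \<gamma> (\<lambda>x. (norm (u t x))\<^sup>2 + \<delta>\<^sup>2 * (norm (v t x))\<^sup>2 + (- 2 * \<delta>) * Re (u t x * cnj (v t x)))" by simp
    also have "\<dots> = tint \<gamma> (\<lambda>x. (norm (u t x))\<^sup>2 + \<delta>\<^sup>2 * (norm (v t x))\<^sup>2) + tint \<gamma> (\<lambda>x. (- 2 * \<delta>) * Re (u t x * cnj (v t x)))"
      using t by (intro tint_add continuous_intros slice_u cv)
    also have "tint \<gamma> (\<lambda>x. (norm (u t x))\<^sup>2 + \<delta>\<^sup>2 * (norm (v t x))\<^sup>2) = mass t + tint \<gamma> (\<lambda>x. \<delta>\<^sup>2 * (norm (v t x))\<^sup>2)"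
      unfolding mass_def using t by (intro tint_add continuous_intros slice_u cv)
    also have "tint \<gamma> (\<lambda>x. \<delta>\<^sup>2 * (norm (v t x))\<^sup>2) = \<delta>\<^sup>2 * M"
      unfolding vM[of t, symmetric] by (intro tint_cmult_real continuous_intros cv)
    also have "tint \<gamma> (\<lambda>x. (- 2 * \<delta>) * Re (u t x * cnj (v t x))) = (- 2 * \<delta>) * tint \<gamma> (\<lambda>x. Re (u t x * cnj (v t x)))"
      using t by (intro tint_cmult_real continuous_intros slice_u cv)
    also have "tint \<gamma> (\<lambda>x. Re (u t x * cnj (v t x))) = Re (P t)"
      unfolding P_def using t by (intro tint_linear[OF bounded_linear_Re] continuous_intros slice_u cv)
    also have "mass t = \<delta>\<^sup>2 * M" by (rule mass[OF t])
    also have "\<delta>\<^sup>2 * M + \<delta>\<^sup>2 * M + - 2 * \<delta> * Re (P t) = 2 * \<delta> * Re (P 0 - P t)"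
      by (simp add: P0 power2_eq_square algebra_simps)
    also have "\<dots> \<le> 2 * \<delta> * (D * \<delta> ^ 3)"
      using order_trans[OF complex_Re_le_cmod[of "P 0 - P t"], of "D * \<delta> ^ 3"] Pdiff[OF t] \<delta>
      by (intro mult_left_mono) (auto simp: norm_minus_commute)
    finally show ?thesis by (simp add: power4_eq_xxxx power3_eq_cube mult_ac)
  qed
  define Q where "Q t = tint \<gamma> (\<lambda>x. norm (v t x) ^ 4)" for t
  have Qle: "Q t \<le> V\<^sup>2 * M" for t
  proof -
    have "Q t \<le> tint \<gamma> (\<lambda>x. V\<^sup>2 * (norm (v t x))\<^sup>2)"
      unfolding Q_def
    proof (rule tint_mono)
      fix x
      have "(norm (v t x))\<^sup>2 \<le> V\<^sup>2" using vV by (intro power_mono) auto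
      then have "(norm (v t x))\<^sup>2 * (norm (v t x))\<^sup>2 \<le> V\<^sup>2 * (norm (v t x))\<^sup>2" by (intro mult_right_mono) auto
      then show "norm (v t x) ^ 4 \<le> V\<^sup>2 * (norm (v t x))\<^sup>2" by (simp add: power4_eq_xxxx power2_eq_square mult_ac)
    qed (intro continuous_intros cv)+
    also have "\<dots> = V\<^sup>2 * M" unfolding vM[of t, symmetric] by (intro tint_cmult_real continuous_intros cv)
    finally show ?thesis .
  qed
  define B2 where "B2 = V * (2 * D + 3 * A + 3 * (V\<^sup>2 * M)) * \<delta> ^ 4"
  have D0: "D \<ge> 0" using T_pos V0 M0 A by (simp add: D_def)
  have B20: "B2 \<ge> 0" unfolding B2_def using V0 M0 A D0 \<delta> by simp
  have Ndiff: "norm (N t - of_real (\<mu> * \<delta> ^ 3 * Q t)) \<le> B2" if t: "t \<in> {0..T}" for t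
  proof -
    define w where "w x = of_real \<delta> * v t x" for x
    define F where "F x = of_real \<mu> * ((of_real ((norm (u t x))\<^sup>2) * u t x - of_real ((norm (w x))\<^sup>2) * w x) * cnj (v t x))" for x
    have cw: "continuous_on UNIV w" unfolding w_def by (intro continuous_intros cv)
    have cF: "continuous_on UNIV F" unfolding F_def using t by (intro continuous_intros slice_u cw cv)
    have "complex_of_real (\<mu> * \<delta> ^ 3 * Q t) = tint \<gamma> (\<lambda>x. of_real (\<mu> * \<delta> ^ 3 * norm (v t x) ^ 4))"
    proof -
      have "\<mu> * \<delta> ^ 3 * Q t = tint \<gamma> (\<lambda>x. \<mu> * \<delta> ^ 3 * norm (v t x) ^ 4)"
        unfolding Q_def by (intro tint_cmult_real[symmetric] continuous_intros cv)
      then show ?thesis by (simp only:) (intro tint_of_real[symmetric] continuous_intros cv)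
    qed
    then have "N t - of_real (\<mu> * \<delta> ^ 3 * Q t) = tint \<gamma> (\<lambda>x. nonlinearity t x * cnj (v t x) - of_real (\<mu> * \<delta> ^ 3 * norm (v t x) ^ 4))"
      unfolding N_def using t by (simp only:) (intro tint_diff[symmetric] continuous_intros slice_nonlinearity cv)
    also have "(\<lambda>x. nonlinearity t x * cnj (v t x) - of_real (\<mu> * \<delta> ^ 3 * norm (v t x) ^ 4)) = F"
    proof
      fix x
      have "of_real ((norm (w x))\<^sup>2) * w x * cnj (v t x) = of_real (\<delta>\<^sup>2 * (norm (v t x))\<^sup>2 * \<delta>) * (v t x * cnj (v t x))"
        unfolding w_def using \<delta> by (simp add: norm_mult power_mult_distrib mult_ac)
      also have "\<dots> = of_real (\<delta>\<^sup>2 * (norm (v t x))\<^sup>2 * \<delta> * (norm (v t x))\<^sup>2)"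
        unfolding complex_norm_square[symmetric] by simp
      also have "\<delta>\<^sup>2 * (norm (v t x))\<^sup>2 * \<delta> * (norm (v t x))\<^sup>2 = \<delta> ^ 3 * norm (v t x) ^ 4"
        by (simp add: power4_eq_xxxx power3_eq_cube power2_eq_square mult_ac)
      finally have "of_real ((norm (w x))\<^sup>2) * w x * cnj (v t x) = of_real (\<delta> ^ 3 * norm (v t x) ^ 4)" .
      then show "nonlinearity t x * cnj (v t x) - of_real (\<mu> * \<delta> ^ 3 * norm (v t x) ^ 4) = F x"
        unfolding F_def nonlinearity_def left_diff_distrib right_diff_distrib by (simp add: mult.assoc)
    qed
    also have "norm (tint \<gamma> F) \<le> tint \<gamma> (\<lambda>x. V * ((norm (u t x - w x))\<^sup>2 + (3 * norm (u t x) ^ 4 + (3 * \<delta> ^ 4) * norm (v t x) ^ 4)))"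
    proof (rule norm_tint_le[OF cF])
      show "continuous_on UNIV (\<lambda>x. V * ((norm (u t x - w x))\<^sup>2 + (3 * norm (u t x) ^ 4 + (3 * \<delta> ^ 4) * norm (v t x) ^ 4)))"
        using t by (intro continuous_intros slice_u cw cv)
      fix x
      have "norm (F x) = norm (of_real ((norm (u t x))\<^sup>2) * u t x - of_real ((norm (w x))\<^sup>2) * w x) * norm (v t x)"
        unfolding F_def using mu by (simp add: norm_mult)
      also have "\<dots> \<le> ((norm (u t x - w x))\<^sup>2 + 3 * norm (u t x) ^ 4 + 3 * norm (w x) ^ 4) * V"
        by (intro mult_mono cubic_difference_bound vV) auto
      also have "norm (w x) ^ 4 = \<delta> ^ 4 * norm (v t x) ^ 4" unfolding w_def using \<delta> by (simp add: norm_mult power_mult_distrib)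
      finally show "norm (F x) \<le> V * ((norm (u t x - w x))\<^sup>2 + (3 * norm (u t x) ^ 4 + (3 * \<delta> ^ 4) * norm (v t x) ^ 4))"
        by (simp add: algebra_simps)
    qed
    also have "\<dots> = V * (tint \<gamma> (\<lambda>x. (norm (u t x - w x))\<^sup>2) + (3 * quartic t + 3 * \<delta> ^ 4 * Q t))"
    proof -
      have "tint \<gamma> (\<lambda>x. 3 * norm (u t x) ^ 4) = 3 * quartic t"
        unfolding quartic_def using t by (intro tint_cmult_real continuous_intros slice_u)
      moreover have "tint \<gamma> (\<lambda>x. (3 * \<delta> ^ 4) * norm (v t x) ^ 4) = 3 * \<delta> ^ 4 * Q t"
        unfolding Q_def by (intro tint_cmult_real continuous_intros cv)
      moreover have "tint \<gamma> (\<lambda>x. 3 * norm (u t x) ^ 4 + (3 * \<delta> ^ 4) * norm (v t x) ^ 4)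
         = tint \<gamma> (\<lambda>x. 3 * norm (u t x) ^ 4) + tint \<gamma> (\<lambda>x. (3 * \<delta> ^ 4) * norm (v t x) ^ 4)"
        using t by (intro tint_add continuous_intros slice_u cv)
      moreover have "tint \<gamma> (\<lambda>x. (norm (u t x - w x))\<^sup>2 + (3 * norm (u t x) ^ 4 + (3 * \<delta> ^ 4) * norm (v t x) ^ 4))
         = tint \<gamma> (\<lambda>x. (norm (u t x - w x))\<^sup>2) + tint \<gamma> (\<lambda>x. 3 * norm (u t x) ^ 4 + (3 * \<delta> ^ 4) * norm (v t x) ^ 4)"
        using t by (intro tint_add continuous_intros slice_u cv cw)
      moreover have "tint \<gamma> (\<lambda>x. V * ((norm (u t x - w x))\<^sup>2 + (3 * norm (u t x) ^ 4 + (3 * \<delta> ^ 4) * norm (v t x) ^ 4)))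
         = V * tint \<gamma> (\<lambda>x. (norm (u t x - w x))\<^sup>2 + (3 * norm (u t x) ^ 4 + (3 * \<delta> ^ 4) * norm (v t x) ^ 4))"
        using t by (intro tint_cmult_real continuous_intros slice_u cv cw)
      ultimately show ?thesis by simp
    qed
    also have "\<dots> \<le> V * (2 * D * \<delta> ^ 4 + (3 * (A * \<delta> ^ 4) + 3 * \<delta> ^ 4 * (V\<^sup>2 * M)))"
      using close[OF t] quart[OF t] Qle[of t] \<delta> V0 unfolding w_def by (intro mult_left_mono add_mono) auto
    also have "\<dots> = B2" by (simp add: B2_def algebra_simps)
    finally show ?thesis .
  qed
  have Tin: "T \<in> {0..T}" using T_pos by simp
  have Qint: "(Q has_integral X) {0..T}"
    unfolding X_def Q_def[symmetric, abs_def] unfolding Q_def[abs_def] v_def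
    by (intro integrable_integral integrable_continuous_real continuous_on_tint_free_wave gamma_pos K)
  have "((\<lambda>t. - \<i> * of_real (\<mu> * \<delta> ^ 3 * Q t)) has_integral - \<i> * of_real (\<mu> * \<delta> ^ 3 * X)) {0..T}"
    by (intro has_integral_mult_right has_integral_of_real Qint)
  from has_integral_diff[OF FTC[OF Tin] this]
  have "((\<lambda>t. - \<i> * (N t - of_real (\<mu> * \<delta> ^ 3 * Q t))) has_integral P T - P 0 + \<i> * of_real (\<mu> * \<delta> ^ 3 * X)) {0..T}"
    by (simp add: right_diff_distrib)
  then have "norm (P T - P 0 + \<i> * of_real (\<mu> * \<delta> ^ 3 * X)) \<le> B2 * measure lborel (cbox 0 T)"
    using Ndiff by (intro has_integral_bound[OF B20]) (auto simp: norm_mult)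
  then have "norm (P T - P 0 + \<i> * of_real (\<mu> * \<delta> ^ 3 * X)) \<le> B2 * T" using T_pos by simp
  moreover have "Im (P T - P 0 + \<i> * of_real (\<mu> * \<delta> ^ 3 * X)) = Im (P T) + \<mu> * \<delta> ^ 3 * X" by (simp add: P0)
  ultimately have Im: "\<bar>Im (P T) + \<mu> * \<delta> ^ 3 * X\<bar> \<le> B2 * T"
    using abs_Im_le_cmod[of "P T - P 0 + \<i> * of_real (\<mu> * \<delta> ^ 3 * X)"] by simp
  have "\<mu> = 1 \<or> \<mu> = -1" using mu by linarith
  then have "- \<mu> * Im (P T) - X * \<delta> ^ 3 = - \<mu> * (Im (P T) + \<mu> * \<delta> ^ 3 * X)" by auto
  then have "\<bar>- \<mu> * Im (P T) - X * \<delta> ^ 3\<bar> = \<bar>Im (P T) + \<mu> * \<delta> ^ 3 * X\<bar>" using mu by (simp only: abs_mult abs_minus_cancel mult_1)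
  then show ?thesis using Im unfolding P_def B2_def by (simp add: mult_ac)
qed

text \<open>
  The initial mass, kinetic energy and quartic integral are those of the wave multiplied by
  \<open>\<delta>\<^sup>2\<close>, \<open>\<delta>\<^sup>2\<close> and \<open>\<delta>\<^sup>4\<close>. So
  \<open>quartic_bound\<close> provides the hypothesis of \<open>first_order_bounds\<close> with a constant that
  depends on the wave only.
\<close>

lemma nls_cubic_expansion:
  assumes \<gamma>: "\<gamma> > 0" and T: "T > 0" and K: "finite K" and mu: "\<bar>\<mu>\<bar> = 1"
  shows "\<exists>C d. d > 0 \<and> (\<forall>\<delta> u. 0 < \<delta> \<longrightarrow> \<delta> < d \<longrightarrow> nls_smooth_solution \<gamma> \<mu> T (\<lambda>x. of_real \<delta> * free_wave \<gamma> K 0 x) u \<longrightarrow>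
    \<bar>- \<mu> * Im (tint \<gamma> (\<lambda>x. u T x * cnj (free_wave \<gamma> K T x)))
      - integral {0..T} (\<lambda>t. tint \<gamma> (\<lambda>x. norm (free_wave \<gamma> K t x) ^ 4)) * \<delta> ^ 3\<bar> \<le> C * \<delta> ^ 4)"
proof -
  define V M where "V = real (card K)" and "M = 4 * pi\<^sup>2 * \<gamma> * real (card K)"
  define \<kappa> where "\<kappa> = (\<Sum>e\<in>Basis. tint \<gamma> (\<lambda>x. (norm (free_wave_d \<gamma> K e 0 x))\<^sup>2))"
  define q where "q = tint \<gamma> (\<lambda>x. norm (free_wave \<gamma> K 0 x) ^ 4)"
  define c where "c = 1 / (2 * pi) + 1 / (2 * pi * \<gamma>)"
  define A where "A = 2 * c\<^sup>2 * M\<^sup>2 + 16 * M * (\<kappa> + q / 2 + c\<^sup>2 * M\<^sup>2)"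
  define D where "D = T * (V * (M + A) / 2)"
  \<comment> \<open>small enough for the mass to satisfy the hypothesis of \<open>quartic_bound\<close>\<close>
  define d where "d = min 1 (1 / (8 * M + 1))"
  have cv: "continuous_on UNIV (free_wave \<gamma> K 0)" and cvd: "\<And>e. continuous_on UNIV (free_wave_d \<gamma> K e 0)"
    unfolding free_wave_def free_wave_d_def by (rule continuous_on_trig_poly)+
  have M0: "M \<ge> 0" using \<gamma> by (simp add: M_def)
  have k0: "\<kappa> \<ge> 0" unfolding \<kappa>_def by (intro sum_nonneg tint_nonneg continuous_intros cvd) auto
  have q0: "q \<ge> 0" unfolding q_def by (intro tint_nonneg continuous_intros cv) auto
  have A0: "A \<ge> 0" unfolding A_def using M0 k0 q0 by simp
  have d: "d > 0" using M0 by (simp add: d_def)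
  show ?thesis
  proof (rule exI[of _ "T * (V * (2 * D + 3 * A + 3 * (V\<^sup>2 * M)))"], rule exI[of _ d], intro conjI d allI impI)
    fix \<delta> u assume \<delta>: "0 < \<delta>" "\<delta> < d" and sol: "nls_smooth_solution \<gamma> \<mu> T (\<lambda>x. of_real \<delta> * free_wave \<gamma> K 0 x) u"
    obtain ut ud udd udt where "classical_nls \<gamma> \<mu> T u ut ud udd udt"
      using nls_smooth_solution_classical[OF \<gamma> T sol] by blast
    then interpret classical_nls \<gamma> \<mu> T u ut ud udd udt .
    have init: "u 0 = (\<lambda>x. of_real \<delta> * free_wave \<gamma> K 0 x)" using sol by (simp add: nls_smooth_solution_def)
    have z: "0 \<in> {0..T}" using T by simp
    have "\<delta> < 1" "\<delta> < 1 / (8 * M + 1)" using \<delta> by (simp_all add: d_def)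
    then have \<delta>1: "\<delta> \<le> 1" "\<delta> * (8 * M + 1) \<le> 1" using M0 by (simp_all add: pos_less_divide_eq less_imp_le)
    have d2: "\<delta>\<^sup>2 \<le> \<delta>" "\<delta>\<^sup>2 \<le> 1" using \<delta> \<delta>1 by (auto simp: power2_eq_square mult_le_one)
    have m: "mass 0 = \<delta>\<^sup>2 * M"
    proof -
      have "mass 0 = tint \<gamma> (\<lambda>x. \<delta>\<^sup>2 * (norm (free_wave \<gamma> K 0 x))\<^sup>2)"
        unfolding mass_def init using \<delta> by (simp add: norm_mult power_mult_distrib)
      also have "\<dots> = \<delta>\<^sup>2 * M"
        unfolding M_def tint_norm_free_wave_squared[OF \<gamma> K, of 0, symmetric] by (intro tint_cmult_real continuous_intros cv)
      finally show ?thesis .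
    qed
    have quart0: "quartic 0 = \<delta> ^ 4 * q"
    proof -
      have "quartic 0 = tint \<gamma> (\<lambda>x. \<delta> ^ 4 * norm (free_wave \<gamma> K 0 x) ^ 4)"
        unfolding quartic_def init using \<delta> by (simp add: norm_mult power_mult_distrib)
      also have "\<dots> = \<delta> ^ 4 * q" unfolding q_def by (intro tint_cmult_real continuous_intros cv)
      finally show ?thesis .
    qed
    have kin0: "kinetic 0 = \<delta>\<^sup>2 * \<kappa>"
    proof -
      have "ud e 0 = (\<lambda>x. of_real \<delta> * free_wave_d \<gamma> K e 0 x)" if e: "e \<in> Basis" for e
        using deriv_along_unique[OF along_u[OF e z, unfolded init] deriv_along_cmult[OF free_wave_deriv_along]] .
      then have "kinetic 0 = (\<Sum>e\<in>Basis. tint \<gamma> (\<lambda>x. \<delta>\<^sup>2 * (norm (free_wave_d \<gamma> K e 0 x))\<^sup>2))"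
        unfolding kinetic_def using \<delta> by (simp add: norm_mult power_mult_distrib)
      also have "\<dots> = \<delta>\<^sup>2 * \<kappa>"
        unfolding \<kappa>_def sum_distrib_left by (intro sum.cong refl tint_cmult_real continuous_intros cvd)
      finally show ?thesis .
    qed
    have small: "8 * mass 0 \<le> 1"
    proof -
      have "8 * mass 0 = \<delta>\<^sup>2 * (8 * M)" by (simp add: m)
      also have "\<dots> \<le> \<delta> * (8 * M)" using d2 M0 by (intro mult_right_mono) auto
      also have "\<dots> \<le> 1" using \<delta>1(2) \<delta> by (simp add: distrib_left)
      finally show ?thesis .
    qed
    have quart: "quartic t \<le> A * \<delta> ^ 4" if t: "t \<in> {0..T}" for t
    proof -
      have "quartic t \<le> 2 * c\<^sup>2 * (\<delta>\<^sup>2 * M)\<^sup>2 + 16 * (\<delta>\<^sup>2 * M) * (\<delta>\<^sup>2 * \<kappa> + \<delta> ^ 4 * q / 2 + c\<^sup>2 * (\<delta>\<^sup>2 * M)\<^sup>2)"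
        using quartic_bound[OF mu small t] unfolding m quart0 kin0 c_def .
      also have "\<dots> = \<delta> ^ 4 * (2 * c\<^sup>2 * M\<^sup>2 + 16 * M * (\<kappa> + \<delta>\<^sup>2 * (q / 2 + c\<^sup>2 * M\<^sup>2)))"
        by (simp add: power2_eq_square power4_eq_xxxx algebra_simps)
      also have "\<dots> \<le> \<delta> ^ 4 * A"
      proof -
        have "\<delta>\<^sup>2 * (q / 2 + c\<^sup>2 * M\<^sup>2) \<le> 1 * (q / 2 + c\<^sup>2 * M\<^sup>2)" using d2 q0 by (intro mult_right_mono) auto
        then have "16 * M * (\<kappa> + \<delta>\<^sup>2 * (q / 2 + c\<^sup>2 * M\<^sup>2)) \<le> 16 * M * (\<kappa> + q / 2 + c\<^sup>2 * M\<^sup>2)"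
          using M0 by (intro mult_left_mono) auto
        then show ?thesis unfolding A_def using \<delta> by (intro mult_left_mono) auto
      qed
      finally show ?thesis by (simp add: mult.commute)
    qed
    show "\<bar>- \<mu> * Im (tint \<gamma> (\<lambda>x. u T x * cnj (free_wave \<gamma> K T x)))
      - integral {0..T} (\<lambda>t. tint \<gamma> (\<lambda>x. norm (free_wave \<gamma> K t x) ^ 4)) * \<delta> ^ 3\<bar>
       \<le> T * (V * (2 * D + 3 * A + 3 * (V\<^sup>2 * M))) * \<delta> ^ 4"
      unfolding V_def M_def D_def by (rule first_order_bounds[OF K mu \<delta>(1) init quart A0])
  qed
qed

section \<open>Square integrable functions as a seminormed space\<close>

lemma L2_measurable: "f \<in> vecs (L2 \<gamma>) \<Longrightarrow> f \<in> borel_measurable (torus_measure \<gamma>)"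
  by (rule measurable_torus) (simp add: L2_def)

lemma L2_square_integrable: "f \<in> vecs (L2 \<gamma>) \<Longrightarrow> integrable (torus_measure \<gamma>) (\<lambda>x. (norm (f x))\<^sup>2)"
  by (simp add: L2_def)

lemma snorm_L2_square: "(snorm (L2 \<gamma>) f)\<^sup>2 = (LINT x|torus_measure \<gamma>. (norm (f x))\<^sup>2)"
  by (simp add: L2_def)

lemma snorm_L2_nonneg: "snorm (L2 \<gamma>) f \<ge> 0"
  by (simp add: L2_def)

lemma L2_product_integrable:
  assumes f: "f \<in> vecs (L2 \<gamma>)" and g: "g \<in> vecs (L2 \<gamma>)"
  shows "integrable (torus_measure \<gamma>) (\<lambda>x. norm (f x) * norm (g x))"
proof (rule Bochner_Integration.integrable_bound)
  show "integrable (torus_measure \<gamma>) (\<lambda>x. (norm (f x))\<^sup>2 + (norm (g x))\<^sup>2)"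
    using f g by (intro Bochner_Integration.integrable_add L2_square_integrable)
  show "(\<lambda>x. norm (f x) * norm (g x)) \<in> borel_measurable (torus_measure \<gamma>)"
    using L2_measurable[OF f] L2_measurable[OF g] by measurable
  have "norm (f x) * norm (g x) \<le> (norm (f x))\<^sup>2 + (norm (g x))\<^sup>2" for x
    using sum_squares_bound[of "norm (f x)" "norm (g x)"] mult_nonneg_nonneg[OF norm_ge_zero[of "f x"] norm_ge_zero[of "g x"]]
    by linarith
  then show "AE x in torus_measure \<gamma>. norm (norm (f x) * norm (g x)) \<le> norm ((norm (f x))\<^sup>2 + (norm (g x))\<^sup>2)"
    by (intro AE_I2) (simp add: abs_of_nonneg)
qed

lemma L2_Cauchy_Schwarz:
  assumes f: "f \<in> vecs (L2 \<gamma>)" and g: "g \<in> vecs (L2 \<gamma>)"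
  shows "(LINT x|torus_measure \<gamma>. norm (f x) * norm (g x)) \<le> snorm (L2 \<gamma>) f * snorm (L2 \<gamma>) g"
proof -
  let ?I = "LINT x|torus_measure \<gamma>. norm (f x) * norm (g x)"
  have I0: "?I \<ge> 0" by (intro Bochner_Integration.integral_nonneg) auto
  have "(2 * ?I)\<^sup>2 \<le> 4 * (snorm (L2 \<gamma>) f)\<^sup>2 * (snorm (L2 \<gamma>) g)\<^sup>2"
  proof (rule square_le_of_amgm)
    fix s :: real assume s: "s > 0"
    have "2 * ?I = (LINT x|torus_measure \<gamma>. 2 * (norm (f x) * norm (g x)))" by simp
    also have "\<dots> \<le> (LINT x|torus_measure \<gamma>. s * (norm (f x))\<^sup>2 + (norm (g x))\<^sup>2 / s)"
    proof (rule integral_mono)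
      show "integrable (torus_measure \<gamma>) (\<lambda>x. 2 * (norm (f x) * norm (g x)))"
        using L2_product_integrable[OF f g] by (rule integrable_mult_right)
      show "integrable (torus_measure \<gamma>) (\<lambda>x. s * (norm (f x))\<^sup>2 + (norm (g x))\<^sup>2 / s)"
        by (intro Bochner_Integration.integrable_add integrable_mult_right integrable_divide L2_square_integrable f g)
      fix x
      have "2 * (norm (f x) * norm (g x)) = 2 * (sqrt s * norm (f x)) * (norm (g x) / sqrt s)" using s by simp
      also have "\<dots> \<le> (sqrt s * norm (f x))\<^sup>2 + (norm (g x) / sqrt s)\<^sup>2" by (rule sum_squares_bound)
      also have "\<dots> = s * (norm (f x))\<^sup>2 + (norm (g x))\<^sup>2 / s" using s by (simp add: power_mult_distrib power_divide)
      finally show "2 * (norm (f x) * norm (g x)) \<le> s * (norm (f x))\<^sup>2 + (norm (g x))\<^sup>2 / s" .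
    qed
    also have "\<dots> = s * (snorm (L2 \<gamma>) f)\<^sup>2 + (snorm (L2 \<gamma>) g)\<^sup>2 / s"
      using L2_square_integrable[OF f] L2_square_integrable[OF g] by (simp add: snorm_L2_square)
    finally show "2 * ?I \<le> s * (snorm (L2 \<gamma>) f)\<^sup>2 + (snorm (L2 \<gamma>) g)\<^sup>2 / s" .
  qed (use I0 in auto)
  then have "?I\<^sup>2 \<le> (snorm (L2 \<gamma>) f * snorm (L2 \<gamma>) g)\<^sup>2" by (simp add: power_mult_distrib)
  then show ?thesis by (rule power2_le_imp_le) (intro mult_nonneg_nonneg snorm_L2_nonneg)
qed

lemma seminormed_space_L2: "seminormed_space (L2 \<gamma>)"
proof (rule seminormed_spaceI)
  show "0 \<in> vecs (L2 \<gamma>)" by (simp add: L2_def torus_periodic_def zero_fun_def)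
  fix f assume f: "f \<in> vecs (L2 \<gamma>)"
  show "snorm (L2 \<gamma>) f \<ge> 0" by (rule snorm_L2_nonneg)
  show "c *\<^sub>R f \<in> vecs (L2 \<gamma>)" for c
    using f by (auto simp: L2_def torus_periodic_def scaleR_fun_def power_mult_distrib)
  show "snorm (L2 \<gamma>) (c *\<^sub>R f) \<le> \<bar>c\<bar> * snorm (L2 \<gamma>) f" for c
    by (simp add: L2_def scaleR_fun_def power_mult_distrib real_sqrt_mult)
  fix g assume g: "g \<in> vecs (L2 \<gamma>)"
  have le: "(norm (f x + g x))\<^sup>2 \<le> (norm (f x))\<^sup>2 + 2 * (norm (f x) * norm (g x)) + (norm (g x))\<^sup>2" for x
  proof -
    have "(norm (f x + g x))\<^sup>2 \<le> (norm (f x) + norm (g x))\<^sup>2" by (intro power_mono norm_triangle_ineq) auto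
    then show ?thesis by (simp add: power2_sum)
  qed
  have int: "integrable (torus_measure \<gamma>) (\<lambda>x. (norm (f x))\<^sup>2 + 2 * (norm (f x) * norm (g x)) + (norm (g x))\<^sup>2)"
    using L2_square_integrable[OF f] L2_square_integrable[OF g] L2_product_integrable[OF f g] by simp
  have int': "integrable (torus_measure \<gamma>) (\<lambda>x. (norm (f x + g x))\<^sup>2)"
  proof (rule Bochner_Integration.integrable_bound[OF int])
    show "(\<lambda>x. (norm (f x + g x))\<^sup>2) \<in> borel_measurable (torus_measure \<gamma>)"
      using L2_measurable[OF f] L2_measurable[OF g] by measurable
    show "AE x in torus_measure \<gamma>. norm ((norm (f x + g x))\<^sup>2) \<le> norm ((norm (f x))\<^sup>2 + 2 * (norm (f x) * norm (g x)) + (norm (g x))\<^sup>2)"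
      using le by (intro AE_I2) (simp add: abs_of_nonneg)
  qed
  then show "f + g \<in> vecs (L2 \<gamma>)" using f g by (auto simp: L2_def torus_periodic_def plus_fun_def)
  have "(snorm (L2 \<gamma>) (f + g))\<^sup>2 \<le> (LINT x|torus_measure \<gamma>. (norm (f x))\<^sup>2 + 2 * (norm (f x) * norm (g x)) + (norm (g x))\<^sup>2)"
    unfolding snorm_L2_square plus_fun_def by (rule integral_mono[OF int' int le])
  also have "\<dots> = (snorm (L2 \<gamma>) f)\<^sup>2 + 2 * (LINT x|torus_measure \<gamma>. norm (f x) * norm (g x)) + (snorm (L2 \<gamma>) g)\<^sup>2"
    using L2_square_integrable[OF f] L2_square_integrable[OF g] L2_product_integrable[OF f g] by (simp add: snorm_L2_square)
  also have "\<dots> \<le> (snorm (L2 \<gamma>) f + snorm (L2 \<gamma>) g)\<^sup>2"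
    using L2_Cauchy_Schwarz[OF f g] by (simp add: power2_sum)
  finally show "snorm (L2 \<gamma>) (f + g) \<le> snorm (L2 \<gamma>) f + snorm (L2 \<gamma>) g"
    by (rule power2_le_imp_le) (intro add_nonneg_nonneg snorm_L2_nonneg)
qed

lemma bounded_functional_pairing:
  assumes T: "T \<ge> 0" and g: "g \<in> vecs (L2 \<gamma>)"
  shows "bounded_functional (curve_space T (L2 \<gamma>)) (\<lambda>w. a * Im (LINT x|torus_measure \<gamma>. w T x * cnj (g x))) (\<bar>a\<bar> * snorm (L2 \<gamma>) g)"
  unfolding bounded_functional_def
proof (intro conjI ballI allI)
  have Tin: "T \<in> {0..T}" using T by simp
  have wL: "w T \<in> vecs (L2 \<gamma>)" if "w \<in> vecs (curve_space T (L2 \<gamma>))" for w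
    using that Tin by (simp add: curve_space_def)
  have int: "integrable (torus_measure \<gamma>) (\<lambda>x. f x * cnj (g x))" if f: "f \<in> vecs (L2 \<gamma>)" for f
  proof (rule Bochner_Integration.integrable_bound[OF L2_product_integrable[OF f g]])
    have "(\<lambda>x. cnj (g x)) \<in> borel_measurable (torus_measure \<gamma>)"
      using L2_measurable[OF g] by (rule measurable_compose) (intro borel_measurable_continuous_onI continuous_intros)
    then show "(\<lambda>x. f x * cnj (g x)) \<in> borel_measurable (torus_measure \<gamma>)"
      using L2_measurable[OF f] by (intro borel_measurable_times)
  qed (simp add: norm_mult)
  show "\<bar>a\<bar> * snorm (L2 \<gamma>) g \<ge> 0" using snorm_L2_nonneg by simp
  fix w assume w: "w \<in> vecs (curve_space T (L2 \<gamma>))"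
  show "a * Im (LINT x|torus_measure \<gamma>. (b *\<^sub>R w) T x * cnj (g x)) = b * (a * Im (LINT x|torus_measure \<gamma>. w T x * cnj (g x)))" for b
    by (simp add: scaleR_fun_def)
  have "\<bar>a * Im (LINT x|torus_measure \<gamma>. w T x * cnj (g x))\<bar> \<le> \<bar>a\<bar> * norm (LINT x|torus_measure \<gamma>. w T x * cnj (g x))"
    unfolding abs_mult by (intro mult_left_mono abs_Im_le_cmod) auto
  also have "\<dots> \<le> \<bar>a\<bar> * (LINT x|torus_measure \<gamma>. norm (w T x) * norm (g x))"
    using integral_norm_bound[of "torus_measure \<gamma>" "\<lambda>x. w T x * cnj (g x)"] by (intro mult_left_mono) (auto simp: norm_mult)
  also have "\<dots> \<le> \<bar>a\<bar> * (snorm (L2 \<gamma>) (w T) * snorm (L2 \<gamma>) g)"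
    by (intro mult_left_mono L2_Cauchy_Schwarz wL w g) auto
  also have "\<dots> \<le> \<bar>a\<bar> * (snorm (curve_space T (L2 \<gamma>)) w * snorm (L2 \<gamma>) g)"
    using seminormed_space_curve(2)[OF seminormed_space_L2 T w Tin]
    by (intro mult_left_mono mult_right_mono snorm_L2_nonneg) auto
  finally show "\<bar>a * Im (LINT x|torus_measure \<gamma>. w T x * cnj (g x))\<bar> \<le> \<bar>a\<bar> * snorm (L2 \<gamma>) g * snorm (curve_space T (L2 \<gamma>)) w"
    by (simp add: mult_ac)
  fix w' assume w': "w' \<in> vecs (curve_space T (L2 \<gamma>))"
  show "a * Im (LINT x|torus_measure \<gamma>. (w + w') T x * cnj (g x)) =
      a * Im (LINT x|torus_measure \<gamma>. w T x * cnj (g x)) + a * Im (LINT x|torus_measure \<gamma>. w' T x * cnj (g x))"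
    using int[OF wL[OF w]] int[OF wL[OF w']] by (simp add: distrib_left distrib_right)
qed

section \<open>Failure of third order differentiability\<close>

text \<open>
  The functional is, up to sign, the imaginary part of the pairing with \<open>v(T)\<close>; the linear term
  \<open>\<delta>\<parallel>\<phi>\<parallel>\<^sup>2\<close> of the expansion is real and disappears. Its norm is
  \<open>\<parallel>\<phi>\<parallel>\<close>, so the cubic coefficient is at most
  \<open>B\<parallel>\<phi>\<parallel>\<^sup>4\<close>.
\<close>

theorem nls_flow_not_C3:
  assumes \<gamma>: "\<gamma> > 0" and wa: "well_approximable \<gamma>" and mu: "\<bar>\<mu>\<bar> = 1" and T: "T > 0" and r: "r > 0"
    and S: "\<And>u0. u0 \<in> snorm_cball (L2 \<gamma>) r \<Longrightarrow> S u0 \<in> vecs (curve_space T (L2 \<gamma>))"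
    and flow: "extends_nls_flow \<gamma> \<mu> T r S"
  shows "\<not> C3_near (L2 \<gamma>) (curve_space T (L2 \<gamma>)) S 0"
proof
  assume "C3_near (L2 \<gamma>) (curve_space T (L2 \<gamma>)) S 0"
  from C3_near_cubic_coefficient[OF seminormed_space_L2 seminormed_space_curve(1)[OF seminormed_space_L2 less_imp_le[OF T]] this]
  obtain B where B: "\<And>h \<Lambda> L X C d. h \<in> vecs (L2 \<gamma>) \<Longrightarrow> bounded_functional (curve_space T (L2 \<gamma>)) \<Lambda> L \<Longrightarrow> d > 0 \<Longrightarrow>
      (\<And>s. 0 < s \<Longrightarrow> s < d \<Longrightarrow> \<bar>\<Lambda> (S (s *\<^sub>R h)) - X * s ^ 3\<bar> \<le> C * s ^ 4) \<Longrightarrow> \<bar>X\<bar> \<le> B * L * snorm (L2 \<gamma>) h ^ 3"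
    by blast
  obtain K where K: "finite K" and big: "integral {0..T} (\<lambda>t. tint \<gamma> (\<lambda>x. norm (free_wave \<gamma> K t x) ^ 4))
      > B * (4 * pi\<^sup>2 * \<gamma> * real (card K))\<^sup>2"
    using free_wave_strichartz_ratio_unbounded[OF \<gamma> wa T] by blast
  define X where "X = integral {0..T} (\<lambda>t. tint \<gamma> (\<lambda>x. norm (free_wave \<gamma> K t x) ^ 4))"
  \<comment> \<open>the common \<open>L\<^sup>2\<close> norm of \<open>v(t)\<close> for all \<open>t\<close>\<close>
  define n where "n = sqrt (4 * pi\<^sup>2 * \<gamma> * real (card K))"
  have n0: "n \<ge> 0" using \<gamma> by (simp add: n_def)
  have sv: "snorm (L2 \<gamma>) (free_wave \<gamma> K t) = n" for t unfolding n_def by (rule snorm_free_wave[OF \<gamma> K])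
  have cv: "continuous_on UNIV (free_wave \<gamma> K t)" for t unfolding free_wave_def by (rule continuous_on_trig_poly)
  have vL: "free_wave \<gamma> K t \<in> vecs (L2 \<gamma>)" for t by (rule free_wave_in_L2[OF \<gamma>])
  obtain C d where d: "d > 0" and C: "\<And>\<delta> u. 0 < \<delta> \<Longrightarrow> \<delta> < d \<Longrightarrow> nls_smooth_solution \<gamma> \<mu> T (\<lambda>x. of_real \<delta> * free_wave \<gamma> K 0 x) u \<Longrightarrow>
    \<bar>- \<mu> * Im (tint \<gamma> (\<lambda>x. u T x * cnj (free_wave \<gamma> K T x))) - X * \<delta> ^ 3\<bar> \<le> C * \<delta> ^ 4"
    using nls_cubic_expansion[OF \<gamma> T K mu] unfolding X_def by blast
  have "\<bar>X\<bar> \<le> B * (\<bar>- \<mu>\<bar> * snorm (L2 \<gamma>) (free_wave \<gamma> K T)) * snorm (L2 \<gamma>) (free_wave \<gamma> K 0) ^ 3"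
  proof (rule B[OF vL bounded_functional_pairing[OF less_imp_le[OF T] vL]])
    show "min d (r / (n + 1)) > 0" using d r n0 by simp
    fix s :: real assume s: "0 < s" "s < min d (r / (n + 1))"
    define u0 where "u0 = s *\<^sub>R free_wave \<gamma> K 0"
    have u0: "u0 = (\<lambda>x. of_real s * free_wave \<gamma> K 0 x)" by (simp add: u0_def scaleR_fun_def scaleR_conv_of_real)
    also have "\<dots> = trig_poly \<gamma> K (\<lambda>k. of_real s * exp (- \<i> * of_real ((norm (freq \<gamma> k))\<^sup>2 * 0)))"
      by (simp add: free_wave_def trig_poly_def sum_distrib_left mult.assoc fun_eq_iff)
    finally have smooth: "smooth_torus \<gamma> u0" using smooth_torus_trig_poly[OF \<gamma>] by simp
    have "snorm (L2 \<gamma>) u0 = s * n" unfolding u0_def using snorm_scaleR[OF seminormed_space_L2 vL] s by (simp add: sv)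
    also have "\<dots> \<le> s * (n + 1)" using s by simp
    also have "\<dots> \<le> r" using s n0 by (simp add: pos_less_divide_eq less_imp_le)
    finally have u0r: "snorm (L2 \<gamma>) u0 \<le> r" .
    have "u0 \<in> snorm_cball (L2 \<gamma>) r"
      using u0r vecs_scaleR[OF seminormed_space_L2 vL] by (simp add: snorm_cball_def u0_def)
    then have ST: "S u0 T \<in> vecs (L2 \<gamma>)" using S T by (simp add: curve_space_def)
    obtain u where u: "nls_smooth_solution \<gamma> \<mu> T u0 u" and ae: "\<And>t. t \<in> {0..T} \<Longrightarrow> AE x in torus_measure \<gamma>. S u0 t x = u t x"
      using flow smooth u0r unfolding extends_nls_flow_def by blast
    obtain ut ud udd udt where "classical_nls \<gamma> \<mu> T u ut ud udd udt"
      using nls_smooth_solution_classical[OF \<gamma> T u] by blast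
    then interpret classical_nls \<gamma> \<mu> T u ut ud udd udt .
    have cu: "continuous_on UNIV (u T)" using T by (intro slice_u) simp
    have cuv: "continuous_on UNIV (\<lambda>x. u T x * cnj (free_wave \<gamma> K T x))" by (intro continuous_intros cu cv)
    have "(LINT x|torus_measure \<gamma>. S u0 T x * cnj (free_wave \<gamma> K T x)) = (LINT x|torus_measure \<gamma>. u T x * cnj (free_wave \<gamma> K T x))"
    proof (rule integral_cong_AE)
      have "(\<lambda>x. cnj (free_wave \<gamma> K T x)) \<in> borel_measurable (torus_measure \<gamma>)"
        by (intro measurable_torus borel_measurable_continuous_onI continuous_intros cv)
      then show "(\<lambda>x. S u0 T x * cnj (free_wave \<gamma> K T x)) \<in> borel_measurable (torus_measure \<gamma>)"
        using L2_measurable[OF ST] by (intro borel_measurable_times)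
      show "(\<lambda>x. u T x * cnj (free_wave \<gamma> K T x)) \<in> borel_measurable (torus_measure \<gamma>)"
        by (intro measurable_torus borel_measurable_continuous_onI cuv)
      show "AE x in torus_measure \<gamma>. S u0 T x * cnj (free_wave \<gamma> K T x) = u T x * cnj (free_wave \<gamma> K T x)"
        using ae[of T] T by auto
    qed
    also have "\<dots> = tint \<gamma> (\<lambda>x. u T x * cnj (free_wave \<gamma> K T x))" by (rule torus_integral_eq[OF cuv])
    finally show "\<bar>- \<mu> * Im (LINT x|torus_measure \<gamma>. S (s *\<^sub>R free_wave \<gamma> K 0) T x * cnj (free_wave \<gamma> K T x)) - X * s ^ 3\<bar> \<le> C * s ^ 4"
      using C[OF s(1) _ u[unfolded u0]] s(2) unfolding u0_def by simp
  qed
  also have "\<dots> = B * (n\<^sup>2)\<^sup>2" using mu by (simp add: sv power2_eq_square power3_eq_cube)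
  also have "n\<^sup>2 = 4 * pi\<^sup>2 * \<gamma> * real (card K)" using \<gamma> by (simp add: n_def)
  finally show False using big unfolding X_def by linarith
qed

theorem theorem1p4:
  shows
    "(\<forall>\<gamma>>0. well_approximable \<gamma> \<longrightarrow> (\<forall>T>0. \<not> L4_strichartz \<gamma> T)) \<and>
     (\<forall>\<gamma>>0. well_approximable \<gamma> \<longrightarrow>
        (\<forall>\<mu>\<in>{1, -1}. \<forall>T>0. \<forall>r>0. \<forall>S.
           (\<forall>u0\<in>snorm_cball (L2 \<gamma>) r. S u0 \<in> vecs (curve_space T (L2 \<gamma>))) \<and>
           snorm_continuous_on (L2 \<gamma>) (curve_space T (L2 \<gamma>)) (snorm_cball (L2 \<gamma>) r) S \<and>
           extends_nls_flow \<gamma> \<mu> T r S \<longrightarrow>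
           \<not> C3_near (L2 \<gamma>) (curve_space T (L2 \<gamma>)) S 0)) \<and>
     {\<gamma>::real. \<gamma> > 0 \<and> \<not> well_approximable \<gamma>} \<in> null_sets lebesgue"
proof (intro conjI allI impI ballI)
  fix \<gamma> T :: real assume "\<gamma> > 0" "well_approximable \<gamma>" "T > 0"
  then show "\<not> L4_strichartz \<gamma> T" by (rule not_L4_strichartz)
next
  fix \<gamma> \<mu> T r :: real and S
  assume "\<gamma> > 0" "well_approximable \<gamma>" "\<mu> \<in> {1, -1}" "T > 0" "r > 0"
    and S: "(\<forall>u0\<in>snorm_cball (L2 \<gamma>) r. S u0 \<in> vecs (curve_space T (L2 \<gamma>))) \<and>
           snorm_continuous_on (L2 \<gamma>) (curve_space T (L2 \<gamma>)) (snorm_cball (L2 \<gamma>) r) S \<and>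
           extends_nls_flow \<gamma> \<mu> T r S"
  moreover from this have "\<bar>\<mu>\<bar> = 1" by auto
  ultimately show "\<not> C3_near (L2 \<gamma>) (curve_space T (L2 \<gamma>)) S 0"
    using nls_flow_not_C3[of \<gamma> \<mu> T r S] S by blast
next
  show "{\<gamma>::real. \<gamma> > 0 \<and> \<not> well_approximable \<gamma>} \<in> null_sets lebesgue"
    by (rule null_sets_not_well_approximable)
qed

end
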